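(* Let $H$ and $U$ be Hilbert spaces, let $A$ generate a $C_0$ semigroup on $H$, let $B\in\mathcal{L}(U;H)$, and let $T>0$. Let $\mathcal{G}$ be a closed vector subspace of $L^2(0,T;U)$, let $\mathcal{W}$ be a closed vector subspace of $L^2(0,T;H)$, and let $E$ be a finite dimensional subspace of $H$. Assume the following unique continuation property: if, for some $z_T\in H$, $g\in\mathcal{G}$ and $w\in\mathcal{W}$, the solution $z$ of $$z'+A^*z=w \ \text{ for } t\in(0,T),\qquad z(T)=z_T,$$ satisfies $B^*z=g$ in $(0,T)$, then $z_T=0$, $g=0$ and $w=0$. Assume moreover that $\mathcal{W}$ is of finite dimension. Then for any $y_0,y_1\in H$, $\varepsilon>0$, $g_*\in\mathcal{G}$ and $w_*\in\mathcal{W}$, there exists a control function $u\in L^2(0,T;U)$ such that $$\mathbb{P}_{\mathcal{G}}u=g_*$$ and the solution $y$ of $$y'=Ay+Bu \ \text{ for } t\in(0,T),\qquad y(0)=y_0,$$ satisfies $$\|y(T)-y_1\|_H\le\varepsilon,\qquad \mathbb{P}_{\mathcal{W}}y=w_*,\qquad \mathbb{P}_E\,y(T)=\mathbb{P}_E\,y_1.$$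
   Context: $\mathbb{P}_{\mathcal{G}}$ denotes the orthogonal projection onto $\mathcal{G}$ in $L^2(0,T;U)$, $\mathbb{P}_{\mathcal{W}}$ the orthogonal projection onto $\mathcal{W}$ in $L^2(0,T;H)$, and $\mathbb{P}_E$ the orthogonal projection onto $E$ in $H$. Solutions of the evolution equations are the usual mild (semigroup) solutions, which belong to $C^0([0,T];H)$; the equation for $z$ is solved backward in time from $z(T)=z_T$. $A^*$, $B^*$ denote adjoints. *)

theory Defs
  imports "HOL-Analysis.Analysis"
begin

text \<open>Hilbert spaces are types of sort \<open>{real_inner, complete_space}\<close>, not assumed separable.
  The complex case is covered by restriction of scalars with the inner product
  \<open>Re \<langle>x, y\<rangle>\<close>: for complex-linear operators and complex subspaces, adjoints, orthogonality
  and orthogonal projections are the same for both inner products.\<close>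

section \<open>Strong measurability and the Bochner integral\<close>

text \<open>The library's \<^const>\<open>has_bochner_integral\<close> requires a second countable target space;
  the following is the same definition with Borel measurability replaced by strong
  measurability, which is the appropriate notion for non-separable targets.\<close>

definition strongly_measurable :: "'a measure \<Rightarrow> ('a \<Rightarrow> 'b::real_normed_vector) \<Rightarrow> bool" where
  "strongly_measurable M f \<longleftrightarrow>
     (\<exists>s. (\<forall>i. simple_function M (s i)) \<and> (AE x in M. (\<lambda>i. s i x) \<longlonglongrightarrow> f x))"

definition has_strong_integral :: "'a measure \<Rightarrow> ('a \<Rightarrow> 'b::real_normed_vector) \<Rightarrow> 'b \<Rightarrow> bool" where
  "has_strong_integral M f v \<longleftrightarrow> strongly_measurable M f \<and>
     (\<exists>s. (\<forall>i. Bochner_Integration.simple_bochner_integrable M (s i)) \<and>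
          (\<lambda>i. \<integral>\<^sup>+x. ennreal (norm (f x - s i x)) \<partial>M) \<longlonglongrightarrow> 0 \<and>
          (\<lambda>i. Bochner_Integration.simple_bochner_integral M (s i)) \<longlonglongrightarrow> v)"

section \<open>The space of square integrable functions on (0,T)\<close>

text \<open>Elements of \<open>L\<^sup>2(0,T;X)\<close> are represented by functions, with equality almost everywhere on
  \<open>[0,T]\<close>; values outside \<open>[0,T]\<close> are irrelevant.\<close>

abbreviation time_measure :: "real \<Rightarrow> real measure" where
  "time_measure T \<equiv> lebesgue_on {0..T}"

definition L2 :: "real \<Rightarrow> (real \<Rightarrow> 'b::real_inner) set" where
  "L2 T = {f. strongly_measurable (time_measure T) f \<and>
              integrable (time_measure T) (\<lambda>t. (norm (f t))\<^sup>2)}"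

definition L2_inner :: "real \<Rightarrow> (real \<Rightarrow> 'b::real_inner) \<Rightarrow> (real \<Rightarrow> 'b) \<Rightarrow> real" where
  "L2_inner T f g = (\<integral>t. f t \<bullet> g t \<partial>time_measure T)"

definition L2_norm :: "real \<Rightarrow> (real \<Rightarrow> 'b::real_inner) \<Rightarrow> real" where
  "L2_norm T f = sqrt (L2_inner T f f)"

text \<open>The last clause, applied to constant sequences, also makes \<open>V\<close> invariant under equality
  almost everywhere.\<close>

definition L2_closed_subspace :: "real \<Rightarrow> (real \<Rightarrow> 'b::real_inner) set \<Rightarrow> bool" where
  "L2_closed_subspace T V \<longleftrightarrow> V \<subseteq> L2 T \<and> (\<lambda>t. 0) \<in> V \<and>
     (\<forall>f\<in>V. \<forall>g\<in>V. (\<lambda>t. f t + g t) \<in> V) \<and>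
     (\<forall>c. \<forall>f\<in>V. (\<lambda>t. c *\<^sub>R f t) \<in> V) \<and>
     (\<forall>F. \<forall>f\<in>L2 T. (\<forall>n. F n \<in> V) \<and> (\<lambda>n. L2_norm T (\<lambda>t. F n t - f t)) \<longlonglongrightarrow> 0 \<longrightarrow> f \<in> V)"

definition L2_finite_dim :: "real \<Rightarrow> (real \<Rightarrow> 'b::real_inner) set \<Rightarrow> bool" where
  "L2_finite_dim T V \<longleftrightarrow>
     (\<exists>Bs. finite Bs \<and> Bs \<subseteq> V \<and>
        (\<forall>f\<in>V. \<exists>c. AE t in time_measure T. f t = (\<Sum>b\<in>Bs. c b *\<^sub>R b t)))"

text \<open>\<open>L2_proj T V f p\<close>: \<open>p\<close> represents the orthogonal projection of \<open>f \<in> L\<^sup>2\<close> onto \<open>V\<close>.\<close>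

definition L2_proj :: "real \<Rightarrow> (real \<Rightarrow> 'b::real_inner) set \<Rightarrow> (real \<Rightarrow> 'b) \<Rightarrow> (real \<Rightarrow> 'b) \<Rightarrow> bool" where
  "L2_proj T V f p \<longleftrightarrow> f \<in> L2 T \<and> p \<in> V \<and> (\<forall>v\<in>V. L2_inner T (\<lambda>t. f t - p t) v = 0)"

section \<open>Finite dimensional subspaces and orthogonal projections\<close>

definition finite_dim_subspace :: "'a::real_vector set \<Rightarrow> bool" where
  "finite_dim_subspace E \<longleftrightarrow> (\<exists>b. finite b \<and> E = span b)"

definition orth_proj :: "'a::real_inner set \<Rightarrow> 'a \<Rightarrow> 'a" where
  "orth_proj E x = (THE p. p \<in> E \<and> (\<forall>e\<in>E. orthogonal (x - p) e))"

section \<open>Semigroups, generators and mild solutions\<close>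

definition C0_semigroup :: "(real \<Rightarrow> 'h::real_normed_vector \<Rightarrow> 'h) \<Rightarrow> bool" where
  "C0_semigroup S \<longleftrightarrow> (\<forall>t\<ge>0. bounded_linear (S t)) \<and> (\<forall>x. S 0 x = x) \<and>
     (\<forall>s\<ge>0. \<forall>t\<ge>0. \<forall>x. S (s + t) x = S s (S t x)) \<and>
     (\<forall>x. ((\<lambda>t. S t x) \<longlongrightarrow> x) (at_right 0))"

text \<open>Unbounded operators are identified with their graphs.\<close>

definition generator :: "(real \<Rightarrow> 'h::real_normed_vector \<Rightarrow> 'h) \<Rightarrow> ('h \<times> 'h) set" where
  "generator S = {(x, v). ((\<lambda>h. (S h x - x) /\<^sub>R h) \<longlongrightarrow> v) (at_right 0)}"

definition generates :: "('h::real_normed_vector \<times> 'h) set \<Rightarrow> (real \<Rightarrow> 'h \<Rightarrow> 'h) \<Rightarrow> bool" where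
  "generates A S \<longleftrightarrow> C0_semigroup S \<and> generator S = A"

definition adjoint_op :: "('h::real_inner \<times> 'h) set \<Rightarrow> ('h \<times> 'h) set" where
  "adjoint_op A = {(z, v). \<forall>(x, a)\<in>A. a \<bullet> z = x \<bullet> v}"

text \<open>Mild solution on \<open>[0,T]\<close> of \<open>y' = A y + f\<close>, \<open>y(0) = y0\<close>, given by Duhamel's formula
  \<open>y(t) = S(t) y0 + \<integral>\<^sub>0\<^sup>t S(t-s) f(s) ds\<close> with \<open>S\<close> the semigroup generated by \<open>A\<close>
  (which is uniquely determined on \<open>[0,\<infinity>)\<close>).\<close>

definition mild_solution ::
    "real \<Rightarrow> ('h::real_inner \<times> 'h) set \<Rightarrow> (real \<Rightarrow> 'h) \<Rightarrow> 'h \<Rightarrow> (real \<Rightarrow> 'h) \<Rightarrow> bool" where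
  "mild_solution T A f y0 y \<longleftrightarrow>
     (\<exists>S. generates A S \<and>
        (\<forall>t\<in>{0..T}. has_strong_integral (lebesgue_on {0..t}) (\<lambda>s. S (t - s) (f s)) (y t - S t y0)))"

text \<open>Mild solution on \<open>[0,T]\<close> of \<open>z' + A z = w\<close>, \<open>z(T) = zT\<close>: the time reversal
  \<open>v(t) = z(T - t)\<close> solves \<open>v' = A v - w(T - t)\<close>, \<open>v(0) = zT\<close>.\<close>

definition backward_mild_solution ::
    "real \<Rightarrow> ('h::real_inner \<times> 'h) set \<Rightarrow> (real \<Rightarrow> 'h) \<Rightarrow> 'h \<Rightarrow> (real \<Rightarrow> 'h) \<Rightarrow> bool" where
  "backward_mild_solution T A w zT z \<longleftrightarrow>
     mild_solution T A (\<lambda>t. - w (T - t)) zT (\<lambda>t. z (T - t))"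

end

theory Submission
  imports Defs
begin

text \<open>The states and adjoint states are linked by a duality identity. Let \<open>L v\<close> be the final state and
\<open>y\<^sub>v\<close> the trajectory started at \<open>0\<close> with control \<open>v\<close>, and let \<open>z\<close> solve \<open>z' + A\<^sup>* z = - w\<close>, \<open>z(T) = \<zeta>\<close>.
Then \<open>L v \<bullet> \<zeta> + \<langle>y\<^sub>v, w\<rangle> = \<langle>v, B\<^sup>* z\<rangle>\<close>, the scalar products on the right and of \<open>y\<^sub>v\<close> with \<open>w\<close> being
those of \<open>L\<^sup>2\<close>. If the left-hand side vanishes for all \<open>v\<close> orthogonal to \<open>G\<close>, then \<open>B\<^sup>* z\<close> belongs to
the double orthogonal of \<open>G\<close>, which is \<open>G\<close> because \<open>G\<close> is closed, and the unique continuation property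
yields \<open>\<zeta> = 0\<close> and \<open>w = 0\<close> (\<open>adjoint_data_zero_if_orthogonal\<close>).

A control with projection \<open>g\<^sub>0\<close> on \<open>G\<close> has the form \<open>g\<^sub>0 + v\<close> with \<open>v\<close> orthogonal to \<open>G\<close>, so everything
is a statement about the linear map \<open>v \<mapsto> L v\<close> and, by finite dimension of \<open>W\<close> and \<open>E\<close>, about finitely
many functionals: the products of \<open>y\<^sub>v\<close> with a spanning family of \<open>W\<close>, and of \<open>L v\<close> with a spanning
family of \<open>E\<close>. A linear relation between these functionals is a vanishing left-hand side of the
duality identity with \<open>\<zeta> \<in> E\<close> and \<open>w \<in> W\<close>; hence \<open>\<zeta> = 0\<close> and \<open>w = 0\<close>, and the prescribed values, which are
products with the same vectors, satisfy the relation as well. So the finite linear system is solvable.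

On the subspace \<open>N\<close> of controls on which all the functionals vanish, \<open>L\<close> has dense range in the orthogonal complement of \<open>E\<close>: a vector \<open>q\<close> of this
complement orthogonal to \<open>L N\<close> defines a functional \<open>L v \<bullet> q\<close> which vanishes on \<open>N\<close>, hence is a
combination of the finitely many ones, and the uniqueness just established puts \<open>q\<close> into \<open>E\<close>, so
\<open>q = 0\<close>. This is \<open>approximate_range_with_constraints\<close>.

Three analytic facts support the argument. The adjoints of the operators of a semigroup form a
strongly continuous semigroup generated by the adjoint of the generator (\<open>generates_adjoint\<close>).
The space \<open>L\<^sup>2\<close> of strongly measurable functions is complete (\<open>square_integrable_complete\<close>), which
provides the projection onto \<open>G\<close>. The duality identity is an exchange of the order of integration in
Duhamel's formula (\<open>convolution_Fubini\<close>, \<open>state_adjoint_duality\<close>). Vectors given by integrals are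
handled through their scalar products with fixed vectors, that is, by means of the Riesz
representation theorem, so that only integrals of real functions are computed.\<close>

section \<open>Riesz representation and orthogonal projection\<close>

text \<open>A quadratic polynomial that is minimal at \<open>0\<close> has vanishing derivative there; this is how
the minimum of the energy in the Riesz theorem becomes a linear equation.\<close>

lemma linear_coefficient_zero:
  fixes a b :: real
  assumes nonneg: "\<And>c. 0 \<le> c * a + c\<^sup>2 / 2 * b" and b: "0 \<le> b"
  shows "a = 0"
proof -
  define t where "t = 1 + b"
  have t: "t > 0" "b / t \<le> 1" using b by (auto simp: t_def)
  have "(- a / t)\<^sup>2 / 2 * b = (a\<^sup>2 / t) * (b / t) / 2"
    by (simp add: power2_eq_square)
  also have "\<dots> \<le> (a\<^sup>2 / t) * 1 / 2"
    using t by (intro divide_right_mono mult_left_mono) auto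
  finally have "0 \<le> - a / t * a + (a\<^sup>2 / t) * 1 / 2" using nonneg[of "- a / t"] by linarith
  then have "a\<^sup>2 / t \<le> 0" by (simp add: power2_eq_square)
  then show ?thesis using t by (simp add: divide_le_0_iff)
qed

text \<open>The Riesz theorem is needed for subspaces of a Hilbert space and for subspaces of \<open>L\<^sup>2\<close>, whose
elements are functions with equality almost everywhere and so do not form a type with an inner
product. The locale asks only for the operation \<open>x + c y\<close> on a set and for a symmetric, positive
semidefinite bilinear form.\<close>

locale prehilbert_set =
  fixes V :: "'v set" and axpy :: "'v \<Rightarrow> real \<Rightarrow> 'v \<Rightarrow> 'v" and ip :: "'v \<Rightarrow> 'v \<Rightarrow> real"
  assumes nonempty: "V \<noteq> {}"
    and axpy_closed: "x \<in> V \<Longrightarrow> y \<in> V \<Longrightarrow> axpy x c y \<in> V"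
    and ip_axpy: "x \<in> V \<Longrightarrow> y \<in> V \<Longrightarrow> z \<in> V \<Longrightarrow> ip (axpy x c y) z = ip x z + c * ip y z"
    and ip_commute: "x \<in> V \<Longrightarrow> y \<in> V \<Longrightarrow> ip x y = ip y x"
    and ip_nonneg: "x \<in> V \<Longrightarrow> 0 \<le> ip x x"
begin

lemma ip_axpy_right: "x \<in> V \<Longrightarrow> y \<in> V \<Longrightarrow> z \<in> V \<Longrightarrow> ip z (axpy x c y) = ip z x + c * ip z y"
  by (metis axpy_closed ip_axpy ip_commute)

lemma ip_axpy_self:
  "x \<in> V \<Longrightarrow> y \<in> V \<Longrightarrow> ip (axpy x c y) (axpy x c y) = ip x x + 2 * c * ip x y + c\<^sup>2 * ip y y"
  by (simp add: ip_axpy ip_axpy_right axpy_closed ip_commute[of y x] power2_eq_square algebra_simps)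

lemma Cauchy_Schwarz:
  assumes x: "x \<in> V" and y: "y \<in> V"
  shows "\<bar>ip x y\<bar> \<le> sqrt (ip x x) * sqrt (ip y y)"
proof -
  have q: "0 \<le> ip x x + 2 * c * ip x y + c\<^sup>2 * ip y y" for c
    using ip_axpy_self[OF x y] ip_nonneg[OF axpy_closed[OF x y]] by metis
  have "(ip x y)\<^sup>2 \<le> ip x x * ip y y"
  proof (cases "ip y y = 0")
    case True
    have "ip x y = 0"
    proof (rule ccontr)
      assume "ip x y \<noteq> 0"
      then show False
        using q[of "- (ip x x + 1) / (2 * ip x y)"] True by (simp add: field_simps)
    qed
    then show ?thesis using True by simp
  next
    case False
    then have "ip y y > 0" using ip_nonneg[OF y] by simp
    then show ?thesis
      using q[of "- ip x y / ip y y"] by (simp add: field_simps power2_eq_square)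
  qed
  then show ?thesis
    by (metis real_sqrt_abs real_sqrt_le_iff real_sqrt_mult)
qed

text \<open>The representing element minimizes the energy \<open>ip x x / 2 - \<phi> x\<close>. By the parallelogram identity
a minimizing sequence is Cauchy, and choosing its energies within \<open>(1/4)^n / 8\<close> of the infimum
bounds the squared distances by \<open>(1/4)^m\<close>; completeness is assumed for such rapidly converging sequences only,
which spares the extraction of a subsequence in \<open>L\<^sup>2\<close>.\<close>

theorem Riesz:
  assumes complete: "\<And>X. (\<And>n. X n \<in> V) \<Longrightarrow>
      (\<And>m n. m \<le> n \<Longrightarrow> ip (axpy (X n) (-1) (X m)) (axpy (X n) (-1) (X m)) \<le> (1/4)^m) \<Longrightarrow>
      \<exists>l\<in>V. (\<lambda>n. ip (axpy (X n) (-1) l) (axpy (X n) (-1) l)) \<longlonglongrightarrow> 0"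
    and lin: "\<And>x y c. x \<in> V \<Longrightarrow> y \<in> V \<Longrightarrow> \<phi> (axpy x c y) = \<phi> x + c * \<phi> y"
    and bound: "\<And>x. x \<in> V \<Longrightarrow> \<bar>\<phi> x\<bar> \<le> C * sqrt (ip x x)"
  shows "\<exists>l\<in>V. \<forall>x\<in>V. \<phi> x = ip l x"
proof -
  define J where "J x = ip x x / 2 - \<phi> x" for x
  have J_axpy: "J (axpy x c y) = J x + c * (ip x y - \<phi> y) + c\<^sup>2 / 2 * ip y y"
    if "x \<in> V" "y \<in> V" for x y c
    using that by (simp add: J_def ip_axpy_self lin algebra_simps)
  have J_bound: "J x \<ge> - (C\<^sup>2 / 2)" if x: "x \<in> V" for x
  proof -
    have "0 \<le> (sqrt (ip x x) - C)\<^sup>2" by simp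
    also have "\<dots> = ip x x - 2 * (C * sqrt (ip x x)) + C\<^sup>2"
      using ip_nonneg[OF x] by (simp add: power2_diff)
    finally show ?thesis using bound[OF x] by (simp add: J_def)
  qed
  define d where "d = (INF x\<in>V. J x)"
  have bdd: "bdd_below (J ` V)" using J_bound by (auto intro!: bdd_belowI2)
  have d_le: "d \<le> J x" if "x \<in> V" for x
    unfolding d_def using bdd that by (rule cINF_lower)
  have "\<exists>x\<in>V. J x < d + (1/4)^n / 8" for n :: nat
    unfolding d_def by (subst cINF_less_iff[symmetric, OF nonempty bdd]) simp
  then obtain X where X: "X n \<in> V" "J (X n) < d + (1/4)^n / 8" for n :: nat
    by metis
  have "ip (axpy (X n) (-1) (X m)) (axpy (X n) (-1) (X m)) \<le> (1/4)^m" if "m \<le> n" for m n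
  proof -
    define e where "e = axpy (X n) (-1) (X m)"
    have e: "e \<in> V" using X axpy_closed by (auto simp: e_def)
    have mid: "J (axpy (X m) (1/2) e) = (J (X m) + J (X n)) / 2 - ip e e / 8"
    proof -
      have "\<phi> e = \<phi> (X n) - \<phi> (X m)" "ip (X m) e = ip (X m) (X n) - ip (X m) (X m)"
        "ip e e = ip (X n) (X n) - 2 * ip (X m) (X n) + ip (X m) (X m)"
        unfolding e_def using X by (auto simp: lin ip_axpy_right ip_axpy_self ip_commute[of "X n" "X m"])
      then show ?thesis
        by (subst J_axpy[OF X(1) e]) (simp add: J_def field_simps)
    qed
    have "d \<le> (J (X m) + J (X n)) / 2 - ip e e / 8"
      using d_le[OF axpy_closed[OF X(1) e]] mid by metis
    moreover have "(1/4::real)^n \<le> (1/4)^m"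
      using that by (intro power_decreasing) auto
    moreover have "r \<le> a" if "d \<le> (p + q) / 2 - r / 8" "b \<le> a" "p < d + a / 8" "q < d + b / 8"
      for p q r a b :: real using that by (simp add: field_simps)
    ultimately show ?thesis using X(2)[of m] X(2)[of n] unfolding e_def[symmetric] by blast
  qed
  from complete[OF X(1) this] obtain l where l: "l \<in> V"
    and lim: "(\<lambda>n. ip (axpy (X n) (-1) l) (axpy (X n) (-1) l)) \<longlonglongrightarrow> 0" by blast
  have "\<phi> h = ip l h" if h: "h \<in> V" for h
  proof -
    have lim_ip: "(\<lambda>n. ip (X n) h) \<longlonglongrightarrow> ip l h"
    proof (rule LIM_zero_cancel, rule Lim_null_comparison)
      show "(\<lambda>n. sqrt (ip (axpy (X n) (-1) l) (axpy (X n) (-1) l)) * sqrt (ip h h)) \<longlonglongrightarrow> 0"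
        using tendsto_mult[OF tendsto_real_sqrt[OF lim] tendsto_const[of "sqrt (ip h h)"]] by simp
      show "\<forall>\<^sub>F n in sequentially. norm (ip (X n) h - ip l h)
          \<le> sqrt (ip (axpy (X n) (-1) l) (axpy (X n) (-1) l)) * sqrt (ip h h)"
        using Cauchy_Schwarz[OF axpy_closed[OF X(1) l, where c="-1"] h] X(1) l h
        by (intro always_eventually allI) (simp add: ip_axpy)
    qed
    have "0 \<le> c * (ip l h - \<phi> h) + c\<^sup>2 / 2 * ip h h" for c
    proof (rule LIMSEQ_le_const)
      have "(\<lambda>n. (1/4::real)^n / 8 + c * (ip (X n) h - \<phi> h) + c\<^sup>2 / 2 * ip h h)
          \<longlonglongrightarrow> 0 / 8 + c * (ip l h - \<phi> h) + c\<^sup>2 / 2 * ip h h"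
        by (intro tendsto_intros lim_ip LIMSEQ_power_zero) auto
      then show "(\<lambda>n. (1/4::real)^n / 8 + c * (ip (X n) h - \<phi> h) + c\<^sup>2 / 2 * ip h h)
          \<longlonglongrightarrow> c * (ip l h - \<phi> h) + c\<^sup>2 / 2 * ip h h" by simp
      show "\<exists>N. \<forall>n\<ge>N. 0 \<le> (1/4::real)^n / 8 + c * (ip (X n) h - \<phi> h) + c\<^sup>2 / 2 * ip h h"
      proof (intro exI allI impI)
        fix n
        have "d \<le> J (X n) + c * (ip (X n) h - \<phi> h) + c\<^sup>2 / 2 * ip h h"
          using d_le[OF axpy_closed[OF X(1) h]] J_axpy[OF X(1) h] by metis
        then show "0 \<le> (1/4::real)^n / 8 + c * (ip (X n) h - \<phi> h) + c\<^sup>2 / 2 * ip h h"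
          using X(2)[of n] by simp
      qed
    qed
    then have "ip l h - \<phi> h = 0"
      using ip_nonneg[OF h] by (rule linear_coefficient_zero)
    then show ?thesis by simp
  qed
  then show ?thesis using l by blast
qed

end

lemma convergent_if_rapidly_Cauchy:
  fixes X :: "nat \<Rightarrow> 'a::{real_inner, complete_space}"
  assumes "\<And>m n. m \<le> n \<Longrightarrow> (X n - X m) \<bullet> (X n - X m) \<le> (1/4)^m"
  shows "\<exists>l. X \<longlonglongrightarrow> l"
proof -
  have *: "dist (X m) (X n) \<le> (1/2)^m" if "m \<le> n" for m n
  proof -
    have "(norm (X n - X m))\<^sup>2 \<le> ((1/2)^m)\<^sup>2"
      using assms[OF that]
      by (simp add: power2_norm_eq_inner power_divide power2_eq_square[of "2^m"] power_mult_distrib[symmetric])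
    then show ?thesis by (simp add: dist_norm norm_minus_commute power2_le_iff_abs_le)
  qed
  have "Cauchy X"
  proof (rule metric_CauchyI)
    fix e :: real assume "e > 0"
    then obtain N where N: "(1/2)^N < e" using real_arch_pow_inv[of e "1/2"] by auto
    show "\<exists>M. \<forall>m\<ge>M. \<forall>n\<ge>M. dist (X m) (X n) < e"
    proof (intro exI allI impI)
      fix m n assume mn: "N \<le> m" "N \<le> n"
      have "(1/2::real)^m \<le> (1/2)^N" "(1/2::real)^n \<le> (1/2)^N"
        using mn by (auto intro!: power_decreasing)
      then show "dist (X m) (X n) < e"
        using *[of m n] *[of n m] N dist_commute[of "X m" "X n"]
        by (cases "m \<le> n") linarith+
    qed
  qed
  then show ?thesis using Cauchy_convergent convergent_def by blast
qed

lemma Riesz_closed_subspace: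
  fixes K :: "'a::{real_inner, complete_space} set"
  assumes K: "subspace K" "closed K"
    and lin: "\<And>x y c. x \<in> K \<Longrightarrow> y \<in> K \<Longrightarrow> \<phi> (x + c *\<^sub>R y) = \<phi> x + c * \<phi> y"
    and bound: "\<And>x. x \<in> K \<Longrightarrow> \<bar>\<phi> x\<bar> \<le> C * norm x"
  shows "\<exists>l\<in>K. \<forall>x\<in>K. \<phi> x = l \<bullet> x"
proof -
  interpret prehilbert_set K "\<lambda>x c y. x + c *\<^sub>R y" "(\<bullet>)"
    using K by unfold_locales
      (auto simp: subspace_add subspace_mul inner_simps inner_commute dest: subspace_0)
  show ?thesis
  proof (rule Riesz[where C=C])
    fix X :: "nat \<Rightarrow> 'a"
    assume X: "\<And>n. X n \<in> K"
      and "\<And>m n. m \<le> n \<Longrightarrow> (X n + - 1 *\<^sub>R X m) \<bullet> (X n + - 1 *\<^sub>R X m) \<le> (1/4)^m"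
    then obtain l where l: "X \<longlonglongrightarrow> l"
      using convergent_if_rapidly_Cauchy[of X] by auto
    have "(\<lambda>n. (X n - l) \<bullet> (X n - l)) \<longlonglongrightarrow> (l - l) \<bullet> (l - l)"
      by (intro tendsto_intros l)
    moreover have "l \<in> K" using closed_sequentially[OF K(2) _ l] X by auto
    ultimately show "\<exists>l\<in>K. (\<lambda>n. (X n + - 1 *\<^sub>R l) \<bullet> (X n + - 1 *\<^sub>R l)) \<longlonglongrightarrow> 0" by auto
  qed (use lin bound in \<open>auto simp: norm_eq_sqrt_inner\<close>)
qed

lemma Riesz_Hilbert:
  fixes \<phi> :: "'a::{real_inner, complete_space} \<Rightarrow> real"
  assumes "\<And>x y c. \<phi> (x + c *\<^sub>R y) = \<phi> x + c * \<phi> y" "\<And>x. \<bar>\<phi> x\<bar> \<le> C * norm x"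
  shows "\<exists>l. \<forall>x. \<phi> x = l \<bullet> x"
  using Riesz_closed_subspace[of UNIV \<phi> C] assms by auto

lemma orthogonal_decomposition:
  fixes K :: "'a::{real_inner, complete_space} set"
  assumes K: "subspace K" "closed K"
  shows "\<exists>p\<in>K. \<forall>x\<in>K. (a - p) \<bullet> x = 0"
proof -
  have "\<exists>l\<in>K. \<forall>x\<in>K. a \<bullet> x = l \<bullet> x"
    by (rule Riesz_closed_subspace[OF K, where C="norm a"])
      (auto simp: inner_simps Cauchy_Schwarz_ineq2)
  then show ?thesis by (auto simp: inner_simps)
qed

lemma closed_subspace_eq_UNIV:
  fixes K :: "'a::{real_inner, complete_space} set"
  assumes K: "subspace K" "closed K" and "\<And>y. (\<And>x. x \<in> K \<Longrightarrow> y \<bullet> x = 0) \<Longrightarrow> y = 0"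
  shows "K = UNIV"
proof (intro UNIV_eq_I[symmetric])
  fix a
  obtain p where "p \<in> K" "\<forall>x\<in>K. (a - p) \<bullet> x = 0" using orthogonal_decomposition[OF K] by blast
  then show "a \<in> K" using assms(3)[of "a - p"] by auto
qed

text \<open>The constant \<open>adjoint\<close> is a choice of a map with the adjoint property; Riesz representation
provides one for every bounded operator on a Hilbert space.\<close>

lemma inner_adjoint:
  fixes f :: "'a::{real_inner, complete_space} \<Rightarrow> 'b::real_inner"
  assumes "bounded_linear f"
  shows "f x \<bullet> y = x \<bullet> adjoint f y"
proof -
  interpret bounded_linear f by fact
  have "\<exists>l. \<forall>x. f x \<bullet> y = l \<bullet> x" for y
  proof (rule Riesz_Hilbert)
    fix x
    have "\<bar>f x \<bullet> y\<bar> \<le> norm (f x) * norm y" by (rule Cauchy_Schwarz_ineq2)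
    also have "\<dots> \<le> (onorm f * norm x) * norm y"
      using onorm[OF assms] by (intro mult_right_mono) auto
    finally show "\<bar>f x \<bullet> y\<bar> \<le> (onorm f * norm y) * norm x" by (simp add: mult_ac)
  qed (simp add: add scaleR inner_simps)
  then obtain g where "\<forall>x y. f x \<bullet> y = x \<bullet> g y" by (metis inner_commute)
  then have "\<exists>g. \<forall>x y. f x \<bullet> y = x \<bullet> g y" by blast
  from someI_ex[OF this] show ?thesis unfolding adjoint_def by blast
qed

text \<open>Norm estimates for weakly defined vectors are obtained by testing against all \<open>y\<close>.\<close>

lemma norm_le_if_inner_le:
  fixes x :: "'a::real_inner"
  assumes "\<And>y. x \<bullet> y \<le> C * norm y" and "0 \<le> C"
  shows "norm x \<le> C"
  using assms(1)[of x] assms(2)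
  by (cases "x = 0") (simp_all add: power2_norm_eq_inner[symmetric] power2_eq_square)

lemma bounded_linear_adjoint:
  fixes f :: "'a::{real_inner, complete_space} \<Rightarrow> 'b::real_inner"
  assumes f: "bounded_linear f" and M: "\<And>x. norm (f x) \<le> M * norm x" and M0: "0 \<le> M"
  shows "bounded_linear (adjoint f)" "norm (adjoint f y) \<le> M * norm y"
proof -
  have eqI: "u = v" if "\<And>x. x \<bullet> u = x \<bullet> v" for u v :: 'a
    using that[of "u - v"] by (metis inner_eq_zero_iff inner_diff_right right_minus_eq)
  have b: "norm (adjoint f y) \<le> M * norm y" for y
  proof (rule norm_le_if_inner_le)
    show "0 \<le> M * norm y" using M0 by simp
    fix z
    have "adjoint f y \<bullet> z = f z \<bullet> y" by (metis inner_adjoint[OF f] inner_commute)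
    also have "\<dots> \<le> norm (f z) * norm y" by (rule norm_cauchy_schwarz)
    also have "\<dots> \<le> (M * norm z) * norm y" by (intro mult_right_mono M) auto
    finally show "adjoint f y \<bullet> z \<le> M * norm y * norm z" by (simp add: mult_ac)
  qed
  show "norm (adjoint f y) \<le> M * norm y" by fact
  show "bounded_linear (adjoint f)"
  proof (rule bounded_linear_intro[where K=M])
    show "adjoint f (x + y) = adjoint f x + adjoint f y" for x y
      by (rule eqI) (simp add: inner_simps inner_adjoint[OF f, symmetric])
    show "adjoint f (r *\<^sub>R x) = r *\<^sub>R adjoint f x" for r x
      by (rule eqI) (simp add: inner_simps inner_adjoint[OF f, symmetric])
    show "norm (adjoint f x) \<le> norm x * M" for x using b[of x] by (simp add: mult.commute)
  qed
qed

section \<open>Linear maps under finitely many linear constraints\<close>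

text \<open>Induction on the number of functionals. If the new functional \<open>\<psi> k\<close> is nonzero at some \<open>v1\<close> in the
kernel of the others, subtracting the multiple of \<open>\<psi> k\<close> that agrees with \<open>\<phi>\<close> at \<open>v1\<close> reduces to
the smaller family; otherwise \<open>\<psi> k\<close> can be dropped.\<close>

lemma functional_in_span_if_vanishes_on_kernel:
  fixes \<psi> :: "'k \<Rightarrow> 'v \<Rightarrow> real"
  assumes "finite K"
    and axpy: "\<And>x y c. x \<in> V \<Longrightarrow> y \<in> V \<Longrightarrow> axpy x c y \<in> V"
    and "\<And>k x y c. k \<in> K \<Longrightarrow> x \<in> V \<Longrightarrow> y \<in> V \<Longrightarrow> \<psi> k (axpy x c y) = \<psi> k x + c * \<psi> k y"
    and "\<And>x y c. x \<in> V \<Longrightarrow> y \<in> V \<Longrightarrow> \<phi> (axpy x c y) = \<phi> x + c * \<phi> y"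
    and "\<And>v. v \<in> V \<Longrightarrow> (\<And>k. k \<in> K \<Longrightarrow> \<psi> k v = 0) \<Longrightarrow> \<phi> v = 0"
  shows "\<exists>c. \<forall>v\<in>V. \<phi> v = (\<Sum>k\<in>K. c k * \<psi> k v)"
  using assms(1,3-)
proof (induction K arbitrary: \<phi> rule: finite_induct)
  case empty
  then show ?case by simp
next
  case (insert k K)
  note \<psi> = insert.prems(1) and \<phi> = insert.prems(2) and van = insert.prems(3)
  show ?case
  proof (cases "\<exists>v\<in>V. (\<forall>j\<in>K. \<psi> j v = 0) \<and> \<psi> k v \<noteq> 0")
    case True
    then obtain v1 where v1: "v1 \<in> V" "\<And>j. j \<in> K \<Longrightarrow> \<psi> j v1 = 0" "\<psi> k v1 \<noteq> 0" by blast
    define d where "d = \<phi> v1 / \<psi> k v1"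
    have "\<exists>c. \<forall>v\<in>V. \<phi> v - d * \<psi> k v = (\<Sum>j\<in>K. c j * \<psi> j v)"
    proof (rule insert.IH)
      fix v assume v: "v \<in> V" "\<And>j. j \<in> K \<Longrightarrow> \<psi> j v = 0"
      have "\<phi> (axpy v (- \<psi> k v / \<psi> k v1) v1) = 0"
      proof (rule van)
        fix j assume "j \<in> insert k K"
        then show "\<psi> j (axpy v (- \<psi> k v / \<psi> k v1) v1) = 0"
          using v v1 by (subst \<psi>) auto
      qed (use v v1 axpy in auto)
      then show "\<phi> v - d * \<psi> k v = 0" using v v1 by (simp add: \<phi> d_def field_simps)
    qed (auto simp: \<psi> \<phi> algebra_simps)
    then obtain c where c: "\<And>v. v \<in> V \<Longrightarrow> \<phi> v - d * \<psi> k v = (\<Sum>j\<in>K. c j * \<psi> j v)" by blast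
    have "\<phi> v = (\<Sum>j\<in>insert k K. (c(k := d)) j * \<psi> j v)" if "v \<in> V" for v
    proof -
      have "(\<Sum>j\<in>K. (c(k := d)) j * \<psi> j v) = (\<Sum>j\<in>K. c j * \<psi> j v)"
        using insert.hyps by (intro sum.cong) auto
      then show ?thesis using c[OF that] insert.hyps by simp
    qed
    then show ?thesis by blast
  next
    case False
    have "\<exists>c. \<forall>v\<in>V. \<phi> v = (\<Sum>j\<in>K. c j * \<psi> j v)"
      using False by (intro insert.IH) (auto simp: \<psi> \<phi> intro!: van)
    then obtain c where c: "\<And>v. v \<in> V \<Longrightarrow> \<phi> v = (\<Sum>j\<in>K. c j * \<psi> j v)" by blast
    have "\<phi> v = (\<Sum>j\<in>insert k K. (c(k := 0)) j * \<psi> j v)" if "v \<in> V" for v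
    proof -
      have "(\<Sum>j\<in>K. (c(k := 0)) j * \<psi> j v) = (\<Sum>j\<in>K. c j * \<psi> j v)"
        using insert.hyps by (intro sum.cong) auto
      then show ?thesis using c[OF that] insert.hyps by simp
    qed
    then show ?thesis by blast
  qed
qed

text \<open>The Fredholm alternative for finitely many functionals: the system is solvable as soon as the
right-hand side satisfies every linear relation between the functionals.\<close>

lemma finite_linear_system_solvable:
  fixes \<psi> :: "'k \<Rightarrow> 'v \<Rightarrow> real"
  assumes "finite K" and "V \<noteq> {}"
    and axpy: "\<And>x y c. x \<in> V \<Longrightarrow> y \<in> V \<Longrightarrow> axpy x c y \<in> V"
    and "\<And>k x y c. k \<in> K \<Longrightarrow> x \<in> V \<Longrightarrow> y \<in> V \<Longrightarrow> \<psi> k (axpy x c y) = \<psi> k x + c * \<psi> k y"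
    and "\<And>c. (\<And>v. v \<in> V \<Longrightarrow> (\<Sum>k\<in>K. c k * \<psi> k v) = 0) \<Longrightarrow> (\<Sum>k\<in>K. c k * b k) = 0"
  shows "\<exists>v\<in>V. \<forall>k\<in>K. \<psi> k v = b k"
  using assms(1,4-)
proof (induction K rule: finite_induct)
  case empty
  then show ?case using \<open>V \<noteq> {}\<close> by auto
next
  case (insert k K)
  note \<psi> = insert.prems(1) and compat = insert.prems(2)
  have upd: "(\<Sum>j\<in>insert k K. (c(k := d)) j * f j) = d * f k + (\<Sum>j\<in>K. c j * f j)" for c d f
  proof -
    have "(\<Sum>j\<in>K. (c(k := d)) j * f j) = (\<Sum>j\<in>K. c j * f j)"
      using insert.hyps by (intro sum.cong) auto
    then show ?thesis using insert.hyps by simp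
  qed
  have "\<exists>v\<in>V. \<forall>j\<in>K. \<psi> j v = b j"
  proof (rule insert.IH)
    fix c :: "'k \<Rightarrow> real" assume c: "\<And>v. v \<in> V \<Longrightarrow> (\<Sum>j\<in>K. c j * \<psi> j v) = 0"
    show "(\<Sum>j\<in>K. c j * b j) = 0" using compat[of "c(k := 0)"] c by (simp add: upd del: fun_upd_apply)
  qed (auto simp: \<psi>)
  then obtain v0 where v0: "v0 \<in> V" "\<And>j. j \<in> K \<Longrightarrow> \<psi> j v0 = b j" by blast
  show ?case
  proof (cases "\<exists>v\<in>V. (\<forall>j\<in>K. \<psi> j v = 0) \<and> \<psi> k v \<noteq> 0")
    case True
    then obtain v1 where v1: "v1 \<in> V" "\<And>j. j \<in> K \<Longrightarrow> \<psi> j v1 = 0" "\<psi> k v1 \<noteq> 0" by blast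
    show ?thesis
    proof (intro bexI ballI)
      fix j assume "j \<in> insert k K"
      then show "\<psi> j (axpy v0 ((b k - \<psi> k v0) / \<psi> k v1) v1) = b j"
        using v0 v1 by (subst \<psi>) auto
    qed (use v0 v1 axpy in auto)
  next
    case False
    have "\<exists>c. \<forall>v\<in>V. \<psi> k v = (\<Sum>j\<in>K. c j * \<psi> j v)"
      using False insert.hyps
      by (intro functional_in_span_if_vanishes_on_kernel[where axpy=axpy]) (auto simp: \<psi> axpy)
    then obtain c where c: "\<And>v. v \<in> V \<Longrightarrow> \<psi> k v = (\<Sum>j\<in>K. c j * \<psi> j v)" by blast
    have "(\<Sum>j\<in>insert k K. (c(k := -1)) j * b j) = 0"
      using c by (intro compat) (simp add: upd del: fun_upd_apply)
    then have "b k = (\<Sum>j\<in>K. c j * b j)" by (simp add: upd del: fun_upd_apply)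
    also have "\<dots> = \<psi> k v0" using c[OF v0(1)] v0(2) by simp
    finally show ?thesis using v0 by auto
  qed
qed

lemma subspace_closure:
  fixes X :: "'a::real_normed_vector set"
  assumes "subspace X"
  shows "subspace (closure X)"
proof (rule subspaceI)
  show "0 \<in> closure X" using subspace_0[OF assms] closure_subset by blast
  fix x y assume "x \<in> closure X" "y \<in> closure X"
  then obtain u v where uv: "\<And>n. u n \<in> X" "u \<longlonglongrightarrow> x" "\<And>n. v n \<in> X" "v \<longlonglongrightarrow> y"
    unfolding closure_sequential by blast
  have "(\<lambda>n. u n + v n) \<longlonglongrightarrow> x + y" by (intro tendsto_add uv)
  then show "x + y \<in> closure X"
    unfolding closure_sequential using subspace_add[OF assms uv(1) uv(3)]
    by (intro exI[of _ "\<lambda>n. u n + v n"]) simp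
next
  fix c x assume "x \<in> closure X"
  then obtain u where u: "\<And>n. u n \<in> X" "u \<longlonglongrightarrow> x" unfolding closure_sequential by blast
  have "(\<lambda>n. c *\<^sub>R u n) \<longlonglongrightarrow> c *\<^sub>R x" by (intro tendsto_scaleR tendsto_const u)
  then show "c *\<^sub>R x \<in> closure X"
    unfolding closure_sequential using subspace_scale[OF assms u(1)]
    by (intro exI[of _ "\<lambda>n. c *\<^sub>R u n"]) simp
qed

text \<open>The functional-analytic core. The functionals \<open>\<psi> i\<close> and the products with the elements of \<open>b\<close> are
treated as one finite family \<open>\<Psi>\<close>. The uniqueness assumption says that the adjoint of
\<open>v \<mapsto> (L v, \<psi> v)\<close> is injective up to combinations annihilating \<open>\<beta>\<close>. It is used twice: to see that the
constraints are compatible, and to see that their common kernel is mapped by \<open>L\<close> onto a dense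
subspace of the orthogonal complement of \<open>b\<close>.\<close>

theorem approximate_range_with_constraints:
  fixes L :: "'v \<Rightarrow> 'h::{real_inner, complete_space}" and \<psi> :: "'i \<Rightarrow> 'v \<Rightarrow> real"
  assumes V: "V \<noteq> {}" and axpy: "\<And>x y c. x \<in> V \<Longrightarrow> y \<in> V \<Longrightarrow> axpy x c y \<in> V"
    and L: "\<And>x y c. x \<in> V \<Longrightarrow> y \<in> V \<Longrightarrow> L (axpy x c y) = L x + c *\<^sub>R L y"
    and \<psi>: "\<And>i x y c. i \<in> I \<Longrightarrow> x \<in> V \<Longrightarrow> y \<in> V \<Longrightarrow> \<psi> i (axpy x c y) = \<psi> i x + c * \<psi> i y"
    and I: "finite I" and b: "finite b"
    and unique: "\<And>\<zeta> c. (\<And>v. v \<in> V \<Longrightarrow> L v \<bullet> \<zeta> + (\<Sum>i\<in>I. c i * \<psi> i v) = 0) \<Longrightarrow> \<zeta> = 0 \<and> (\<Sum>i\<in>I. c i * \<beta> i) = 0"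
    and e: "e > 0"
  shows "\<exists>v\<in>V. (\<forall>i\<in>I. \<psi> i v = \<beta> i) \<and> (\<forall>x\<in>span b. (L v - a) \<bullet> x = 0) \<and> norm (L v - a) \<le> e"
proof -
  define K where "K = I <+> b"
  define \<Psi> where "\<Psi> k v = (case k of Inl i \<Rightarrow> \<psi> i v | Inr x \<Rightarrow> L v \<bullet> x)" for k v
  define B where "B k = (case k of Inl i \<Rightarrow> \<beta> i | Inr x \<Rightarrow> a \<bullet> x)" for k
  have K: "finite K" using I b by (simp add: K_def)
  have \<Psi>: "\<Psi> k (axpy x c y) = \<Psi> k x + c * \<Psi> k y" if "k \<in> K" "x \<in> V" "y \<in> V" for k x y c
    using that by (auto simp: K_def \<Psi>_def \<psi> L inner_simps)
  have sum_K: "(\<Sum>k\<in>K. c k * \<Psi> k v) = (\<Sum>i\<in>I. c (Inl i) * \<psi> i v) + L v \<bullet> (\<Sum>x\<in>b. c (Inr x) *\<^sub>R x)" for c v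
    unfolding K_def using I b by (simp add: sum.Plus \<Psi>_def inner_sum_right)
  have sum_B: "(\<Sum>k\<in>K. c k * B k) = (\<Sum>i\<in>I. c (Inl i) * \<beta> i) + a \<bullet> (\<Sum>x\<in>b. c (Inr x) *\<^sub>R x)" for c
    unfolding K_def using I b by (simp add: sum.Plus B_def inner_sum_right)
  have "\<exists>v\<in>V. \<forall>k\<in>K. \<Psi> k v = B k"
  proof (rule finite_linear_system_solvable[where axpy=axpy, OF K V axpy \<Psi>])
    fix c assume "\<And>v. v \<in> V \<Longrightarrow> (\<Sum>k\<in>K. c k * \<Psi> k v) = 0"
    then have "\<And>v. v \<in> V \<Longrightarrow> L v \<bullet> (\<Sum>x\<in>b. c (Inr x) *\<^sub>R x) + (\<Sum>i\<in>I. c (Inl i) * \<psi> i v) = 0"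
      by (simp add: sum_K add.commute)
    from unique[OF this] show "(\<Sum>k\<in>K. c k * B k) = 0" by (simp add: sum_B)
  qed
  then obtain v0 where v0: "v0 \<in> V" "\<And>k. k \<in> K \<Longrightarrow> \<Psi> k v0 = B k" by blast
  have v0': "(a - L v0) \<bullet> x = 0" if "x \<in> b" for x
    using v0(2)[of "Inr x"] that by (simp add: K_def InrI \<Psi>_def B_def inner_diff_left)
  (* The controls in N leave all constraints unchanged; corrections of v0 are sought there. *)
  define N where "N = {v \<in> V. \<forall>k\<in>K. \<Psi> k v = 0}"
  have N_axpy: "axpy x c y \<in> N" if "x \<in> N" "y \<in> N" for x y c
    using that axpy by (auto simp: N_def \<Psi>)
  have zero: "axpy v0 (-1) v0 \<in> N" "L (axpy v0 (-1) v0) = 0"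
    using v0 axpy by (auto simp: N_def \<Psi> L)
  define R where "R = closure (L ` N)"
  have "subspace (L ` N)"
  proof (rule subspaceI)
    show "0 \<in> L ` N" using zero by (metis imageI)
    fix x y assume "x \<in> L ` N" "y \<in> L ` N"
    then obtain u v where uv: "u \<in> N" "v \<in> N" "x = L u" "y = L v" by blast
    then have "x + y = L (axpy u 1 v)" using L[of u v 1] by (simp add: N_def)
    then show "x + y \<in> L ` N" using N_axpy[OF uv(1,2)] by blast
  next
    fix c x assume "x \<in> L ` N"
    then obtain u where u: "u \<in> N" "x = L u" by blast
    then have "c *\<^sub>R x = L (axpy (axpy v0 (-1) v0) c u)"
      using L[of "axpy v0 (-1) v0" u c] zero by (simp add: N_def)
    then show "c *\<^sub>R x \<in> L ` N" using N_axpy[OF zero(1) u(1)] by blast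
  qed
  then have R: "subspace R" "closed R" unfolding R_def by (auto intro: subspace_closure)
  have R_orth: "p \<bullet> x = 0" if "p \<in> R" "x \<in> b" for p x
  proof -
    have "Inr x \<in> K" using that(2) by (simp add: K_def InrI)
    then have "L ` N \<subseteq> {p. p \<bullet> x = 0}" by (force simp: N_def \<Psi>_def)
    moreover have "closed {p. p \<bullet> x = 0}" by (intro closed_Collect_eq continuous_intros)
    ultimately have "R \<subseteq> {p. p \<bullet> x = 0}" unfolding R_def by (rule closure_minimal)
    then show ?thesis using that by blast
  qed
  obtain p where p: "p \<in> R" "\<And>x. x \<in> R \<Longrightarrow> (a - L v0 - p) \<bullet> x = 0"
    using orthogonal_decomposition[OF R, of "a - L v0"] by blast
  (* q is the obstruction to approximating a - L v0 by the image of N; it vanishes because it is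
     both a combination of the vectors of b and orthogonal to each of them. *)
  define q where "q = a - L v0 - p"
  have "\<exists>c. \<forall>v\<in>V. L v \<bullet> q = (\<Sum>k\<in>K. c k * \<Psi> k v)"
  proof (rule functional_in_span_if_vanishes_on_kernel[where axpy=axpy, OF K axpy \<Psi>])
    show "L (axpy x c y) \<bullet> q = L x \<bullet> q + c * (L y \<bullet> q)" if "x \<in> V" "y \<in> V" for x y c
      using that by (simp add: L inner_simps)
    fix v assume "v \<in> V" "\<And>k. k \<in> K \<Longrightarrow> \<Psi> k v = 0"
    then have "L v \<in> R" unfolding R_def N_def by (intro subsetD[OF closure_subset]) auto
    then show "L v \<bullet> q = 0" using p(2) by (simp add: q_def inner_commute)
  qed
  then obtain c where c: "\<And>v. v \<in> V \<Longrightarrow> L v \<bullet> q = (\<Sum>k\<in>K. c k * \<Psi> k v)" by blast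
  define d where "d = (\<Sum>x\<in>b. c (Inr x) *\<^sub>R x)"
  have "L v \<bullet> (q - d) + (\<Sum>i\<in>I. - c (Inl i) * \<psi> i v) = 0" if "v \<in> V" for v
    using c[OF that] by (simp add: sum_K d_def inner_diff_right sum_negf)
  from unique[OF this] have "q = d" by simp
  moreover have "q \<bullet> x = 0" if "x \<in> b" for x
    using v0'[OF that] R_orth[OF p(1) that] by (simp add: q_def inner_diff_left)
  ultimately have "q \<bullet> q = 0"
    unfolding d_def by (metis (no_types, lifting) inner_scaleR_right inner_sum_right mult_zero_right sum.neutral)
  then have "a - L v0 \<in> R" using p(1) by (simp add: q_def)
  then obtain r where r: "r \<in> L ` N" "dist r (a - L v0) < e"
    using e unfolding R_def closure_approachable by blast
  then obtain v1 where v1: "v1 \<in> N" "r = L v1" by blast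
  define v where "v = axpy v0 1 v1"
  have v1V: "v1 \<in> V" using v1 by (simp add: N_def)
  have v: "v \<in> V" "L v = L v0 + L v1" using v0 v1V axpy L[of v0 v1 1] by (auto simp: v_def)
  have \<Psi>v: "\<Psi> k v = B k" if "k \<in> K" for k
    using that v0 v1 v1V by (simp add: v_def \<Psi> N_def)
  have "\<psi> i v = \<beta> i" if "i \<in> I" for i
    using \<Psi>v[of "Inl i"] that by (simp add: K_def InlI \<Psi>_def B_def)
  moreover have "(L v - a) \<bullet> x = 0" if "x \<in> span b" for x
    using that
  proof (induction rule: span_induct_alt)
    case (step c x y)
    then show ?case using \<Psi>v[of "Inr x"] by (simp add: K_def InrI \<Psi>_def B_def inner_simps)
  qed simp
  moreover have "norm (L v - a) \<le> e"
    using r v1 v(2) by (simp add: dist_norm algebra_simps)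
  ultimately show ?thesis using v(1) by blast
qed

section \<open>Semigroups and the adjoint semigroup\<close>

text \<open>By Baire's theorem one of the closed sets \<open>F k\<close> of points at which all \<open>f i\<close> are bounded by \<open>k\<close>
contains a ball. Differences of two points of the ball are then mapped into a ball of radius \<open>2 k\<close>,
and scaling gives a bound for the operator norms.\<close>

theorem uniform_boundedness:
  fixes f :: "'i \<Rightarrow> 'a::{real_normed_vector, complete_space} \<Rightarrow> 'b::real_normed_vector"
  assumes lin: "\<And>i. bounded_linear (f i)" and bdd: "\<And>x. \<exists>C. \<forall>i. norm (f i x) \<le> C"
  shows "\<exists>M. \<forall>i x. norm (f i x) \<le> M * norm x"
proof -
  define F where "F k = {x. \<forall>i. norm (f i x) \<le> real k}" for k :: nat
  have cl: "closed (F k)" for k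
    unfolding F_def
    by (intro closed_Collect_all closed_Collect_le continuous_on_norm linear_continuous_on lin continuous_on_const)
  have un: "\<Union>(range F) = UNIV"
  proof (intro UNIV_eq_I[symmetric])
    fix x
    obtain C where "\<forall>i. norm (f i x) \<le> C" using bdd by blast
    moreover obtain k where "C \<le> real k" using real_arch_simple by blast
    ultimately have "x \<in> F k" unfolding F_def by (auto intro: order_trans)
    then show "x \<in> \<Union>(range F)" by blast
  qed
  have "\<exists>k. interior (F k) \<noteq> {}"
  proof (rule ccontr)
    assume "\<nexists>k. interior (F k) \<noteq> {}"
    then have "euclidean interior_of \<Union>(range F) = {}"
      by (intro Baire_category_alt) (auto simp: completely_metrizable_space_euclidean cl)
    then show False using un by simp
  qed
  then obtain k x0 where "x0 \<in> interior (F k)" by blast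
  then obtain r where r: "r > 0" "ball x0 r \<subseteq> F k" by (meson mem_interior)
  have "norm (f i x) \<le> 4 * real k / r * norm x" for i x
  proof (cases "x = 0")
    case True
    then show ?thesis using linear_simps(3)[OF lin] by simp
  next
    case False
    interpret bounded_linear "f i" by (rule lin)
    (* The factor puts x0 + a x at distance r / 2 from x0. *)
    define a where "a = r / (2 * norm x)"
    have a: "a > 0" using r False by (simp add: a_def)
    have "x0 + a *\<^sub>R x \<in> ball x0 r" using r False by (simp add: dist_norm a_def)
    then have "norm (f i (x0 + a *\<^sub>R x)) \<le> real k" "norm (f i x0) \<le> real k"
      using r by (auto simp: F_def subset_iff)
    moreover have "f i (x0 + a *\<^sub>R x) = f i x0 + a *\<^sub>R f i x" by (simp add: add scaleR)
    ultimately have "norm (a *\<^sub>R f i x) \<le> 2 * real k"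
      using norm_triangle_ineq4[of "f i (x0 + a *\<^sub>R x)" "f i x0"] by simp
    then have "a * norm (f i x) \<le> 2 * real k" using a by simp
    then show ?thesis using r False by (simp add: a_def field_simps)
  qed
  then show ?thesis by blast
qed

lemma integral_shift_real:
  fixes g :: "real \<Rightarrow> real"
  assumes "continuous_on {a + h..b + h} g" and "a \<le> b"
  shows "integral {a..b} (\<lambda>s. g (s + h)) = integral {a + h..b + h} g"
proof -
  have "(g has_integral integral {a + h..b + h} g) (cbox (a + h) (b + h))"
    using assms integrable_continuous_real by (auto intro!: integrable_integral)
  from has_integral_affinity[OF this, of 1 h]
  have "((\<lambda>s. g (s + h)) has_integral integral {a + h..b + h} g) ((\<lambda>x. x - h) ` {a + h..b + h})"
    by simp
  moreover have "(\<lambda>x. x - h) ` {a + h..b + h} = {a..b}"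
    using assms(2) by (auto simp: image_iff intro!: bexI[of _ "_ + h"])
  ultimately show ?thesis by (auto intro: integral_unique)
qed

text \<open>The value at \<open>0\<close> is the derivative of the indefinite integral.\<close>

lemma continuous_value_zero_if_integrals_zero:
  fixes g :: "real \<Rightarrow> real"
  assumes "continuous_on {0..1} g" and "\<And>r. 0 < r \<Longrightarrow> r \<le> 1 \<Longrightarrow> integral {0..r} g = 0"
  shows "g 0 = 0"
proof (rule vector_derivative_unique_within_closed_interval)
  show "((\<lambda>u. integral {0..u} g) has_vector_derivative g 0) (at 0 within cbox 0 1)"
    using integral_has_vector_derivative[OF assms(1), of 0] by simp
  have "((\<lambda>u. 0::real) has_vector_derivative 0) (at 0 within cbox 0 1)" by simp
  then show "((\<lambda>u. integral {0..u} g) has_vector_derivative 0) (at 0 within cbox 0 (1::real))"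
  proof (rule has_vector_derivative_transform[rotated 2])
    fix u :: real assume "u \<in> cbox 0 1"
    then show "integral {0..u} g = 0" using assms(2)[of u] by (cases "u = 0") auto
  qed simp
qed auto

text \<open>The integral of a weakly continuous function is the Riesz representative of the integrated scalar
products.\<close>

lemma weak_integral_exists:
  fixes f :: "real \<Rightarrow> 'h::{real_inner, complete_space}"
  assumes ab: "a \<le> b" and cont: "\<And>y. continuous_on {a..b} (\<lambda>s. f s \<bullet> y)"
    and M: "\<And>s. s \<in> {a..b} \<Longrightarrow> norm (f s) \<le> M"
  shows "\<exists>v. \<forall>y. v \<bullet> y = integral {a..b} (\<lambda>s. f s \<bullet> y)"
proof -
  have int: "(\<lambda>s. f s \<bullet> y) integrable_on {a..b}" for y
    by (rule integrable_continuous_real[OF cont])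
  have "\<exists>v. \<forall>y. integral {a..b} (\<lambda>s. f s \<bullet> y) = v \<bullet> y"
  proof (rule Riesz_Hilbert)
    show "integral {a..b} (\<lambda>s. f s \<bullet> (x + c *\<^sub>R y)) =
        integral {a..b} (\<lambda>s. f s \<bullet> x) + c * integral {a..b} (\<lambda>s. f s \<bullet> y)" for x y c
      unfolding inner_add_right inner_scaleR_right
      by (intro integral_unique has_integral_add has_integral_mult_right integrable_integral int)
    show "\<bar>integral {a..b} (\<lambda>s. f s \<bullet> x)\<bar> \<le> (M * (b - a)) * norm x" for x
    proof -
      have "\<bar>f s \<bullet> x\<bar> \<le> M * norm x" if "s \<in> {a..b}" for s
        using Cauchy_Schwarz_ineq2[of "f s" x] mult_right_mono[OF M[OF that], of "norm x"] by simp
      then have "norm (integral {a..b} (\<lambda>s. f s \<bullet> x)) \<le> (M * norm x) * (b - a)"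
        using ab cont by (intro integral_bound) auto
      then show ?thesis by (simp add: mult_ac)
    qed
  qed
  then show ?thesis by metis
qed

text \<open>A semigroup and its adjoint both satisfy these conditions. Weak continuity passes to adjoints
at once, whereas their strong continuity has to be derived.\<close>

locale weak_semigroup =
  fixes R :: "real \<Rightarrow> 'h::{real_inner, complete_space} \<Rightarrow> 'h"
  assumes lin: "t \<ge> 0 \<Longrightarrow> bounded_linear (R t)"
    and R_0: "R 0 x = x"
    and R_add: "s \<ge> 0 \<Longrightarrow> t \<ge> 0 \<Longrightarrow> R (s + t) x = R s (R t x)"
    and weak_cont: "continuous_on {0..} (\<lambda>t. R t x \<bullet> y)"
    and bound: "\<exists>M\<ge>1. \<forall>t\<in>{0..T}. \<forall>x. norm (R t x) \<le> M * norm x"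
begin

lemma average_exists:
  assumes "r \<ge> 0"
  shows "\<exists>v. \<forall>y. v \<bullet> y = integral {0..r} (\<lambda>s. R s x \<bullet> y)"
proof -
  obtain M where "\<forall>t\<in>{0..r}. \<forall>x. norm (R t x) \<le> M * norm x" using bound by blast
  then show ?thesis
    by (intro weak_integral_exists[where M="M * norm x"] assms)
      (auto intro!: continuous_on_subset[OF weak_cont])
qed

text \<open>The increments of an averaged orbit \<open>v = \<integral>\<^sub>0\<^sup>r R s x ds\<close> have two expressions: one moves \<open>R h\<close>
onto \<open>x\<close>, the other keeps only the two ends of the shifted interval. The second one shows that
the increment is of order \<open>h\<close>.\<close>

lemma inner_average_diff:
  assumes r: "r \<ge> 0" and h: "h \<ge> 0" and v: "\<And>y. v \<bullet> y = integral {0..r} (\<lambda>s. R s x \<bullet> y)"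
  shows "(R h v - v) \<bullet> y = integral {0..r} (\<lambda>s. R s (R h x - x) \<bullet> y)"
    and "(R h v - v) \<bullet> y = integral {r..r + h} (\<lambda>s. R s x \<bullet> y) - integral {0..h} (\<lambda>s. R s x \<bullet> y)"
proof -
  have c: "continuous_on {a..b} (\<lambda>s. R s x \<bullet> y)" if "0 \<le> a" for a b x y
    using that by (auto intro!: continuous_on_subset[OF weak_cont])
  have i: "(\<lambda>s. R s x \<bullet> y) integrable_on {a..b}" if "0 \<le> a" for a b x y
    by (rule integrable_continuous_real[OF c[OF that]])
  have "R h v \<bullet> y = v \<bullet> adjoint (R h) y" by (rule inner_adjoint[OF lin[OF h]])
  also have "\<dots> = integral {0..r} (\<lambda>s. R s x \<bullet> adjoint (R h) y)" by (rule v)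
  also have "\<dots> = integral {0..r} (\<lambda>s. R (s + h) x \<bullet> y)"
  proof (rule integral_cong)
    fix s assume "s \<in> {0..r}"
    then show "R s x \<bullet> adjoint (R h) y = R (s + h) x \<bullet> y"
      using h by (simp add: inner_adjoint[OF lin[OF h], symmetric] R_add[symmetric] add.commute)
  qed
  finally have Rh: "R h v \<bullet> y = integral {0..r} (\<lambda>s. R (s + h) x \<bullet> y)" .
  have "integral {0..r} (\<lambda>s. R (s + h) x \<bullet> y) = integral {0..r} (\<lambda>s. R s (R h x) \<bullet> y)"
    using h by (intro integral_cong) (simp add: R_add)
  then have "(R h v - v) \<bullet> y = integral {0..r} (\<lambda>s. R s (R h x) \<bullet> y - R s x \<bullet> y)"
    using i by (simp add: inner_diff_left Rh v integral_diff)
  also have "\<dots> = integral {0..r} (\<lambda>s. R s (R h x - x) \<bullet> y)"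
    by (intro integral_cong) (simp add: linear_simps[OF lin] inner_diff_left)
  finally show "(R h v - v) \<bullet> y = integral {0..r} (\<lambda>s. R s (R h x - x) \<bullet> y)" .
  have "integral {0..r} (\<lambda>s. R (s + h) x \<bullet> y) = integral {h..r + h} (\<lambda>s. R s x \<bullet> y)"
    using integral_shift_real[of 0 h r "\<lambda>s. R s x \<bullet> y"] c h r by simp
  moreover have "integral {0..r} (\<lambda>s. R s x \<bullet> y) + integral {r..r + h} (\<lambda>s. R s x \<bullet> y)
      = integral {0..h} (\<lambda>s. R s x \<bullet> y) + integral {h..r + h} (\<lambda>s. R s x \<bullet> y)"
    using h r i by (simp add: Henstock_Kurzweil_Integration.integral_combine)
  ultimately show "(R h v - v) \<bullet> y = integral {r..r + h} (\<lambda>s. R s x \<bullet> y) - integral {0..h} (\<lambda>s. R s x \<bullet> y)"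
    by (simp add: inner_diff_left Rh v)
qed

text \<open>Divided by \<open>r\<close>, the averages over \<open>[0,r]\<close> tend weakly to \<open>x\<close> as \<open>r\<close> tends to \<open>0\<close>, so the averages are total.\<close>

lemma zero_if_orthogonal_to_averages:
  assumes "\<And>x r v. 0 < r \<Longrightarrow> (\<And>y. v \<bullet> y = integral {0..r} (\<lambda>s. R s x \<bullet> y)) \<Longrightarrow> v \<bullet> q = 0"
  shows "q = 0"
proof -
  have "R 0 q \<bullet> q = 0"
  proof (rule continuous_value_zero_if_integrals_zero)
    show "continuous_on {0..1} (\<lambda>t. R t q \<bullet> q)" by (auto intro!: continuous_on_subset[OF weak_cont])
    fix r :: real assume r: "0 < r" "r \<le> 1"
    obtain v where "\<forall>y. v \<bullet> y = integral {0..r} (\<lambda>s. R s q \<bullet> y)" using average_exists r by fastforce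
    then show "integral {0..r} (\<lambda>t. R t q \<bullet> q) = 0" using assms[OF r(1), of v q] by simp
  qed
  then show ?thesis by (simp add: R_0)
qed

text \<open>The vectors with strongly continuous orbit at \<open>0\<close> form a closed subspace. It contains the averages,
whose increments are of order \<open>h\<close>, and these are total; hence it is the whole space.\<close>

theorem strongly_continuous: "((\<lambda>h. R h x) \<longlongrightarrow> x) (at_right 0)"
proof -
  define D where "D = {x. ((\<lambda>h. R h x) \<longlongrightarrow> x) (at_right 0)}"
  obtain M where M: "M \<ge> 1" "\<And>t x. t \<in> {0..1} \<Longrightarrow> norm (R t x) \<le> M * norm x"
    using bound by blast
  have ev: "\<forall>\<^sub>F h in at_right (0::real). 0 < h \<and> h < 1"
    by (simp add: eventually_at_right_less eventually_conj eventually_at_right[of 0 1]) (metis zero_less_one)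
  have "subspace D"
  proof (rule subspaceI)
    have "\<forall>\<^sub>F h in at_right 0. R h 0 = 0"
      using ev by eventually_elim (simp add: linear_simps(3)[OF lin])
    then show "0 \<in> D" unfolding D_def by (auto simp: tendsto_eventually)
  next
    fix x y assume "x \<in> D" "y \<in> D"
    then have "((\<lambda>h. R h x + R h y) \<longlongrightarrow> x + y) (at_right 0)"
      unfolding D_def by (auto intro: tendsto_add)
    moreover have "\<forall>\<^sub>F h in at_right 0. R h x + R h y = R h (x + y)"
      using ev by eventually_elim (simp add: linear_simps(1)[OF lin])
    ultimately show "x + y \<in> D" unfolding D_def by (auto intro: Lim_transform_eventually)
  next
    fix c x assume "x \<in> D"
    then have "((\<lambda>h. c *\<^sub>R R h x) \<longlongrightarrow> c *\<^sub>R x) (at_right 0)"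
      unfolding D_def by (auto intro: tendsto_scaleR)
    moreover have "\<forall>\<^sub>F h in at_right 0. c *\<^sub>R R h x = R h (c *\<^sub>R x)"
      using ev by eventually_elim (simp add: linear_simps(5)[OF lin])
    ultimately show "c *\<^sub>R x \<in> D" unfolding D_def by (auto intro: Lim_transform_eventually)
  qed
  moreover have "closed D"
  proof (rule closed_sequential_limits[THEN iffD2], intro allI impI, elim conjE)
    fix X l assume X: "\<forall>n. X n \<in> D" "X \<longlonglongrightarrow> l"
    show "l \<in> D" unfolding D_def mem_Collect_eq
    proof (rule tendstoI)
      fix e :: real assume e: "e > 0"
      have "e / (4 * M) > 0" using e M by simp
      then obtain n where n: "norm (X n - l) < e / (4 * M)"
        using X(2) unfolding LIMSEQ_iff by blast
      have "\<forall>\<^sub>F h in at_right 0. dist (R h (X n)) (X n) < e / 4"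
        using X(1) e unfolding D_def by (intro tendstoD) auto
      with ev show "\<forall>\<^sub>F h in at_right 0. dist (R h l) l < e"
      proof eventually_elim
        case (elim h)
        have "R h l - l = R h (l - X n) + (R h (X n) - X n) + (X n - l)"
          using elim by (simp add: linear_simps(2)[OF lin])
        then have "norm (R h l - l) \<le> norm (R h (l - X n)) + norm (R h (X n) - X n) + norm (X n - l)"
          using norm_triangle_ineq[of "R h (l - X n) + (R h (X n) - X n)" "X n - l"]
            norm_triangle_ineq[of "R h (l - X n)" "R h (X n) - X n"] by simp
        moreover have "norm (R h (l - X n)) \<le> M * norm (X n - l)"
          using M(2)[of h "l - X n"] elim by (simp add: norm_minus_commute)
        moreover have "M * norm (X n - l) < e / 4" using n M by (simp add: field_simps)
        moreover have "norm (X n - l) \<le> M * norm (X n - l)" using M mult_right_mono[of 1 M] by simp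
        ultimately show ?case using elim e unfolding dist_norm by linarith
      qed
    qed
  qed
  moreover have "q = 0" if q: "\<And>x. x \<in> D \<Longrightarrow> q \<bullet> x = 0" for q
  proof (rule zero_if_orthogonal_to_averages)
    fix x r v assume r: "0 < r" and v: "\<And>y. v \<bullet> y = integral {0..r} (\<lambda>s. R s x \<bullet> y)"
    obtain K where K: "K \<ge> 1" "\<And>t x. t \<in> {0..r + 1} \<Longrightarrow> norm (R t x) \<le> K * norm x"
      using bound by blast
    have le: "norm (R h v - v) \<le> h * (2 * K * norm x)" if h: "0 < h" "h < 1" for h
    proof (rule norm_le_if_inner_le)
      show "0 \<le> h * (2 * K * norm x)" using h K by simp
      fix y
      have b: "\<bar>R t x \<bullet> y\<bar> \<le> K * norm x * norm y" if "t \<in> {0..r + 1}" for t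
        using Cauchy_Schwarz_ineq2[of "R t x" y] mult_right_mono[OF K(2)[OF that], of "norm y" x] by simp
      have "norm (integral {r..r + h} (\<lambda>s. R s x \<bullet> y)) \<le> (K * norm x * norm y) * (r + h - r)"
        using h r b by (intro integral_bound continuous_on_subset[OF weak_cont]) auto
      moreover have "norm (integral {0..h} (\<lambda>s. R s x \<bullet> y)) \<le> (K * norm x * norm y) * (h - 0)"
        using h r b by (intro integral_bound continuous_on_subset[OF weak_cont]) auto
      ultimately show "(R h v - v) \<bullet> y \<le> h * (2 * K * norm x) * norm y"
        using inner_average_diff(2)[of r h v x y] v r h by (simp add: algebra_simps)
    qed
    have "((\<lambda>h. R h v - v) \<longlongrightarrow> 0) (at_right 0)"
    proof (rule Lim_null_comparison)
      show "\<forall>\<^sub>F h in at_right 0. norm (R h v - v) \<le> h * (2 * K * norm x)"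
        using ev by eventually_elim (simp add: le)
      show "((\<lambda>h. h * (2 * K * norm x)) \<longlongrightarrow> 0) (at_right 0)"
        by (auto intro!: tendsto_eq_intros)
    qed
    then have "v \<in> D" unfolding D_def by (simp add: LIM_zero_iff)
    then show "v \<bullet> q = 0" using q[of v] by (simp add: inner_commute[of v])
  qed
  ultimately have "D = UNIV" by (rule closed_subspace_eq_UNIV)
  then show ?thesis unfolding D_def by blast
qed

lemma C0: "C0_semigroup R"
  unfolding C0_semigroup_def by (simp add: lin R_0 R_add strongly_continuous)

end

text \<open>If there were no bound near \<open>0\<close>, there would be times \<open>t n\<close> tending to \<open>0\<close> at which the norms of
\<open>S (t n)\<close> are unbounded, although \<open>S (t n) x\<close> converges for every \<open>x\<close>; this contradicts uniform
boundedness. The semigroup law extends the bound \<open>M\<close> from \<open>[0,\<delta>]\<close> to \<open>M ^ n\<close> on \<open>[0,n \<delta>]\<close>.\<close>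

lemma C0_semigroup_bound:
  fixes S :: "real \<Rightarrow> 'h::{real_normed_vector, complete_space} \<Rightarrow> 'h"
  assumes C0: "C0_semigroup S"
  shows "\<exists>M\<ge>1. \<forall>t\<in>{0..T}. \<forall>x. norm (S t x) \<le> M * norm x"
proof -
  have lin: "\<And>t. t \<ge> 0 \<Longrightarrow> bounded_linear (S t)" and S0: "\<And>x. S 0 x = x"
    and add: "\<And>s t x. s \<ge> 0 \<Longrightarrow> t \<ge> 0 \<Longrightarrow> S (s + t) x = S s (S t x)"
    and lim: "\<And>x. ((\<lambda>t. S t x) \<longlongrightarrow> x) (at_right 0)"
    using C0 unfolding C0_semigroup_def by auto
  have "\<exists>\<delta>>0. \<exists>M. \<forall>t\<in>{0..\<delta>}. \<forall>x. norm (S t x) \<le> M * norm x"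
  proof (rule ccontr)
    assume neg: "\<not> ?thesis"
    have "\<exists>t x. t \<in> {0..1 / real (Suc n)} \<and> norm (S t x) > real (Suc n) * norm x" for n
    proof (rule ccontr)
      assume "\<not> ?thesis"
      then have "\<forall>t\<in>{0..1 / real (Suc n)}. \<forall>x. norm (S t x) \<le> real (Suc n) * norm x"
        by (meson not_le)
      moreover have "1 / real (Suc n) > 0" by simp
      ultimately show False using neg by blast
    qed
    then obtain t X where t: "\<And>n. t n \<in> {0..1 / real (Suc n)}"
      and X: "\<And>n. norm (S (t n) (X n)) > real (Suc n) * norm (X n)"
      by metis
    (* Time 0 is excluded because S 0 is the identity; the right limit at 0 then applies. *)
    have t0: "t n > 0" for n
    proof -
      have "t n \<noteq> 0"
      proof
        assume "t n = 0"
        then have "real (Suc n) * norm (X n) < 1 * norm (X n)" using X[of n] by (simp add: S0)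
        moreover have "1 * norm (X n) \<le> real (Suc n) * norm (X n)"
          by (intro mult_right_mono) auto
        ultimately show False by linarith
      qed
      then show ?thesis using t[of n] by auto
    qed
    have "t \<longlonglongrightarrow> 0"
    proof (rule Lim_null_comparison)
      show "\<forall>\<^sub>F n in sequentially. norm (t n) \<le> 1 / real (Suc n)" using t by auto
      show "(\<lambda>n. 1 / real (Suc n)) \<longlonglongrightarrow> 0" by (rule LIMSEQ_Suc[OF lim_1_over_n])
    qed
    then have ft: "filterlim t (at_right 0) sequentially"
      unfolding filterlim_at using t0 less_imp_neq[OF t0] by (auto simp: eq_commute[of 0])
    have "\<exists>C. \<forall>n. norm (S (t n) x) \<le> C" for x
    proof -
      have "(\<lambda>n. S (t n) x) \<longlonglongrightarrow> x" by (rule filterlim_compose[OF lim ft])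
      then have "Bseq (\<lambda>n. S (t n) x)" by (intro convergent_imp_Bseq convergentI)
      then show ?thesis unfolding Bseq_def by blast
    qed
    then obtain M where M: "\<And>n x. norm (S (t n) x) \<le> M * norm x"
      using uniform_boundedness[of "\<lambda>n. S (t n)"] lin t0 by (meson less_imp_le)
    obtain n where "M \<le> real n" using real_arch_simple by blast
    then have "M * norm (X n) \<le> real (Suc n) * norm (X n)" by (intro mult_right_mono) auto
    then show False using M[of n "X n"] X[of n] by linarith
  qed
  then obtain \<delta> M0 where \<delta>: "\<delta> > 0" and M0: "\<And>t x. t \<in> {0..\<delta>} \<Longrightarrow> norm (S t x) \<le> M0 * norm x"
    by blast
  define M where "M = max 1 M0"
  have M1: "M \<ge> 1" by (simp add: M_def)
  have M: "norm (S t x) \<le> M * norm x" if "t \<in> {0..\<delta>}" for t x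
    using M0[OF that, of x] mult_right_mono[of M0 M "norm x"] by (simp add: M_def)
  have pow: "norm (S t x) \<le> M ^ n * norm x" if "t \<in> {0..real n * \<delta>}" for n t x
    using that
  proof (induction n arbitrary: t)
    case 0
    then show ?case by (simp add: S0)
  next
    case (Suc n)
    show ?case
    proof (cases "t \<le> \<delta>")
      case True
      have "norm (S t x) \<le> M * norm x" using M True Suc.prems by auto
      also have "\<dots> \<le> M ^ Suc n * norm x"
        using M1 one_le_power[of M n] by (intro mult_right_mono) auto
      finally show ?thesis .
    next
      case False
      then have "S t x = S \<delta> (S (t - \<delta>) x)" using add[of \<delta> "t - \<delta>" x] \<delta> by simp
      also have "norm \<dots> \<le> M * norm (S (t - \<delta>) x)" using M \<delta> by auto
      also have "\<dots> \<le> M * (M ^ n * norm x)"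
        using Suc.IH[of "t - \<delta>"] Suc.prems False M1 by (intro mult_left_mono) (auto simp: algebra_simps)
      finally show ?thesis by simp
    qed
  qed
  obtain n where "T / \<delta> \<le> real n" using real_arch_simple by blast
  then have "T \<le> real n * \<delta>" using \<delta> by (simp add: field_simps)
  then have "\<forall>t\<in>{0..T}. \<forall>x. norm (S t x) \<le> M ^ n * norm x" using pow by auto
  then show ?thesis using one_le_power[OF M1, of n] by blast
qed

lemma C0_semigroup_continuous:
  fixes S :: "real \<Rightarrow> 'h::{real_normed_vector, complete_space} \<Rightarrow> 'h"
  assumes C0: "C0_semigroup S"
  shows "continuous_on {0..} (\<lambda>t. S t x)"
proof -
  have lin: "\<And>t. t \<ge> 0 \<Longrightarrow> bounded_linear (S t)"
    and add: "\<And>s t x. s \<ge> 0 \<Longrightarrow> t \<ge> 0 \<Longrightarrow> S (s + t) x = S s (S t x)"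
    and lim: "((\<lambda>t. S t x) \<longlongrightarrow> x) (at_right 0)"
    using C0 unfolding C0_semigroup_def by auto
  show ?thesis unfolding continuous_on_iff
  proof (intro ballI allI impI)
    fix t0 e :: real assume t0: "t0 \<in> {0..}" and e: "e > 0"
    obtain M where M: "M \<ge> 1" "\<And>t x. t \<in> {0..t0 + 1} \<Longrightarrow> norm (S t x) \<le> M * norm x"
      using C0_semigroup_bound[OF C0] by metis
    have "e / M > 0" using e M by simp
    from tendstoD[OF lim this] obtain d where d: "d > 0" "\<And>h. 0 < h \<Longrightarrow> h < d \<Longrightarrow> norm (S h x - x) < e / M"
      unfolding eventually_at_right_field dist_norm by auto
    have key: "norm (S t x - S s x) < e" if "0 \<le> s" "s < t" "t - s < d" "s \<le> t0 + 1" for s t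
    proof -
      have "S t x - S s x = S s (S (t - s) x - x)"
        using add[of s "t - s" x] that by (simp add: linear_simps[OF lin])
      then have "norm (S t x - S s x) \<le> M * norm (S (t - s) x - x)" using M that by simp
      also have "\<dots> < e" using d(2)[of "t - s"] that M by (simp add: field_simps)
      finally show ?thesis .
    qed
    show "\<exists>d>0. \<forall>t\<in>{0..}. dist t t0 < d \<longrightarrow> dist (S t x) (S t0 x) < e"
    proof (intro exI conjI ballI impI)
      show "d > 0" by fact
      fix t assume t: "t \<in> {0..}" "dist t t0 < d"
      consider "t < t0" | "t = t0" | "t0 < t" by linarith
      then show "dist (S t x) (S t0 x) < e"
      proof cases
        case 1
        then show ?thesis using key[of t t0] t t0 by (simp add: dist_norm norm_minus_commute)
      next
        case 3
        then show ?thesis using key[of t0 t] t t0 by (simp add: dist_norm)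
      qed (use e in simp)
    qed
  qed
qed

lemma weak_semigroup_C0:
  fixes S :: "real \<Rightarrow> 'h::{real_inner, complete_space} \<Rightarrow> 'h"
  assumes C0: "C0_semigroup S"
  shows "weak_semigroup S"
proof (rule weak_semigroup.intro)
  show "continuous_on {0..} (\<lambda>t. S t x \<bullet> y)" for x y
    by (intro continuous_intros C0_semigroup_continuous[OF C0])
  show "\<exists>M\<ge>1. \<forall>t\<in>{0..T}. \<forall>x. norm (S t x) \<le> M * norm x" for T
    by (rule C0_semigroup_bound[OF C0])
qed (use C0 in \<open>auto simp: C0_semigroup_def\<close>)

lemma adjoint_weak_semigroup:
  fixes S :: "real \<Rightarrow> 'h::{real_inner, complete_space} \<Rightarrow> 'h"
  assumes C0: "C0_semigroup S"
  shows "weak_semigroup (\<lambda>t. adjoint (S t))"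
proof -
  interpret S: weak_semigroup S by (rule weak_semigroup_C0[OF C0])
  have eqI: "u = v" if "\<And>x. x \<bullet> u = x \<bullet> v" for u v :: 'h
    using that[of "u - v"] by (metis inner_eq_zero_iff inner_diff_right right_minus_eq)
  have bd: "bounded_linear (adjoint (S t)) \<and> norm (adjoint (S t) y) \<le> M * norm y"
    if "t \<ge> 0" "M \<ge> 1" "\<forall>t\<in>{0..t}. \<forall>x. norm (S t x) \<le> M * norm x" for t M y
    using that by (auto intro!: bounded_linear_adjoint S.lin)
  show ?thesis
  proof (rule weak_semigroup.intro)
    show "bounded_linear (adjoint (S t))" if "t \<ge> 0" for t
      using S.bound[of t] bd[OF that] by blast
    show "adjoint (S 0) x = x" for x
      by (rule eqI) (simp add: inner_adjoint[OF S.lin, symmetric] S.R_0)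
    show "adjoint (S (s + t)) x = adjoint (S s) (adjoint (S t) x)" if "s \<ge> 0" "t \<ge> 0" for s t x
    proof (rule eqI)
      fix z
      have "S (s + t) z = S t (S s z)" using S.R_add[of t s z] that by (simp add: add.commute)
      then show "z \<bullet> adjoint (S (s + t)) x = z \<bullet> adjoint (S s) (adjoint (S t) x)"
        using that by (simp add: inner_adjoint[OF S.lin, symmetric])
    qed
    show "continuous_on {0..} (\<lambda>t. adjoint (S t) x \<bullet> y)" for x y
    proof (rule continuous_on_eq[OF S.weak_cont[of y x]])
      fix t :: real assume "t \<in> {0..}"
      then have "S t y \<bullet> x = y \<bullet> adjoint (S t) x" by (intro inner_adjoint S.lin) auto
      then show "S t y \<bullet> x = adjoint (S t) x \<bullet> y" by (simp add: inner_commute[of y])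
    qed
    show "\<exists>M\<ge>1. \<forall>t\<in>{0..T}. \<forall>x. norm (adjoint (S t) x) \<le> M * norm x" for T
    proof -
      obtain M where M: "M \<ge> 1" "\<forall>t\<in>{0..T}. \<forall>x. norm (S t x) \<le> M * norm x" using S.bound by blast
      have "norm (adjoint (S t) x) \<le> M * norm x" if "t \<in> {0..T}" for t x
        using bd[of t M x] M that by auto
      then show ?thesis using M(1) by blast
    qed
  qed
qed

lemma norm_difference_quotient_le:
  fixes u a :: "'a::real_normed_vector"
  assumes "h > 0" "norm (u - h *\<^sub>R a) \<le> h * c"
  shows "norm (u /\<^sub>R h - a) \<le> c"
proof -
  have "u /\<^sub>R h - a = (u - h *\<^sub>R a) /\<^sub>R h" using assms(1) by (simp add: scaleR_diff_right)
  also have "norm \<dots> = norm (u - h *\<^sub>R a) / h" using assms(1) by (simp add: divide_inverse mult.commute)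
  also have "\<dots> \<le> c" using assms by (simp add: field_simps)
  finally show ?thesis .
qed

text \<open>The difference quotient is the mean of the orbit over \<open>[r,r + h]\<close> minus its mean over \<open>[0,h]\<close>, and
both means converge by continuity of the orbit.\<close>

lemma average_in_generator:
  fixes S :: "real \<Rightarrow> 'h::{real_inner, complete_space} \<Rightarrow> 'h"
  assumes C0: "C0_semigroup S" and r: "r \<ge> 0"
    and v: "\<And>y. v \<bullet> y = integral {0..r} (\<lambda>s. S s x \<bullet> y)"
  shows "(v, S r x - x) \<in> generator S"
proof -
  interpret S: weak_semigroup S by (rule weak_semigroup_C0[OF C0])
  have "((\<lambda>h. (S h v - v) /\<^sub>R h) \<longlongrightarrow> S r x - x) (at_right 0)"
  proof (rule tendstoI)
    fix e :: real assume e: "e > 0"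
    have cont: "continuous_on {0..} (\<lambda>s. S s x)" by (rule C0_semigroup_continuous[OF C0])
    obtain d1 where d1: "d1 > 0" "\<And>s. s \<ge> 0 \<Longrightarrow> dist s r < d1 \<Longrightarrow> dist (S s x) (S r x) < e / 4"
      using cont r e unfolding continuous_on_iff
      by (metis atLeast_iff divide_pos_pos zero_less_numeral)
    obtain d2 where d2: "d2 > 0" "\<And>s. s \<ge> 0 \<Longrightarrow> dist s 0 < d2 \<Longrightarrow> dist (S s x) (S 0 x) < e / 4"
      using cont e unfolding continuous_on_iff
      by (metis atLeast_iff divide_pos_pos zero_less_numeral order_refl)
    have ev: "\<forall>\<^sub>F h in at_right 0. 0 < h \<and> h < min d1 d2"
      using d1(1) d2(1) unfolding eventually_at_right_field by (intro exI[of _ "min d1 d2"]) auto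
    then show "\<forall>\<^sub>F h in at_right 0. dist ((S h v - v) /\<^sub>R h) (S r x - x) < e"
    proof eventually_elim
      case (elim h)
      have "norm ((S h v - v) /\<^sub>R h - (S r x - x)) \<le> e / 2"
      proof (rule norm_difference_quotient_le, use elim in simp, rule norm_le_if_inner_le)
        fix y
        have close: "\<bar>integral {a..a + h} (\<lambda>s. S s x \<bullet> y) - h * (S a x \<bullet> y)\<bar> \<le> e / 4 * norm y * h"
          if a: "a \<ge> 0" and c: "\<And>s. s \<in> {a..a + h} \<Longrightarrow> norm (S s x - S a x) \<le> e / 4" for a
        proof -
          have "(\<lambda>s. S s x \<bullet> y) integrable_on {a..a + h}"
            using a by (intro integrable_continuous_real continuous_on_subset[OF S.weak_cont]) auto
          then have "integral {a..a + h} (\<lambda>s. S s x \<bullet> y - S a x \<bullet> y)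
              = integral {a..a + h} (\<lambda>s. S s x \<bullet> y) - h * (S a x \<bullet> y)"
            using elim by (subst integral_diff) auto
          moreover have "norm (integral {a..a + h} (\<lambda>s. S s x \<bullet> y - S a x \<bullet> y)) \<le> (e / 4 * norm y) * (a + h - a)"
          proof (rule integral_bound)
            show "continuous_on {a..a + h} (\<lambda>s. S s x \<bullet> y - S a x \<bullet> y)"
              using a by (intro continuous_intros continuous_on_subset[OF cont]) auto
            fix s assume "s \<in> {a..a + h}"
            then show "norm (S s x \<bullet> y - S a x \<bullet> y) \<le> e / 4 * norm y"
              using Cauchy_Schwarz_ineq2[of "S s x - S a x" y] mult_right_mono[OF c, of s "norm y"]
              by (simp add: inner_diff_left)
          qed (use elim in simp)
          ultimately show ?thesis by simp
        qed
        have "\<bar>integral {r..r + h} (\<lambda>s. S s x \<bullet> y) - h * (S r x \<bullet> y)\<bar> \<le> e / 4 * norm y * h"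
          using d1(2) elim r by (intro close) (auto simp: dist_norm intro!: less_imp_le)
        moreover have "\<bar>integral {0..0 + h} (\<lambda>s. S s x \<bullet> y) - h * (S 0 x \<bullet> y)\<bar> \<le> e / 4 * norm y * h"
          using d2(2) elim by (intro close) (auto simp: dist_norm intro!: less_imp_le)
        moreover have "((S h v - v) - h *\<^sub>R (S r x - x)) \<bullet> y
            = (integral {r..r + h} (\<lambda>s. S s x \<bullet> y) - h * (S r x \<bullet> y))
              - (integral {0..0 + h} (\<lambda>s. S s x \<bullet> y) - h * (S 0 x \<bullet> y))"
          using S.inner_average_diff(2)[OF r _ v, of h y] elim
          by (simp add: inner_diff_left S.R_0 algebra_simps)
        ultimately have "((S h v - v) - h *\<^sub>R (S r x - x)) \<bullet> y \<le> e / 4 * norm y * h + e / 4 * norm y * h"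
          by linarith
        then show "((S h v - v) - h *\<^sub>R (S r x - x)) \<bullet> y \<le> h * (e / 2) * norm y"
          by (simp add: algebra_simps)
      qed (use elim e in simp)
      then show ?case using e by (simp add: dist_norm)
    qed
  qed
  then show ?thesis by (simp add: generator_def)
qed

text \<open>Density of the domain of the generator, as triviality of the orthogonal complement: the domain
contains the averages of orbits, which are total.\<close>

lemma zero_if_orthogonal_to_generator_domain:
  fixes S :: "real \<Rightarrow> 'h::{real_inner, complete_space} \<Rightarrow> 'h"
  assumes C0: "C0_semigroup S" and q: "\<And>x a. (x, a) \<in> generator S \<Longrightarrow> x \<bullet> q = 0"
  shows "q = 0"
proof -
  interpret S: weak_semigroup S by (rule weak_semigroup_C0[OF C0])
  show ?thesis
    by (rule S.zero_if_orthogonal_to_averages, rule q, rule average_in_generator[OF C0]) auto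
qed

text \<open>The orbit is the integral of its derivative. Instead of differentiating the orbit, the generator is
evaluated at the average \<open>v\<close> of the orbit in two ways: by \<open>average_in_generator\<close> and by
moving the difference quotient onto \<open>x\<close> under the integral.\<close>

lemma generator_integral_formula:
  fixes S :: "real \<Rightarrow> 'h::{real_inner, complete_space} \<Rightarrow> 'h"
  assumes C0: "C0_semigroup S" and xa: "(x, a) \<in> generator S" and r: "r \<ge> 0"
  shows "(S r x - x) \<bullet> y = integral {0..r} (\<lambda>s. S s a \<bullet> y)"
proof -
  interpret S: weak_semigroup S by (rule weak_semigroup_C0[OF C0])
  obtain v where v: "\<And>y. v \<bullet> y = integral {0..r} (\<lambda>s. S s x \<bullet> y)" using S.average_exists[OF r] by blast
  have ev: "\<forall>\<^sub>F h in at_right (0::real). 0 < h" by (simp add: eventually_at_right_less)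
  have lim1: "((\<lambda>h. ((S h v - v) /\<^sub>R h) \<bullet> y) \<longlongrightarrow> (S r x - x) \<bullet> y) (at_right 0)"
    using average_in_generator[OF C0 r v] unfolding generator_def
    by (intro tendsto_inner tendsto_const) simp
  obtain M where M: "M \<ge> 1" "\<And>t x. t \<in> {0..r} \<Longrightarrow> norm (S t x) \<le> M * norm x"
    using S.bound by metis
  have int: "(\<lambda>s. S s x \<bullet> y) integrable_on {0..r}" for x
    by (intro integrable_continuous_real continuous_on_subset[OF S.weak_cont]) auto
  have lim2: "((\<lambda>h. ((S h v - v) /\<^sub>R h) \<bullet> y) \<longlongrightarrow> integral {0..r} (\<lambda>s. S s a \<bullet> y)) (at_right 0)"
  proof (rule LIM_zero_cancel, rule Lim_null_comparison)
    show "\<forall>\<^sub>F h in at_right 0. norm (((S h v - v) /\<^sub>R h) \<bullet> y - integral {0..r} (\<lambda>s. S s a \<bullet> y))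
        \<le> M * norm ((S h x - x) /\<^sub>R h - a) * norm y * r"
      using ev
    proof eventually_elim
      case (elim h)
      define b where "b = (S h x - x) /\<^sub>R h"
      have "((S h v - v) /\<^sub>R h) \<bullet> y = integral {0..r} (\<lambda>s. S s (S h x - x) \<bullet> y) / h"
        using S.inner_average_diff(1)[OF r _ v, of h y] elim by (simp add: divide_inverse mult.commute)
      also have "\<dots> = integral {0..r} (\<lambda>s. S s (S h x - x) \<bullet> y / h)" by simp
      also have "\<dots> = integral {0..r} (\<lambda>s. S s b \<bullet> y)"
        unfolding b_def by (intro integral_cong) (simp add: linear_simps(5)[OF S.lin] divide_inverse mult.commute)
      finally have "((S h v - v) /\<^sub>R h) \<bullet> y - integral {0..r} (\<lambda>s. S s a \<bullet> y)
          = integral {0..r} (\<lambda>s. S s b \<bullet> y - S s a \<bullet> y)"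
        using int by (simp add: integral_diff)
      also have "\<dots> = integral {0..r} (\<lambda>s. S s (b - a) \<bullet> y)"
        by (intro integral_cong) (simp add: linear_simps(2)[OF S.lin] inner_diff_left)
      also have "norm \<dots> \<le> (M * norm (b - a) * norm y) * (r - 0)"
      proof (rule integral_bound)
        fix s assume "s \<in> {0..r}"
        then show "norm (S s (b - a) \<bullet> y) \<le> M * norm (b - a) * norm y"
          using Cauchy_Schwarz_ineq2[of "S s (b - a)" y] mult_right_mono[OF M(2), of s "norm y" "b - a"]
          by simp
      qed (auto intro!: r continuous_on_subset[OF S.weak_cont])
      finally show ?case by (simp add: b_def)
    qed
    have "((\<lambda>h. M * norm ((S h x - x) /\<^sub>R h - a) * norm y * r) \<longlongrightarrow> M * norm (a - a) * norm y * r) (at_right 0)"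
      using xa unfolding generator_def by (intro tendsto_intros) simp
    then show "((\<lambda>h. M * norm ((S h x - x) /\<^sub>R h - a) * norm y * r) \<longlongrightarrow> 0) (at_right 0)" by simp
  qed
  show ?thesis by (rule tendsto_unique[OF _ lim1 lim2]) simp
qed

lemma generator_invariant:
  fixes S :: "real \<Rightarrow> 'h::{real_inner, complete_space} \<Rightarrow> 'h"
  assumes C0: "C0_semigroup S" and xa: "(x, a) \<in> generator S" and s: "s \<ge> 0"
  shows "(S s x, S s a) \<in> generator S"
proof -
  interpret S: weak_semigroup S by (rule weak_semigroup_C0[OF C0])
  interpret Ss: bounded_linear "S s" by (rule S.lin[OF s])
  have "((\<lambda>h. S s ((S h x - x) /\<^sub>R h)) \<longlongrightarrow> S s a) (at_right 0)"
    using xa unfolding generator_def by (auto intro: Ss.tendsto)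
  moreover have "\<forall>\<^sub>F h in at_right (0::real). S s ((S h x - x) /\<^sub>R h) = (S h (S s x) - S s x) /\<^sub>R h"
    using eventually_at_right_less[of "0::real"]
  proof eventually_elim
    case (elim h)
    then have "S s (S h x) = S h (S s x)" using S.R_add[of s h x] S.R_add[of h s x] s by (simp add: add.commute)
    then show ?case by (simp add: Ss.scaleR Ss.diff)
  qed
  ultimately have "((\<lambda>h. (S h (S s x) - S s x) /\<^sub>R h) \<longlongrightarrow> S s a) (at_right 0)"
    by (rule Lim_transform_eventually)
  then show ?thesis by (simp add: generator_def)
qed

text \<open>That the generator of the adjoint semigroup is contained in the adjoint of the generator follows by
passing to the limit in difference quotients. Conversely, for \<open>(z, v)\<close> in the adjoint, the integral formula
for the semigroup tested with \<open>z\<close> shows \<open>S(h)\<^sup>* z - z = \<integral>\<^sub>0\<^sup>h S(s)\<^sup>* v ds\<close> on the domain of the generator, hence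
everywhere by density, and strong continuity of the adjoint semigroup makes the quotients converge
to \<open>v\<close>.\<close>

theorem generates_adjoint:
  fixes S :: "real \<Rightarrow> 'h::{real_inner, complete_space} \<Rightarrow> 'h"
  assumes gen: "generates A S"
  shows "generates (adjoint_op A) (\<lambda>t. adjoint (S t))"
proof -
  have C0: "C0_semigroup S" and A: "A = generator S" using gen by (auto simp: generates_def)
  interpret S: weak_semigroup S by (rule weak_semigroup_C0[OF C0])
  interpret Sa: weak_semigroup "\<lambda>t. adjoint (S t)" by (rule adjoint_weak_semigroup[OF C0])
  have adj: "x \<bullet> adjoint (S t) y = S t x \<bullet> y" if "t \<ge> 0" for t x y
    using inner_adjoint[OF S.lin[OF that]] by simp
  have ev: "\<forall>\<^sub>F h in at_right (0::real). 0 < h" by (simp add: eventually_at_right_less)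
  have "(z, v) \<in> adjoint_op A" if zv: "(z, v) \<in> generator (\<lambda>t. adjoint (S t))" for z v
  proof -
    have "a \<bullet> z = x \<bullet> v" if xa: "(x, a) \<in> A" for x a
    proof (rule tendsto_unique)
      show "((\<lambda>h. ((S h x - x) /\<^sub>R h) \<bullet> z) \<longlongrightarrow> a \<bullet> z) (at_right 0)"
        using xa unfolding A generator_def by (intro tendsto_inner tendsto_const) simp
      have "((\<lambda>h. x \<bullet> ((adjoint (S h) z - z) /\<^sub>R h)) \<longlongrightarrow> x \<bullet> v) (at_right 0)"
        using zv unfolding generator_def by (intro tendsto_inner tendsto_const) simp
      moreover have "\<forall>\<^sub>F h in at_right 0. x \<bullet> ((adjoint (S h) z - z) /\<^sub>R h) = ((S h x - x) /\<^sub>R h) \<bullet> z"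
        using ev by eventually_elim (simp add: inner_simps adj)
      ultimately show "((\<lambda>h. ((S h x - x) /\<^sub>R h) \<bullet> z) \<longlongrightarrow> x \<bullet> v) (at_right 0)"
        by (rule Lim_transform_eventually)
    qed simp
    then show ?thesis by (auto simp: adjoint_op_def)
  qed
  moreover have "(z, v) \<in> generator (\<lambda>t. adjoint (S t))" if zv: "(z, v) \<in> adjoint_op A" for z v
  proof -
    have formula: "(adjoint (S h) z - z) \<bullet> y = integral {0..h} (\<lambda>s. adjoint (S s) v \<bullet> y)" if h: "h \<ge> 0" for h y
    proof -
      obtain w where w: "\<And>y. w \<bullet> y = integral {0..h} (\<lambda>s. adjoint (S s) v \<bullet> y)"
        using Sa.average_exists[OF h] by blast
      have "adjoint (S h) z - z - w = 0"
      proof (rule zero_if_orthogonal_to_generator_domain[OF C0])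
        fix x a assume xa: "(x, a) \<in> generator S"
        have "x \<bullet> (adjoint (S h) z - z) = (S h x - x) \<bullet> z"
          using h by (simp add: inner_simps adj)
        also have "\<dots> = integral {0..h} (\<lambda>s. S s a \<bullet> z)" by (rule generator_integral_formula[OF C0 xa h])
        also have "\<dots> = integral {0..h} (\<lambda>s. adjoint (S s) v \<bullet> x)"
        proof (rule integral_cong)
          fix s assume "s \<in> {0..h}"
          then have "(S s x, S s a) \<in> A" "s \<ge> 0" using generator_invariant[OF C0 xa] A by auto
          then have "S s a \<bullet> z = S s x \<bullet> v" using zv unfolding adjoint_op_def by blast
          then show "S s a \<bullet> z = adjoint (S s) v \<bullet> x" using adj[OF \<open>s \<ge> 0\<close>, of x v] by (simp add: inner_commute)
        qed
        also have "\<dots> = x \<bullet> w" by (subst inner_commute) (simp add: w)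
        finally show "x \<bullet> (adjoint (S h) z - z - w) = 0" by (simp add: inner_simps)
      qed
      then show ?thesis using w[of y] by simp
    qed
    have "((\<lambda>h. (adjoint (S h) z - z) /\<^sub>R h) \<longlongrightarrow> v) (at_right 0)"
    proof (rule tendstoI)
      fix e :: real assume e: "e > 0"
      from tendstoD[OF Sa.strongly_continuous, of "e / 2" v] e
      obtain d where d: "d > 0" "\<And>h. 0 < h \<Longrightarrow> h < d \<Longrightarrow> norm (adjoint (S h) v - v) < e / 2"
        unfolding eventually_at_right_field dist_norm by auto
      have d': "norm (adjoint (S s) v - v) \<le> e / 2" if "0 \<le> s" "s < d" for s
        using d(2)[of s] that e Sa.R_0[of v] by (cases "s = 0") auto
      have "\<forall>\<^sub>F h in at_right 0. 0 < h \<and> h < d"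
        using d(1) unfolding eventually_at_right_field by (intro exI[of _ d]) auto
      then show "\<forall>\<^sub>F h in at_right 0. dist ((adjoint (S h) z - z) /\<^sub>R h) v < e"
      proof eventually_elim
        case (elim h)
        have "norm ((adjoint (S h) z - z) /\<^sub>R h - v) \<le> e / 2"
        proof (rule norm_difference_quotient_le, use elim in simp, rule norm_le_if_inner_le)
          fix y
          have c: "continuous_on {0..h} (\<lambda>s. adjoint (S s) v \<bullet> y)"
            by (auto intro!: continuous_on_subset[OF Sa.weak_cont])
          have "((adjoint (S h) z - z) - h *\<^sub>R v) \<bullet> y = integral {0..h} (\<lambda>s. adjoint (S s) v \<bullet> y - v \<bullet> y)"
            using elim integrable_continuous_real[OF c]
            by (subst inner_diff_left, subst integral_diff) (auto simp: formula)
          moreover have "norm (integral {0..h} (\<lambda>s. adjoint (S s) v \<bullet> y - v \<bullet> y)) \<le> (e / 2 * norm y) * (h - 0)"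
          proof (rule integral_bound)
            fix s assume "s \<in> {0..h}"
            then show "norm (adjoint (S s) v \<bullet> y - v \<bullet> y) \<le> e / 2 * norm y"
              using Cauchy_Schwarz_ineq2[of "adjoint (S s) v - v" y] mult_right_mono[OF d', of s "norm y"] elim
              by (simp add: inner_diff_left)
          qed (use elim c in \<open>auto intro!: continuous_intros\<close>)
          ultimately show "((adjoint (S h) z - z) - h *\<^sub>R v) \<bullet> y \<le> h * (e / 2) * norm y"
            by (simp add: algebra_simps)
        qed (use elim e in simp)
        then show ?case using e by (simp add: dist_norm)
      qed
    qed
    then show ?thesis by (simp add: generator_def)
  qed
  ultimately have "generator (\<lambda>t. adjoint (S t)) = adjoint_op A" by auto
  then show ?thesis using Sa.C0 by (simp add: generates_def)
qed

section \<open>Strongly measurable functions and the Bochner integral\<close>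

lemma strongly_measurable_compose2:
  assumes f: "strongly_measurable M f" and g: "strongly_measurable M g"
    and h: "\<And>u v a b. u \<longlonglongrightarrow> a \<Longrightarrow> v \<longlonglongrightarrow> b \<Longrightarrow> (\<lambda>n. h (u n) (v n)) \<longlonglongrightarrow> h a b"
  shows "strongly_measurable M (\<lambda>x. h (f x) (g x))"
proof -
  obtain s where s: "\<And>i. simple_function M (s i)" "AE x in M. (\<lambda>i. s i x) \<longlonglongrightarrow> f x"
    using f unfolding strongly_measurable_def by blast
  obtain t where t: "\<And>i. simple_function M (t i)" "AE x in M. (\<lambda>i. t i x) \<longlonglongrightarrow> g x"
    using g unfolding strongly_measurable_def by blast
  show ?thesis unfolding strongly_measurable_def
  proof (intro exI conjI allI)
    show "simple_function M (\<lambda>x. h (s i x) (t i x))" for i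
      by (rule simple_function_compose2[OF s(1) t(1)])
    show "AE x in M. (\<lambda>i. h (s i x) (t i x)) \<longlonglongrightarrow> h (f x) (g x)"
      using s(2) t(2) by eventually_elim (rule h)
  qed
qed

lemma strongly_measurable_compose:
  assumes "strongly_measurable M f" and "\<And>u a. u \<longlonglongrightarrow> a \<Longrightarrow> (\<lambda>n. h (u n)) \<longlonglongrightarrow> h a"
  shows "strongly_measurable M (\<lambda>x. h (f x))"
  using strongly_measurable_compose2[OF assms(1,1), of "\<lambda>a b. h a"] assms(2) by simp

lemma strongly_measurable_cong_AE:
  assumes "strongly_measurable M f" "AE x in M. f x = g x"
  shows "strongly_measurable M g"
proof -
  obtain s where s: "\<And>i. simple_function M (s i)" "AE x in M. (\<lambda>i. s i x) \<longlonglongrightarrow> f x"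
    using assms unfolding strongly_measurable_def by blast
  have "AE x in M. (\<lambda>i. s i x) \<longlonglongrightarrow> g x" using s(2) assms(2) by eventually_elim simp
  then show ?thesis unfolding strongly_measurable_def using s(1) by blast
qed

text \<open>Replacing almost everywhere convergence by convergence everywhere makes the approximating functions
usable on product spaces, where the exceptional null set would have to be lifted.\<close>

lemma strongly_measurable_everywhere_limit:
  fixes f :: "'a \<Rightarrow> 'b::real_normed_vector"
  assumes "strongly_measurable M f"
  shows "\<exists>f' s. (\<forall>i. simple_function M (s i)) \<and> (\<forall>x. (\<lambda>i. s i x) \<longlonglongrightarrow> f' x) \<and> (AE x in M. f' x = f x)"
proof -
  obtain s where s: "\<And>i. simple_function M (s i)" and lim: "AE x in M. (\<lambda>i. s i x) \<longlonglongrightarrow> f x"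
    using assms unfolding strongly_measurable_def by blast
  obtain N where N: "{x \<in> space M. \<not> (\<lambda>i. s i x) \<longlonglongrightarrow> f x} \<subseteq> N" "emeasure M N = 0" "N \<in> sets M"
    by (rule AE_E[OF lim])
  show ?thesis
  proof (intro exI conjI allI)
    show "simple_function M (\<lambda>x. if x \<in> space M - N then s i x else 0)" for i
      using s N by (intro simple_function_If_set) auto
    show "(\<lambda>i. if x \<in> space M - N then s i x else 0) \<longlonglongrightarrow> (if x \<in> space M - N then f x else 0)" for x
      using N by auto
    have "N \<in> null_sets M" using N by auto
    from AE_not_in[OF this] AE_space show "AE x in M. (if x \<in> space M - N then f x else 0) = f x"
      by eventually_elim auto
  qed
qed

lemma (in complete_measure) measurable_cong_AE_complete:
  assumes f: "f \<in> measurable M N" and eq: "AE x in M. f x = g x" and g: "g \<in> space M \<rightarrow> space N"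
  shows "g \<in> measurable M N"
proof (rule measurableI)
  show "g x \<in> space N" if "x \<in> space M" for x using g that by auto
  fix A assume A: "A \<in> sets N"
  show "g -` A \<inter> space M \<in> sets M"
  proof (rule in_sets_AE)
    show "AE x in M. x \<in> f -` A \<inter> space M \<longleftrightarrow> x \<in> g -` A \<inter> space M"
      using eq by eventually_elim auto
    show "f -` A \<inter> space M \<in> sets M" using f A by (rule measurable_sets)
  qed auto
qed

lemma (in complete_measure) integral_cong_AE_complete:
  fixes f g :: "'a \<Rightarrow> real"
  assumes g: "g \<in> borel_measurable M" and eq: "AE x in M. g x = f x"
  shows "integral\<^sup>L M f = integral\<^sup>L M g"
proof (rule integral_cong_AE)
  show "f \<in> borel_measurable M" using g eq by (rule measurable_cong_AE_complete) simp
  show "AE x in M. f x = g x" using eq by eventually_elim simp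
qed (rule g)

definition square_integrable :: "'a measure \<Rightarrow> ('a \<Rightarrow> 'b::real_normed_vector) \<Rightarrow> bool" where
  "square_integrable M f \<longleftrightarrow> strongly_measurable M f \<and> integrable M (\<lambda>x. (norm (f x))\<^sup>2)"

lemma L2_eq: "L2 T = {f. square_integrable (time_measure T) f}"
  by (simp add: L2_def square_integrable_def)

text \<open>Strong measurability is defined by convergence almost everywhere. Completeness of the measure makes
measurability of the scalar functions derived from it insensitive to null sets.\<close>

locale complete_finite_measure = complete_measure M + finite_measure M for M :: "'a measure"
begin

lemma borel_measurable_strongly_measurable:
  fixes f :: "'a \<Rightarrow> real"
  assumes "strongly_measurable M f"
  shows "f \<in> borel_measurable M"
proof -
  obtain f' s where s: "\<And>i. simple_function M (s i)" "\<And>x. (\<lambda>i. s i x) \<longlonglongrightarrow> f' x" and ae: "AE x in M. f' x = f x"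
    using strongly_measurable_everywhere_limit[OF assms] by blast
  have "f' \<in> borel_measurable M"
    by (rule borel_measurable_LIMSEQ_real[OF s(2)]) (rule borel_measurable_simple_function[OF s(1)])
  then show ?thesis using ae by (rule measurable_cong_AE_complete) auto
qed

lemma borel_measurable_norm_diff:
  assumes "strongly_measurable M f" "strongly_measurable M g"
  shows "(\<lambda>x. norm (f x - g x)) \<in> borel_measurable M"
  by (rule borel_measurable_strongly_measurable, rule strongly_measurable_compose2[OF assms])
    (intro tendsto_intros)

lemma strongly_measurable_simple: "simple_function M f \<Longrightarrow> strongly_measurable M f"
  unfolding strongly_measurable_def by (rule exI[of _ "\<lambda>_. f"]) simp

lemma borel_measurable_norm_strong:
  assumes "strongly_measurable M f"
  shows "(\<lambda>x. norm (f x)) \<in> borel_measurable M"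
  using borel_measurable_norm_diff[OF assms strongly_measurable_simple[OF simple_function_const[of _ 0]]] by simp

lemma borel_measurable_inner_strong:
  assumes "strongly_measurable M f" "strongly_measurable M g"
  shows "(\<lambda>x. f x \<bullet> g x) \<in> borel_measurable M"
  by (rule borel_measurable_strongly_measurable, rule strongly_measurable_compose2[OF assms])
    (intro tendsto_intros)

text \<open>Truncating the approximants where they exceed \<open>2 * norm (f x)\<close> keeps the convergence and provides the
majorant for dominated convergence. At points with \<open>f x = 0\<close> the truncation yields \<open>0\<close>.\<close>

lemma dominated_simple_approximation:
  assumes f: "strongly_measurable M f"
  shows "\<exists>s. (\<forall>i. simple_function M (s i)) \<and> (AE x in M. (\<lambda>i. s i x) \<longlonglongrightarrow> f x) \<and>
    (\<forall>i x. norm (s i x) \<le> 2 * norm (f x))"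
proof -
  obtain s where s: "\<And>i. simple_function M (s i)" and lim: "AE x in M. (\<lambda>i. s i x) \<longlonglongrightarrow> f x"
    using f unfolding strongly_measurable_def by blast
  define t where "t i x = (if norm (s i x) \<le> 2 * norm (f x) then s i x else 0)" for i x
  show ?thesis
  proof (intro exI conjI allI)
    show "simple_function M (t i)" for i
      unfolding t_def
    proof (rule simple_function_If)
      note [measurable] = borel_measurable_norm_strong[OF f]
        borel_measurable_norm_strong[OF strongly_measurable_simple[OF s[of i]]]
      show "{x \<in> space M. norm (s i x) \<le> 2 * norm (f x)} \<in> sets M" by measurable
    qed (use s in auto)
    show "norm (t i x) \<le> 2 * norm (f x)" for i x by (simp add: t_def)
    show "AE x in M. (\<lambda>i. t i x) \<longlonglongrightarrow> f x"
      using lim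
    proof eventually_elim
      case (elim x)
      show ?case
      proof (cases "f x = 0")
        case True
        then have "t i x = 0" for i by (auto simp: t_def)
        then show ?thesis using True by simp
      next
        case False
        then have "norm (f x) < 2 * norm (f x)" by simp
        with order_tendstoD(2)[OF tendsto_norm[OF elim]]
        have "\<forall>\<^sub>F i in sequentially. norm (s i x) < 2 * norm (f x)" by blast
        then have "\<forall>\<^sub>F i in sequentially. s i x = t i x"
          by eventually_elim (simp add: t_def)
        with elim show ?thesis by (rule Lim_transform_eventually)
      qed
    qed
  qed
qed

text \<open>The integral is found weakly, by Riesz representation. The elementary integrals of dominated
simple approximants converge to it in norm, since each distance is at most the \<open>L\<^sup>1\<close> distance of
the integrands.\<close>

theorem strong_integral_exists:
  fixes f :: "'a \<Rightarrow> 'b::{real_inner, complete_space}"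
  assumes f: "strongly_measurable M f" and int: "integrable M (\<lambda>x. norm (f x))"
  shows "\<exists>v. has_strong_integral M f v \<and> (\<forall>y. v \<bullet> y = (\<integral>x. f x \<bullet> y \<partial>M))"
proof -
  let ?I = "Bochner_Integration.simple_bochner_integral M :: ('a \<Rightarrow> 'b) \<Rightarrow> 'b"
  have int_inner: "integrable M (\<lambda>x. f x \<bullet> y)" for y
  proof (rule Bochner_Integration.integrable_bound)
    show "integrable M (\<lambda>x. norm (f x) * norm y)" using int by simp
    show "(\<lambda>x. f x \<bullet> y) \<in> borel_measurable M"
      by (intro borel_measurable_inner_strong f strongly_measurable_simple) simp
  qed (simp add: Cauchy_Schwarz_ineq2)
  have "\<exists>v. \<forall>y. (\<integral>x. f x \<bullet> y \<partial>M) = v \<bullet> y"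
  proof (rule Riesz_Hilbert)
    show "(\<integral>x. f x \<bullet> (y + c *\<^sub>R z) \<partial>M) = (\<integral>x. f x \<bullet> y \<partial>M) + c * (\<integral>x. f x \<bullet> z \<partial>M)" for y c z
      using int_inner by (simp add: inner_simps)
    show "\<bar>\<integral>x. f x \<bullet> y \<partial>M\<bar> \<le> (\<integral>x. norm (f x) \<partial>M) * norm y" for y
    proof -
      have "\<bar>\<integral>x. f x \<bullet> y \<partial>M\<bar> \<le> (\<integral>x. \<bar>f x \<bullet> y\<bar> \<partial>M)" by (rule integral_abs_bound)
      also have "\<dots> \<le> (\<integral>x. norm (f x) * norm y \<partial>M)"
        using int_inner int by (intro integral_mono) (auto simp: Cauchy_Schwarz_ineq2)
      finally show ?thesis by simp
    qed
  qed
  then obtain v where v: "\<And>y. v \<bullet> y = (\<integral>x. f x \<bullet> y \<partial>M)" by metis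
  obtain s where s: "\<And>i. simple_function M (s i)" and lim: "AE x in M. (\<lambda>i. s i x) \<longlonglongrightarrow> f x"
    and dom: "\<And>i x. norm (s i x) \<le> 2 * norm (f x)"
    using dominated_simple_approximation[OF f] by blast
  have sbi: "Bochner_Integration.simple_bochner_integrable M (s i)" for i
    by (rule simple_bochner_integrable.intros[OF s]) (simp add: emeasure_eq_measure)
  have meas: "(\<lambda>x. norm (f x - s i x)) \<in> borel_measurable M" for i
    by (rule borel_measurable_norm_diff[OF f strongly_measurable_simple[OF s]])
  have bd: "norm (f x - s i x) \<le> 3 * norm (f x)" for i x
    using norm_triangle_ineq4[of "f x" "s i x"] dom[of i x] by simp
  have intd: "integrable M (\<lambda>x. norm (f x - s i x))" for i
    by (rule Bochner_Integration.integrable_bound[where f="\<lambda>x. 3 * norm (f x)"]) (use int meas bd in auto)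
  have L1: "(\<lambda>i. \<integral>x. norm (f x - s i x) \<partial>M) \<longlonglongrightarrow> (\<integral>x. 0 \<partial>M)"
  proof (rule integral_dominated_convergence[where w="\<lambda>x. 3 * norm (f x)"])
    show "AE x in M. (\<lambda>i. norm (f x - s i x)) \<longlonglongrightarrow> 0"
      using lim by eventually_elim (auto intro!: tendsto_eq_intros)
  qed (use int meas bd in auto)
  have nn: "(\<lambda>i. \<integral>\<^sup>+x. ennreal (norm (f x - s i x)) \<partial>M) \<longlonglongrightarrow> 0"
    using tendsto_ennrealI[OF L1] by (simp add: nn_integral_eq_integral[OF intd])
  have inner_s: "?I (s i) \<bullet> y = (\<integral>x. s i x \<bullet> y \<partial>M)"
    and int_s: "integrable M (\<lambda>x. s i x \<bullet> y)" for i y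
  proof -
    have 1: "Bochner_Integration.simple_bochner_integrable M (\<lambda>x. s i x \<bullet> y)"
      by (rule simple_bochner_integrable.intros) (auto intro: simple_function_compose1[OF s] simp: emeasure_eq_measure)
    have "Bochner_Integration.simple_bochner_integral M (\<lambda>x. s i x \<bullet> y)
        = ?I (s i) \<bullet> y"
      by (rule simple_bochner_integral_linear[OF _ sbi]) (auto intro!: linearI simp: inner_simps)
    then show "?I (s i) \<bullet> y = (\<integral>x. s i x \<bullet> y \<partial>M)"
      using has_bochner_integral_integral_eq[OF has_bochner_integral_simple_bochner_integrable[OF 1]] by simp
    show "integrable M (\<lambda>x. s i x \<bullet> y)"
      using has_bochner_integral_simple_bochner_integrable[OF 1] by (rule integrable.intros)
  qed
  have "norm (?I (s i) - v) \<le> (\<integral>x. norm (f x - s i x) \<partial>M)" for i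
  proof (rule norm_le_if_inner_le)
    fix y
    have "(?I (s i) - v) \<bullet> y = (\<integral>x. s i x \<bullet> y - f x \<bullet> y \<partial>M)"
      using int_s int_inner by (simp add: inner_diff_left inner_s v)
    also have "\<dots> \<le> (\<integral>x. norm (f x - s i x) * norm y \<partial>M)"
    proof (rule integral_mono)
      show "s i x \<bullet> y - f x \<bullet> y \<le> norm (f x - s i x) * norm y" for x
        using norm_cauchy_schwarz[of "s i x - f x" y] by (simp add: inner_diff_left norm_minus_commute)
    qed (use int_s int_inner intd in auto)
    finally show "(?I (s i) - v) \<bullet> y
      \<le> (\<integral>x. norm (f x - s i x) \<partial>M) * norm y" by simp
  qed simp
  then have "(\<lambda>i. ?I (s i) - v) \<longlonglongrightarrow> 0"
    by (rule Lim_null_comparison[OF always_eventually, OF allI]) (use L1 in simp)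
  then have "(\<lambda>i. ?I (s i)) \<longlonglongrightarrow> v"
    by (rule LIM_zero_cancel)
  with sbi nn f have "has_strong_integral M f v" unfolding has_strong_integral_def by blast
  then show ?thesis using v by blast
qed

section \<open>Square integrable functions\<close>

lemma square_integrable_bounded:
  assumes "strongly_measurable M f" "\<And>x. x \<in> space M \<Longrightarrow> norm (f x) \<le> C"
  shows "square_integrable M f"
proof -
  have "integrable M (\<lambda>x. (norm (f x))\<^sup>2)"
  proof (rule integrable_const_bound[where B="C\<^sup>2"])
    show "AE x in M. norm ((norm (f x))\<^sup>2) \<le> C\<^sup>2"
      using assms(2) by (intro AE_I2) (simp add: power_mono)
    show "(\<lambda>x. (norm (f x))\<^sup>2) \<in> borel_measurable M"
      using borel_measurable_norm_strong[OF assms(1)] by measurable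
  qed
  with assms show ?thesis by (simp add: square_integrable_def)
qed

lemma square_integrable_cong_AE:
  assumes f: "square_integrable M f" and eq: "AE x in M. f x = g x"
  shows "square_integrable M g"
proof -
  have g: "strongly_measurable M g"
    using f eq strongly_measurable_cong_AE unfolding square_integrable_def by blast
  have "integrable M (\<lambda>x. (norm (g x))\<^sup>2)"
  proof (rule integrable_cong_AE_imp)
    show "integrable M (\<lambda>x. (norm (f x))\<^sup>2)" using f by (simp add: square_integrable_def)
    show "(\<lambda>x. (norm (g x))\<^sup>2) \<in> borel_measurable M"
      using borel_measurable_norm_strong[OF g] by measurable
    show "AE x in M. (norm (f x))\<^sup>2 = (norm (g x))\<^sup>2" using eq by eventually_elim simp
  qed
  with g show ?thesis by (simp add: square_integrable_def)
qed

lemma square_integrable_norm: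
  assumes "square_integrable M f"
  shows "integrable M (\<lambda>x. norm (f x))"
proof (rule Bochner_Integration.integrable_bound)
  show "integrable M (\<lambda>x. 1 + (norm (f x))\<^sup>2)" using assms by (simp add: square_integrable_def)
  have "r \<le> 1 + r\<^sup>2" for r :: real
    using zero_le_power2[of "r - 1/2"] by (simp add: power2_eq_square algebra_simps)
  then show "AE x in M. norm (norm (f x)) \<le> norm (1 + (norm (f x))\<^sup>2)" by simp
  show "(\<lambda>x. norm (f x)) \<in> borel_measurable M"
    using assms by (intro borel_measurable_norm_strong) (simp add: square_integrable_def)
qed

lemma square_integrable_axpy:
  assumes f: "square_integrable M f" and g: "square_integrable M g"
  shows "square_integrable M (\<lambda>x. f x + c *\<^sub>R g x)"
proof -
  have sm: "strongly_measurable M (\<lambda>x. f x + c *\<^sub>R g x)"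
    using f g unfolding square_integrable_def
    by (intro strongly_measurable_compose2[of M f g "\<lambda>a b. a + c *\<^sub>R b"]) (auto intro!: tendsto_intros)
  have "integrable M (\<lambda>x. (norm (f x + c *\<^sub>R g x))\<^sup>2)"
  proof (rule Bochner_Integration.integrable_bound)
    show "integrable M (\<lambda>x. 2 * (norm (f x))\<^sup>2 + 2 * c\<^sup>2 * (norm (g x))\<^sup>2)"
      using f g by (simp add: square_integrable_def)
    have "(norm (a + c *\<^sub>R b))\<^sup>2 \<le> 2 * (norm a)\<^sup>2 + 2 * c\<^sup>2 * (norm b)\<^sup>2" for a b :: 'b
    proof -
      have "(norm (a + c *\<^sub>R b))\<^sup>2 \<le> (norm a + \<bar>c\<bar> * norm b)\<^sup>2"
        using norm_triangle_ineq[of a "c *\<^sub>R b"] by (intro power_mono) auto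
      also have "\<dots> \<le> 2 * (norm a)\<^sup>2 + 2 * (\<bar>c\<bar> * norm b)\<^sup>2"
        using sum_squares_bound[of "norm a" "\<bar>c\<bar> * norm b"] by (simp add: power2_sum)
      finally show ?thesis by (simp add: power_mult_distrib)
    qed
    then show "AE x in M. norm ((norm (f x + c *\<^sub>R g x))\<^sup>2) \<le> norm (2 * (norm (f x))\<^sup>2 + 2 * c\<^sup>2 * (norm (g x))\<^sup>2)"
      by simp
    show "(\<lambda>x. (norm (f x + c *\<^sub>R g x))\<^sup>2) \<in> borel_measurable M"
      using borel_measurable_norm_strong[OF sm] by measurable
  qed
  with sm show ?thesis by (simp add: square_integrable_def)
qed

lemma square_integrable_diff:
  assumes "square_integrable M f" "square_integrable M g"
  shows "square_integrable M (\<lambda>x. f x - g x)"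
  using square_integrable_axpy[OF assms, of "-1"] by simp

lemma square_integrable_compose_bounded:
  assumes f: "square_integrable M f" and h: "bounded_linear h"
  shows "square_integrable M (\<lambda>x. h (f x))"
proof -
  interpret bounded_linear h by fact
  have sm: "strongly_measurable M (\<lambda>x. h (f x))"
  proof (rule strongly_measurable_compose[where f=f and h=h])
    show "strongly_measurable M f" using f by (simp add: square_integrable_def)
  qed (rule tendsto)
  have "integrable M (\<lambda>x. (norm (h (f x)))\<^sup>2)"
  proof (rule Bochner_Integration.integrable_bound)
    show "integrable M (\<lambda>x. (onorm h)\<^sup>2 * (norm (f x))\<^sup>2)" using f by (simp add: square_integrable_def)
    show "AE x in M. norm ((norm (h (f x)))\<^sup>2) \<le> norm ((onorm h)\<^sup>2 * (norm (f x))\<^sup>2)"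
      using power_mono[OF onorm[OF h], of _ 2] by (simp add: power_mult_distrib)
    show "(\<lambda>x. (norm (h (f x)))\<^sup>2) \<in> borel_measurable M"
      using borel_measurable_norm_strong[OF sm] by measurable
  qed
  with sm show ?thesis by (simp add: square_integrable_def)
qed

lemma integrable_inner_square:
  assumes f: "square_integrable M f" and g: "square_integrable M g"
  shows "integrable M (\<lambda>x. f x \<bullet> g x)"
proof (rule Bochner_Integration.integrable_bound)
  show "integrable M (\<lambda>x. (norm (f x))\<^sup>2 + (norm (g x))\<^sup>2)"
    using f g by (simp add: square_integrable_def)
  have "\<bar>a \<bullet> b\<bar> \<le> (norm a)\<^sup>2 + (norm b)\<^sup>2" for a b :: 'b
  proof -
    have "\<bar>a \<bullet> b\<bar> \<le> norm a * norm b" by (rule Cauchy_Schwarz_ineq2)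
    also have "\<dots> \<le> 2 * norm a * norm b" by simp
    also have "\<dots> \<le> (norm a)\<^sup>2 + (norm b)\<^sup>2" by (rule sum_squares_bound)
    finally show ?thesis .
  qed
  then show "AE x in M. norm (f x \<bullet> g x) \<le> norm ((norm (f x))\<^sup>2 + (norm (g x))\<^sup>2)" by simp
  show "(\<lambda>x. f x \<bullet> g x) \<in> borel_measurable M"
    using f g by (intro borel_measurable_inner_strong) (auto simp: square_integrable_def)
qed

end

text \<open>A telescoping estimate that needs no linear structure.\<close>

lemma Cauchy_if_summable_increments:
  fixes X :: "nat \<Rightarrow> 'a::metric_space"
  assumes "summable (\<lambda>n. dist (X n) (X (Suc n)))"
  shows "Cauchy X"
proof (rule metric_CauchyI)
  fix e :: real assume "e > 0"
  from summable_partial_sum_bound[OF assms this] obtain N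
    where N: "\<And>m n. N \<le> m \<Longrightarrow> norm (\<Sum>k=m..n. dist (X k) (X (Suc k))) < e" by blast
  have le: "dist (X m) (X (Suc (m + k))) \<le> (\<Sum>k=m..m + k. dist (X k) (X (Suc k)))" for m k
  proof (induction k)
    case (Suc k)
    then show ?case
      using dist_triangle[of "X m" "X (Suc (m + Suc k))" "X (Suc (m + k))"] by simp
  qed simp
  have lt: "dist (X m) (X n) < e" if m: "N \<le> m" and n: "m < n" for m n
  proof -
    obtain k where "n = Suc (m + k)" using n less_iff_Suc_add by auto
    then show ?thesis using le[of m k] N[OF m, of "m + k"] by (simp add: sum_nonneg)
  qed
  show "\<exists>M. \<forall>m\<ge>M. \<forall>n\<ge>M. dist (X m) (X n) < e"
  proof (intro exI allI impI)
    fix m n assume "N \<le> m" "N \<le> n"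
    then show "dist (X m) (X n) < e"
      using lt[of m n] lt[of n m] \<open>e > 0\<close> by (cases m n rule: linorder_cases) (auto simp: dist_commute)
  qed
qed

context complete_finite_measure
begin

lemma simple_approximation_square:
  assumes f: "square_integrable M f" and e: "e > 0"
  shows "\<exists>s. simple_function M s \<and> square_integrable M s \<and> (\<integral>x. (norm (s x - f x))\<^sup>2 \<partial>M) \<le> e"
proof -
  have sm: "strongly_measurable M f" and int: "integrable M (\<lambda>x. (norm (f x))\<^sup>2)"
    using f by (auto simp: square_integrable_def)
  obtain s where s: "\<And>i. simple_function M (s i)" and lim: "AE x in M. (\<lambda>i. s i x) \<longlonglongrightarrow> f x"
    and dom: "\<And>i x. norm (s i x) \<le> 2 * norm (f x)"
    using dominated_simple_approximation[OF sm] by blast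
  have "integrable M (\<lambda>x. (norm (s i x))\<^sup>2)" for i
  proof (rule Bochner_Integration.integrable_bound)
    show "integrable M (\<lambda>x. 4 * (norm (f x))\<^sup>2)" using int by simp
    show "(\<lambda>x. (norm (s i x))\<^sup>2) \<in> borel_measurable M"
      using borel_measurable_norm_strong[OF strongly_measurable_simple[OF s]] by measurable
    have "(norm (s i x))\<^sup>2 \<le> (2 * norm (f x))\<^sup>2" for x by (intro power_mono dom) simp
    then show "AE x in M. norm ((norm (s i x))\<^sup>2) \<le> norm (4 * (norm (f x))\<^sup>2)"
      by (simp add: power_mult_distrib)
  qed
  then have sq: "square_integrable M (s i)" for i
    using s by (simp add: square_integrable_def strongly_measurable_simple)
  have "(\<lambda>i. \<integral>x. (norm (s i x - f x))\<^sup>2 \<partial>M) \<longlonglongrightarrow> (\<integral>x. 0 \<partial>M)"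
  proof (rule integral_dominated_convergence[where w="\<lambda>x. 9 * (norm (f x))\<^sup>2"])
    show "AE x in M. (\<lambda>i. (norm (s i x - f x))\<^sup>2) \<longlonglongrightarrow> 0"
      using lim by eventually_elim (auto intro!: tendsto_eq_intros)
    show "(\<lambda>x. (norm (s i x - f x))\<^sup>2) \<in> borel_measurable M" for i
      using borel_measurable_norm_diff[OF strongly_measurable_simple[OF s] sm] by measurable
    have "norm (s i x - f x) \<le> 3 * norm (f x)" for i x
      using norm_triangle_ineq4[of "s i x" "f x"] dom[of i x] by simp
    then have "(norm (s i x - f x))\<^sup>2 \<le> (3 * norm (f x))\<^sup>2" for i x by (intro power_mono) auto
    then show "AE x in M. norm ((norm (s i x - f x))\<^sup>2) \<le> 9 * (norm (f x))\<^sup>2" for i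
      by (simp add: power_mult_distrib)
  qed (use int in auto)
  then have "\<forall>\<^sub>F i in sequentially. (\<integral>x. (norm (s i x - f x))\<^sup>2 \<partial>M) < e"
    using e by (intro order_tendstoD) auto
  then obtain i where "(\<integral>x. (norm (s i x - f x))\<^sup>2 \<partial>M) < e" by (auto simp: eventually_sequentially)
  then show ?thesis using s sq by (intro exI[of _ "s i"]) auto
qed

lemma square_distance_triangle:
  fixes f g h :: "'a \<Rightarrow> 'b::real_normed_vector"
  assumes f: "square_integrable M f" and g: "square_integrable M g" and h: "square_integrable M h"
  shows "(\<integral>x. (norm (f x - h x))\<^sup>2 \<partial>M) \<le> 2 * (\<integral>x. (norm (f x - g x))\<^sup>2 \<partial>M) + 2 * (\<integral>x. (norm (g x - h x))\<^sup>2 \<partial>M)"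
proof -
  have i: "integrable M (\<lambda>x. (norm (f x - h x))\<^sup>2)" "integrable M (\<lambda>x. (norm (f x - g x))\<^sup>2)"
    "integrable M (\<lambda>x. (norm (g x - h x))\<^sup>2)"
    using square_integrable_diff[OF f h] square_integrable_diff[OF f g] square_integrable_diff[OF g h]
    by (auto simp: square_integrable_def)
  have "(norm (a - c))\<^sup>2 \<le> 2 * (norm (a - b))\<^sup>2 + 2 * (norm (b - c))\<^sup>2" for a b c :: 'b
  proof -
    have "(norm (a - c))\<^sup>2 \<le> (norm (a - b) + norm (b - c))\<^sup>2"
      using norm_triangle_ineq[of "a - b" "b - c"] by (intro power_mono) auto
    also have "\<dots> \<le> 2 * (norm (a - b))\<^sup>2 + 2 * (norm (b - c))\<^sup>2"
      using sum_squares_bound[of "norm (a - b)" "norm (b - c)"] by (simp add: power2_sum)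
    finally show ?thesis .
  qed
  then have "(\<integral>x. (norm (f x - h x))\<^sup>2 \<partial>M) \<le> (\<integral>x. 2 * (norm (f x - g x))\<^sup>2 + 2 * (norm (g x - h x))\<^sup>2 \<partial>M)"
    using i by (intro integral_mono) auto
  then show ?thesis using i by simp
qed

text \<open>Each \<open>X n\<close> is approximated by a simple function \<open>s n\<close> up to \<open>(1/4)^n\<close>, so that a pointwise limit of
the \<open>s n\<close> is strongly measurable by definition. The weights \<open>2^n\<close> in \<open>D\<close> make
\<open>\<Sum>n. D n\<close> integrable, hence finite almost everywhere, and then the increments of \<open>s n x\<close>
are summable because their norms \<open>a\<close> satisfy \<open>a \<le> (1/2)^n + 2^n * a\<^sup>2\<close>. Fatou's lemma turns the
bounds between \<open>s n\<close> and \<open>X m\<close> into bounds between the limit and \<open>X m\<close>.\<close>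

theorem square_integrable_complete:
  fixes X :: "nat \<Rightarrow> 'a \<Rightarrow> 'b::{real_normed_vector, complete_space}"
  assumes X: "\<And>n. square_integrable M (X n)"
    and Cauchy: "\<And>m n. m \<le> n \<Longrightarrow> (\<integral>x. (norm (X n x - X m x))\<^sup>2 \<partial>M) \<le> (1/4)^m"
  shows "\<exists>l. square_integrable M l \<and> (\<lambda>n. \<integral>x. (norm (X n x - l x))\<^sup>2 \<partial>M) \<longlonglongrightarrow> 0"
proof -
  have "\<exists>s. simple_function M s \<and> square_integrable M s \<and> (\<integral>x. (norm (s x - X n x))\<^sup>2 \<partial>M) \<le> (1/4)^n" for n
    by (intro simple_approximation_square X) simp
  then obtain s where s: "\<And>n. simple_function M (s n)" and sq: "\<And>n. square_integrable M (s n)"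
    and sX: "\<And>n. (\<integral>x. (norm (s n x - X n x))\<^sup>2 \<partial>M) \<le> (1/4)^n"
    by metis
  have sXm: "(\<integral>x. (norm (s n x - X m x))\<^sup>2 \<partial>M) \<le> 4 * (1/4)^m" if "m \<le> n" for m n
  proof -
    have "(1/4::real)^n \<le> (1/4)^m" using that by (intro power_decreasing) auto
    then show ?thesis
      using square_distance_triangle[OF sq[of n] X[of n] X[of m]] sX[of n] Cauchy[OF that] by linarith
  qed
  have inc: "(\<integral>x. (norm (s n x - s (Suc n) x))\<^sup>2 \<partial>M) \<le> 16 * (1/4)^n" for n
  proof -
    have "(\<integral>x. (norm (X n x - s (Suc n) x))\<^sup>2 \<partial>M) = (\<integral>x. (norm (s (Suc n) x - X n x))\<^sup>2 \<partial>M)"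
      by (simp only: norm_minus_commute)
    then show ?thesis
      using square_distance_triangle[OF sq[of n] X[of n] sq[of "Suc n"]] sX[of n] sXm[of n "Suc n"]
        zero_le_power[of "1/4::real" n] by linarith
  qed
  define D where "D = (\<lambda>n x. 2^n * (norm (s n x - s (Suc n) x))\<^sup>2)"
  have D: "integrable M (D n)" for n
    using square_integrable_diff[OF sq[of n] sq[of "Suc n"]] by (simp add: D_def square_integrable_def)
  have D_nonneg: "0 \<le> D n x" for n x by (simp add: D_def)
  have Dint: "integral\<^sup>L M (D n) \<le> 16 * (1/2)^n" for n
  proof -
    have "integral\<^sup>L M (D n) = 2^n * (\<integral>x. (norm (s n x - s (Suc n) x))\<^sup>2 \<partial>M)" by (simp add: D_def)
    also have "\<dots> \<le> 2^n * (16 * (1/4)^n)" by (intro mult_left_mono inc) auto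
    also have "\<dots> = 16 * (2 * (1/4))^n" by (simp only: power_mult_distrib mult_ac)
    finally show ?thesis by simp
  qed
  have "(\<integral>\<^sup>+x. (\<Sum>n. ennreal (D n x)) \<partial>M) = (\<Sum>n. \<integral>\<^sup>+x. ennreal (D n x) \<partial>M)"
    using D by (intro nn_integral_suminf) (auto dest: borel_measurable_integrable)
  also have "\<dots> = (\<Sum>n. ennreal (integral\<^sup>L M (D n)))"
    by (simp add: nn_integral_eq_integral[OF D] D_nonneg)
  also have "\<dots> \<le> (\<Sum>n. ennreal (16 * (1/2)^n))"
    by (intro suminf_le ennreal_leI Dint summableI)
  also have "\<dots> = ennreal (\<Sum>n. 16 * (1/2)^n)"
    by (intro suminf_ennreal2 summable_mult summable_geometric) auto
  also have "\<dots> < \<infinity>" by simp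
  finally have "AE x in M. (\<Sum>n. ennreal (D n x)) \<noteq> \<infinity>"
    using D by (intro nn_integral_PInf_AE) (auto dest: borel_measurable_integrable)
  then have "AE x in M. \<exists>a. (\<lambda>n. s n x) \<longlonglongrightarrow> a"
  proof eventually_elim
    case (elim x)
    then have sumD: "summable (\<lambda>n. D n x)" using D_nonneg by (intro summable_suminf_not_top) auto
    have le: "dist (s n x) (s (Suc n) x) \<le> (1/2)^n + D n x" for n
    proof -
      define a where "a = norm (s n x - s (Suc n) x)"
      have "0 \<le> (1 - 2^n * a)\<^sup>2" by simp
      then have "2 * (2^n * a) \<le> 1 + (2^n * a)\<^sup>2" by (simp add: power2_diff)
      also have "\<dots> = 2^n * ((1/2)^n + 2^n * a\<^sup>2)"
        by (simp add: power2_eq_square power_one_over algebra_simps)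
      finally have "2^n * (2 * a) \<le> 2^n * ((1/2)^n + 2^n * a\<^sup>2)" by (simp add: mult_ac)
      then have "2 * a \<le> (1/2)^n + 2^n * a\<^sup>2" by simp
      moreover have "0 \<le> a" by (simp add: a_def)
      ultimately have "a \<le> (1/2)^n + 2^n * a\<^sup>2" by linarith
      then show ?thesis by (simp add: D_def dist_norm a_def)
    qed
    have "summable (\<lambda>n. dist (s n x) (s (Suc n) x))"
    proof (rule summable_comparison_test')
      show "summable (\<lambda>n. (1/2)^n + D n x)" by (intro summable_add sumD summable_geometric) simp
    qed (use le in auto)
    then have "Cauchy (\<lambda>n. s n x)" by (rule Cauchy_if_summable_increments)
    then show ?case using Cauchy_convergent convergent_def by blast
  qed
  then have lim: "AE x in M. (\<lambda>n. s n x) \<longlonglongrightarrow> lim (\<lambda>n. s n x)"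
    by eventually_elim (metis convergent_def convergent_LIMSEQ_iff)
  define l where "l x = lim (\<lambda>n. s n x)" for x
  have sm: "strongly_measurable M l"
    unfolding strongly_measurable_def l_def using s lim by blast
  have bound: "(\<integral>\<^sup>+x. ennreal ((norm (l x - X m x))\<^sup>2) \<partial>M) \<le> ennreal (4 * (1/4)^m)" for m
  proof -
    have meas: "(\<lambda>x. (norm (s n x - X m x))\<^sup>2) \<in> borel_measurable M" for n
      using square_integrable_diff[OF sq[of n] X[of m]] by (auto simp: square_integrable_def)
    have "(\<integral>\<^sup>+x. ennreal ((norm (l x - X m x))\<^sup>2) \<partial>M)
        = (\<integral>\<^sup>+x. liminf (\<lambda>n. ennreal ((norm (s n x - X m x))\<^sup>2)) \<partial>M)"
    proof (rule nn_integral_cong_AE)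
      show "AE x in M. ennreal ((norm (l x - X m x))\<^sup>2) = liminf (\<lambda>n. ennreal ((norm (s n x - X m x))\<^sup>2))"
        using lim
      proof eventually_elim
        case (elim x)
        then have "(\<lambda>n. ennreal ((norm (s n x - X m x))\<^sup>2)) \<longlonglongrightarrow> ennreal ((norm (l x - X m x))\<^sup>2)"
          unfolding l_def by (intro tendsto_intros)
        then show ?case by (intro lim_imp_Liminf[symmetric]) auto
      qed
    qed
    also have "\<dots> \<le> liminf (\<lambda>n. \<integral>\<^sup>+x. ennreal ((norm (s n x - X m x))\<^sup>2) \<partial>M)"
      using meas by (intro nn_integral_liminf) auto
    also have "\<dots> \<le> ennreal (4 * (1/4)^m)"
    proof (rule Liminf_le)
      show "\<forall>\<^sub>F n in sequentially. (\<integral>\<^sup>+x. ennreal ((norm (s n x - X m x))\<^sup>2) \<partial>M) \<le> ennreal (4 * (1/4)^m)"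
      proof (rule eventually_sequentiallyI[of m])
        fix n assume "m \<le> n"
        have "(\<integral>\<^sup>+x. ennreal ((norm (s n x - X m x))\<^sup>2) \<partial>M) = ennreal (\<integral>x. (norm (s n x - X m x))\<^sup>2 \<partial>M)"
          using square_integrable_diff[OF sq[of n] X[of m]]
          by (intro nn_integral_eq_integral) (auto simp: square_integrable_def)
        then show "(\<integral>\<^sup>+x. ennreal ((norm (s n x - X m x))\<^sup>2) \<partial>M) \<le> ennreal (4 * (1/4)^m)"
          using sXm[OF \<open>m \<le> n\<close>] by (simp add: ennreal_leI)
      qed
    qed simp
    finally show ?thesis .
  qed
  have smX: "strongly_measurable M (X m)" for m using X by (simp add: square_integrable_def)
  have meas: "(\<lambda>x. (norm (l x - X m x))\<^sup>2) \<in> borel_measurable M" for m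
    using borel_measurable_norm_diff[OF sm smX[of m]] by measurable
  have int: "integrable M (\<lambda>x. (norm (l x - X m x))\<^sup>2)" for m
    using bound[of m] meas[of m]
    by (intro integrableI_bounded) (auto intro: le_less_trans[OF _ ennreal_less_top])
  have "square_integrable M (\<lambda>x. l x - X 0 x)"
    unfolding square_integrable_def
    by (intro conjI int strongly_measurable_compose2[OF sm smX[of 0]]) (intro tendsto_intros)
  then have l: "square_integrable M l" using square_integrable_axpy[OF _ X[of 0], of "\<lambda>x. l x - X 0 x" 1] by simp
  have "(\<integral>x. (norm (X m x - l x))\<^sup>2 \<partial>M) \<le> 4 * (1/4)^m" for m
    using bound[of m] by (simp add: nn_integral_eq_integral[OF int] norm_minus_commute)
  then have "\<forall>\<^sub>F m in sequentially. norm (\<integral>x. (norm (X m x - l x))\<^sup>2 \<partial>M) \<le> 4 * (1/4)^m"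
    by simp
  moreover have "(\<lambda>m. 4 * (1/4)^m) \<longlonglongrightarrow> (0::real)"
    by (intro tendsto_mult_right_zero LIMSEQ_power_zero) simp
  ultimately have "(\<lambda>n. \<integral>x. (norm (X n x - l x))\<^sup>2 \<partial>M) \<longlonglongrightarrow> 0"
    by (rule Lim_null_comparison)
  then show ?thesis using l by blast
qed

end

lemma complete_finite_measure_interval: "complete_finite_measure (lebesgue_on {a..b::real})"
proof (intro complete_finite_measure.intro complete_measure.intro)
  fix A B :: "real set" assume "B \<subseteq> A" "A \<in> null_sets (lebesgue_on {a..b})"
  then have "A \<subseteq> {a..b}" "A \<in> null_sets lebesgue" by (auto simp: null_sets_restrict_space)
  then have "B \<in> null_sets lebesgue" using \<open>B \<subseteq> A\<close> completion.complete2 by blast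
  then show "B \<in> sets (lebesgue_on {a..b})"
    using \<open>A \<subseteq> {a..b}\<close> \<open>B \<subseteq> A\<close> by (auto simp: sets_restrict_space)
qed (simp add: finite_measure_lebesgue_on)

interpretation time: complete_finite_measure "lebesgue_on {a..b::real}" for a b
  by (rule complete_finite_measure_interval)

text \<open>The Riesz theorem on \<open>G\<close>, applied to the functional \<open>v \<mapsto> \<langle>f, v\<rangle>\<close>.\<close>

lemma L2_projection_exists:
  fixes f :: "real \<Rightarrow> 'u::{real_inner, complete_space}"
  assumes G: "L2_closed_subspace T G" and f: "f \<in> L2 T"
  shows "\<exists>p\<in>G. \<forall>v\<in>G. L2_inner T f v = L2_inner T p v"
proof -
  have GL: "G \<subseteq> L2 T" and G0: "(\<lambda>t. 0) \<in> G"
    and add: "\<And>f g. f \<in> G \<Longrightarrow> g \<in> G \<Longrightarrow> (\<lambda>t. f t + g t) \<in> G"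
    and scale: "\<And>c f. f \<in> G \<Longrightarrow> (\<lambda>t. c *\<^sub>R f t) \<in> G"
    and cl: "\<And>F f. f \<in> L2 T \<Longrightarrow> (\<And>n. F n \<in> G) \<Longrightarrow> (\<lambda>n. L2_norm T (\<lambda>t. F n t - f t)) \<longlonglongrightarrow> 0 \<Longrightarrow> f \<in> G"
    using G unfolding L2_closed_subspace_def by blast+
  have sq: "square_integrable (time_measure T) g" if "g \<in> L2 T" for g :: "real \<Rightarrow> 'u"
    using that by (simp add: L2_eq)
  have ip: "L2_inner T (\<lambda>t. x t + c *\<^sub>R y t) z = L2_inner T x z + c * L2_inner T y z"
    if "x \<in> L2 T" "y \<in> L2 T" "z \<in> L2 T" for x y z :: "real \<Rightarrow> 'u" and c
    using time.integrable_inner_square[OF sq sq] that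
    by (simp add: L2_inner_def inner_simps)
  have comm: "L2_inner T x y = L2_inner T y x" for x y :: "real \<Rightarrow> 'u"
    by (simp add: L2_inner_def inner_commute)
  have nonneg: "0 \<le> L2_inner T x x" for x :: "real \<Rightarrow> 'u"
    by (simp add: L2_inner_def)
  interpret L: prehilbert_set "L2 T :: (real \<Rightarrow> 'u) set" "\<lambda>x c y t. x t + c *\<^sub>R y t" "L2_inner T"
    using G0 GL ip comm nonneg by unfold_locales (auto simp: L2_eq time.square_integrable_axpy)
  interpret prehilbert_set G "\<lambda>x c y t. x t + c *\<^sub>R y t" "L2_inner T"
  proof
    show "G \<noteq> {}" using G0 by blast
    show "(\<lambda>t. x t + c *\<^sub>R y t) \<in> G" if "x \<in> G" "y \<in> G" for x y c
      using add[OF that(1) scale[OF that(2)]] .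
    show "L2_inner T (\<lambda>t. x t + c *\<^sub>R y t) z = L2_inner T x z + c * L2_inner T y z"
      if "x \<in> G" "y \<in> G" "z \<in> G" for x y z c
      using that GL by (intro ip) auto
    show "L2_inner T x y = L2_inner T y x" for x y :: "real \<Rightarrow> 'u" by (rule comm)
    show "0 \<le> L2_inner T x x" for x :: "real \<Rightarrow> 'u" by (rule nonneg)
  qed
  have "\<exists>p\<in>G. \<forall>v\<in>G. L2_inner T f v = L2_inner T p v"
  proof (rule Riesz[where C="sqrt (L2_inner T f f)"])
    fix X :: "nat \<Rightarrow> real \<Rightarrow> 'u"
    assume X: "\<And>n. X n \<in> G" and Cau: "\<And>m n. m \<le> n \<Longrightarrow>
      L2_inner T (\<lambda>t. X n t + -1 *\<^sub>R X m t) (\<lambda>t. X n t + -1 *\<^sub>R X m t) \<le> (1/4)^m"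
    have "\<exists>l. square_integrable (time_measure T) l \<and>
        (\<lambda>n. \<integral>x. (norm (X n x - l x))\<^sup>2 \<partial>time_measure T) \<longlonglongrightarrow> 0"
      using X GL Cau
      by (intro time.square_integrable_complete) (auto simp: L2_inner_def power2_norm_eq_inner intro!: sq)
    then obtain l where l: "l \<in> L2 T"
      and lim: "(\<lambda>n. L2_inner T (\<lambda>t. X n t - l t) (\<lambda>t. X n t - l t)) \<longlonglongrightarrow> 0"
      unfolding L2_eq L2_inner_def power2_norm_eq_inner by blast
    have "l \<in> G"
      using tendsto_real_sqrt[OF lim] by (intro cl[OF l X]) (simp add: L2_norm_def)
    then show "\<exists>l\<in>G. (\<lambda>n. L2_inner T (\<lambda>t. X n t + -1 *\<^sub>R l t) (\<lambda>t. X n t + -1 *\<^sub>R l t)) \<longlonglongrightarrow> 0"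
      using lim by auto
  next
    show "L2_inner T f (\<lambda>t. x t + c *\<^sub>R y t) = L2_inner T f x + c * L2_inner T f y" if "x \<in> G" "y \<in> G" for x y c
      using L.ip_axpy_right f GL that by blast
    show "\<bar>L2_inner T f x\<bar> \<le> sqrt (L2_inner T f f) * sqrt (L2_inner T x x)" if "x \<in> G" for x
      using L.Cauchy_Schwarz f GL that by blast
  qed
  then show ?thesis .
qed

lemma AE_zero_if_L2_inner_zero:
  fixes f :: "real \<Rightarrow> 'u::real_inner"
  assumes "f \<in> L2 T" "L2_inner T f f = 0"
  shows "AE t in time_measure T. f t = 0"
proof -
  have "integrable (time_measure T) (\<lambda>t. f t \<bullet> f t)"
    using assms(1) by (intro time.integrable_inner_square) (auto simp: L2_eq)
  then have "AE t in time_measure T. f t \<bullet> f t = 0"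
    using assms(2) unfolding L2_inner_def by (subst (asm) integral_nonneg_eq_0_iff_AE) auto
  then show ?thesis by simp
qed

section \<open>Functions of time: subintervals, reflection and discretization\<close>

lemma strongly_measurable_comp:
  assumes f: "strongly_measurable N f" and g: "g \<in> measurable M N"
    and AE: "\<And>P. (AE x in N. P x) \<Longrightarrow> AE x in M. P (g x)"
  shows "strongly_measurable M (\<lambda>x. f (g x))"
proof -
  obtain s where s: "\<And>i. simple_function N (s i)" "AE x in N. (\<lambda>i. s i x) \<longlonglongrightarrow> f x"
    using f unfolding strongly_measurable_def by blast
  then have "\<And>i. simple_function M (\<lambda>x. s i (g x))" "AE x in M. (\<lambda>i. s i (g x)) \<longlonglongrightarrow> f (g x)"
    using simple_function_comp[OF g] AE by auto
  then show ?thesis unfolding strongly_measurable_def by (intro exI[of _ "\<lambda>i x. s i (g x)"]) simp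
qed

lemma AE_subinterval:
  assumes "AE x in lebesgue_on {a..b::real}. P x" "{c..d} \<subseteq> {a..b}"
  shows "AE x in lebesgue_on {c..d}. P x"
proof -
  have "AE x in lebesgue. x \<in> {a..b} \<longrightarrow> P x"
    using assms(1) by (subst (asm) AE_restrict_space_iff) auto
  then have "AE x in lebesgue. x \<in> {c..d} \<longrightarrow> P x"
    by eventually_elim (use assms(2) in auto)
  then show ?thesis by (subst AE_restrict_space_iff) auto
qed

lemma strongly_measurable_subinterval:
  assumes f: "strongly_measurable (lebesgue_on {a..b::real}) f" and sub: "{c..d} \<subseteq> {a..b}"
  shows "strongly_measurable (lebesgue_on {c..d}) f"
proof -
  have "(\<lambda>x. x) \<in> lebesgue_on {c..d} \<rightarrow>\<^sub>M lebesgue_on {a..b}"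
    by (rule measurable_restrict_space3) (use sub in auto)
  from strongly_measurable_comp[OF f this AE_subinterval[OF _ sub]] show ?thesis by simp
qed

lemma borel_measurable_lebesgue_on: "f \<in> borel_measurable borel \<Longrightarrow> f \<in> borel_measurable (lebesgue_on S)"
  by (intro measurable_restrict_space1 measurable_completion) simp

lemma reflect_measurable: "(\<lambda>t. T - t) \<in> lebesgue_on {0..T::real} \<rightarrow>\<^sub>M lebesgue_on {0..T}"
proof (rule measurable_restrict_space3)
  show "(\<lambda>t. T - t) \<in> lebesgue \<rightarrow>\<^sub>M lebesgue"
    using lebesgue_affine_measurable[of "\<lambda>_. -1" T] by simp
qed auto

lemma distr_reflect: "distr (lebesgue_on {0..T::real}) (lebesgue_on {0..T}) (\<lambda>t. T - t) = lebesgue_on {0..T}"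
proof (rule measure_eqI)
  fix A assume "A \<in> sets (distr (lebesgue_on {0..T}) (lebesgue_on {0..T}) (\<lambda>t. T - t))"
  then have A: "A \<in> sets (lebesgue_on {0..T})" by simp
  then have A': "A \<subseteq> {0..T}" "A \<in> sets lebesgue" by (auto simp: sets_restrict_space)
  have "(\<lambda>t. T - t) -` A \<inter> {0..T} = (\<lambda>t. T - t) ` A"
    using A'(1) by (auto simp: image_iff intro!: bexI[of _ "T - _"])
  moreover have "(\<lambda>t. T - t) ` A \<subseteq> {0..T}" using A'(1) by auto
  moreover have "emeasure lebesgue ((\<lambda>t. T - t) ` A) = emeasure lebesgue A"
    using emeasure_lebesgue_affine[of "-1" T A] by simp
  ultimately show "emeasure (distr (lebesgue_on {0..T}) (lebesgue_on {0..T}) (\<lambda>t. T - t)) A = emeasure (lebesgue_on {0..T}) A"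
    using A A' by (simp add: emeasure_distr[OF reflect_measurable A] emeasure_restrict_space)
qed simp

lemma AE_reflect:
  assumes "AE t in lebesgue_on {0..T::real}. P t"
  shows "AE t in lebesgue_on {0..T}. P (T - t)"
  by (rule AE_distrD[OF reflect_measurable]) (unfold distr_reflect, rule assms)

lemma strongly_measurable_reflect:
  assumes "strongly_measurable (lebesgue_on {0..T::real}) f"
  shows "strongly_measurable (lebesgue_on {0..T}) (\<lambda>t. f (T - t))"
  by (rule strongly_measurable_comp[OF assms reflect_measurable]) (rule AE_reflect)

lemma integral_reflect_time:
  fixes f :: "real \<Rightarrow> real"
  assumes "f \<in> borel_measurable (lebesgue_on {0..T})"
  shows "(\<integral>t. f (T - t) \<partial>lebesgue_on {0..T}) = (\<integral>t. f t \<partial>lebesgue_on {0..T})"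
  using integral_distr[OF reflect_measurable assms] by (simp add: distr_reflect)

lemma square_integrable_reflect:
  assumes "square_integrable (lebesgue_on {0..T::real}) f"
  shows "square_integrable (lebesgue_on {0..T}) (\<lambda>t. f (T - t))"
proof -
  have "integrable (distr (lebesgue_on {0..T}) (lebesgue_on {0..T}) (\<lambda>t. T - t)) (\<lambda>x. (norm (f x))\<^sup>2)"
    using assms by (simp add: distr_reflect square_integrable_def)
  from integrable_distr[OF reflect_measurable this] show ?thesis
    using assms strongly_measurable_reflect[of T f] by (simp add: square_integrable_def)
qed

text \<open>Rounding up to a multiple of \<open>1 / (i + 1)\<close>, cut off at \<open>T\<close>. Trajectories are shown to be
continuous from the right, so the discretized times must approach \<open>r\<close> from above.\<close>

definition round_up :: "real \<Rightarrow> nat \<Rightarrow> real \<Rightarrow> real" where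
  "round_up T i r = min T ((real_of_int \<lfloor>r * real (Suc i)\<rfloor> + 1) / real (Suc i))"

lemma round_up_bounds: "r \<le> T \<Longrightarrow> round_up T i r \<in> {r..T}"
proof -
  assume "r \<le> T"
  have "r * real (Suc i) \<le> real_of_int \<lfloor>r * real (Suc i)\<rfloor> + 1" by linarith
  then have "r \<le> (real_of_int \<lfloor>r * real (Suc i)\<rfloor> + 1) / real (Suc i)" by (simp add: field_simps)
  with \<open>r \<le> T\<close> show ?thesis by (simp add: round_up_def)
qed

lemma round_up_tendsto:
  assumes "r \<le> T"
  shows "(\<lambda>i. round_up T i r) \<longlonglongrightarrow> r"
proof (rule tendsto_sandwich)
  show "\<forall>\<^sub>F i in sequentially. r \<le> round_up T i r" using round_up_bounds[OF assms] by simp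
  have "round_up T i r \<le> r + 1 / real (Suc i)" for i
  proof -
    have "real_of_int \<lfloor>r * real (Suc i)\<rfloor> + 1 \<le> r * real (Suc i) + 1" by linarith
    then have "(real_of_int \<lfloor>r * real (Suc i)\<rfloor> + 1) / real (Suc i) \<le> (r * real (Suc i) + 1) / real (Suc i)"
      by (intro divide_right_mono) auto
    also have "\<dots> = r + 1 / real (Suc i)" by (simp add: field_simps)
    finally show ?thesis by (simp add: round_up_def)
  qed
  then show "\<forall>\<^sub>F i in sequentially. round_up T i r \<le> r + 1 / real (Suc i)" by simp
  have "(\<lambda>i. r + 1 / real (Suc i)) \<longlonglongrightarrow> r + 0"
    by (intro tendsto_add tendsto_const LIMSEQ_Suc[OF lim_1_over_n])
  then show "(\<lambda>i. r + 1 / real (Suc i)) \<longlonglongrightarrow> r" by simp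
qed simp

lemma simple_function_round_up:
  assumes g: "g \<in> borel_measurable M" and range: "\<And>x. x \<in> space M \<Longrightarrow> g x \<in> {0..T}"
  shows "simple_function M (\<lambda>x. round_up T i (g x))"
proof (rule simple_function_borel_measurable)
  show "(\<lambda>x. round_up T i (g x)) \<in> borel_measurable M" unfolding round_up_def using g by measurable
  have "(\<lambda>x. \<lfloor>g x * real (Suc i)\<rfloor>) ` space M \<subseteq> {0..\<lfloor>T * real (Suc i)\<rfloor>}"
  proof (rule image_subsetI)
    fix x assume "x \<in> space M"
    then have "0 \<le> g x" "g x \<le> T" using range by auto
    then have "0 \<le> g x * real (Suc i)" "g x * real (Suc i) \<le> T * real (Suc i)"
      by (auto intro: mult_right_mono)
    then show "\<lfloor>g x * real (Suc i)\<rfloor> \<in> {0..\<lfloor>T * real (Suc i)\<rfloor>}" by (simp add: floor_mono)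
  qed
  then have "finite ((\<lambda>x. \<lfloor>g x * real (Suc i)\<rfloor>) ` space M)" by (rule finite_subset) simp
  then have "finite ((\<lambda>k. min T ((real_of_int k + 1) / real (Suc i))) ` (\<lambda>x. \<lfloor>g x * real (Suc i)\<rfloor>) ` space M)"
    by (rule finite_imageI)
  then show "finite ((\<lambda>x. round_up T i (g x)) ` space M)" by (simp add: round_up_def image_image)
qed

lemma strongly_measurable_right_continuous:
  fixes f :: "real \<Rightarrow> 'b::real_normed_vector"
  assumes "\<And>t X. t \<in> {0..T} \<Longrightarrow> (\<And>n. X n \<in> {t..T}) \<Longrightarrow> X \<longlonglongrightarrow> t \<Longrightarrow> (\<lambda>n. f (X n)) \<longlonglongrightarrow> f t"
  shows "strongly_measurable (lebesgue_on {0..T}) f"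
  unfolding strongly_measurable_def
proof (intro exI conjI allI AE_I2)
  show "simple_function (lebesgue_on {0..T}) (\<lambda>t. f (round_up T i t))" for i
    by (rule simple_function_compose1[OF simple_function_round_up]) (auto intro: borel_measurable_lebesgue_on)
  fix t assume "t \<in> space (lebesgue_on {0..T})"
  then show "(\<lambda>i. f (round_up T i t)) \<longlonglongrightarrow> f t"
    using round_up_bounds[of t T] by (intro assms round_up_tendsto) auto
qed

lemma L2_D: "f \<in> L2 T \<Longrightarrow> square_integrable (time_measure T) f"
  by (simp add: L2_eq)

lemma L2_axpy: "f \<in> L2 T \<Longrightarrow> g \<in> L2 T \<Longrightarrow> (\<lambda>t. f t + c *\<^sub>R g t) \<in> L2 T"
  by (simp add: L2_eq time.square_integrable_axpy)

lemma L2_integrable_inner: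
  "f \<in> L2 T \<Longrightarrow> g \<in> L2 T \<Longrightarrow> integrable (time_measure T) (\<lambda>t. f t \<bullet> g t)"
  by (intro time.integrable_inner_square L2_D)

lemma L2_inner_commute: "L2_inner T f g = L2_inner T g f"
  by (simp add: L2_inner_def inner_commute)

lemma L2_inner_axpy:
  assumes "f \<in> L2 T" "g \<in> L2 T" "h \<in> L2 T"
  shows "L2_inner T (\<lambda>t. f t + c *\<^sub>R g t) h = L2_inner T f h + c * L2_inner T g h"
  using assms by (simp add: L2_inner_def inner_simps L2_integrable_inner)

lemma L2_inner_diff:
  assumes "f \<in> L2 T" "g \<in> L2 T" "h \<in> L2 T"
  shows "L2_inner T (\<lambda>t. f t - g t) h = L2_inner T f h - L2_inner T g h"
  using L2_inner_axpy[OF assms, of "-1"] by simp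

lemma L2_inner_sum_right:
  assumes "f \<in> L2 T" "Bs \<subseteq> L2 T"
  shows "L2_inner T f (\<lambda>t. \<Sum>b\<in>Bs. c b *\<^sub>R b t) = (\<Sum>b\<in>Bs. c b * L2_inner T f b)"
proof -
  have "integrable (time_measure T) (\<lambda>t. c b * (f t \<bullet> b t))" if "b \<in> Bs" for b
    using that assms by (intro integrable_mult_right L2_integrable_inner) auto
  then show ?thesis by (simp add: L2_inner_def inner_sum_right)
qed

lemma L2_inner_cong_AE_right:
  assumes "f \<in> L2 T" "g \<in> L2 T" "AE t in time_measure T. g t = h t"
  shows "L2_inner T f h = L2_inner T f g"
  unfolding L2_inner_def
proof (rule time.integral_cong_AE_complete)
  show "(\<lambda>t. f t \<bullet> g t) \<in> borel_measurable (time_measure T)"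
    using L2_integrable_inner[OF assms(1,2)] by (rule borel_measurable_integrable)
  show "AE t in time_measure T. f t \<bullet> g t = f t \<bullet> h t" using assms(3) by eventually_elim simp
qed

lemma L2_closed_subspace_sum:
  assumes W: "L2_closed_subspace T W" and "finite Bs" "Bs \<subseteq> W"
  shows "(\<lambda>t. \<Sum>b\<in>Bs. c b *\<^sub>R b t) \<in> W"
  using assms(2,3)
proof (induction rule: finite_induct)
  case empty
  then show ?case using W by (simp add: L2_closed_subspace_def)
next
  case (insert b F)
  have add: "(\<lambda>t. f t + g t) \<in> W" if "f \<in> W" "g \<in> W" for f g
    using W that by (simp add: L2_closed_subspace_def)
  have "(\<lambda>t. c b *\<^sub>R b t) \<in> W" "(\<lambda>t. \<Sum>b\<in>F. c b *\<^sub>R b t) \<in> W"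
    using W insert by (auto simp: L2_closed_subspace_def)
  from add[OF this] show ?case using insert.hyps by simp
qed

section \<open>Duhamel's formula\<close>

context
  fixes S :: "real \<Rightarrow> 'h::{real_inner, complete_space} \<Rightarrow> 'h"
  assumes C0: "C0_semigroup S"
begin

interpretation S: weak_semigroup S by (rule weak_semigroup_C0[OF C0])

lemma C0_jointly_continuous:
  assumes u: "\<And>n. u n \<in> {0..T}" "u \<longlonglongrightarrow> a" and x: "x \<longlonglongrightarrow> y"
  shows "(\<lambda>n. S (u n) (x n)) \<longlonglongrightarrow> S a y"
proof -
  obtain M where M: "M \<ge> 1" "\<And>t x. t \<in> {0..T} \<Longrightarrow> norm (S t x) \<le> M * norm x" using S.bound by metis
  have "a \<in> {0..T}" by (rule closed_sequentially[OF _ u(1) u(2)]) simp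
  then have "(\<lambda>n. S (u n) y) \<longlonglongrightarrow> S a y"
    using u by (intro continuous_on_tendsto_compose[OF C0_semigroup_continuous[OF C0]]) auto
  moreover have "(\<lambda>n. S (u n) (x n - y)) \<longlonglongrightarrow> 0"
  proof (rule Lim_null_comparison)
    show "\<forall>\<^sub>F n in sequentially. norm (S (u n) (x n - y)) \<le> M * norm (x n - y)"
      using M u by auto
    show "(\<lambda>n. M * norm (x n - y)) \<longlonglongrightarrow> 0"
      using x by (intro tendsto_mult_right_zero tendsto_norm_zero LIM_zero)
  qed
  ultimately have "(\<lambda>n. S (u n) (x n - y) + S (u n) y) \<longlonglongrightarrow> 0 + S a y" by (intro tendsto_add)
  moreover have "S (u n) (x n - y) + S (u n) y = S (u n) (x n)" for n
    using u(1)[of n] by (simp add: linear_simps(2)[OF S.lin])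
  ultimately show ?thesis by simp
qed

text \<open>The integrand of Duhamel's formula is approximated by discretizing the elapsed time and
the function \<open>f\<close> simultaneously.\<close>

lemma strongly_measurable_transported:
  assumes f: "strongly_measurable (lebesgue_on {0..t}) f"
  shows "strongly_measurable (lebesgue_on {0..t}) (\<lambda>s. S (t - s) (f s))"
proof -
  obtain g where g: "\<And>i. simple_function (lebesgue_on {0..t}) (g i)"
    "AE s in lebesgue_on {0..t}. (\<lambda>i. g i s) \<longlonglongrightarrow> f s"
    using f unfolding strongly_measurable_def by blast
  show ?thesis unfolding strongly_measurable_def
  proof (intro exI conjI allI)
    have "simple_function (lebesgue_on {0..t}) (\<lambda>s. round_up t i (t - s))" for i
      by (rule simple_function_round_up) (auto intro: borel_measurable_lebesgue_on)
    then show "simple_function (lebesgue_on {0..t}) (\<lambda>s. S (round_up t i (t - s)) (g i s))" for i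
      using g(1) by (rule simple_function_compose2)
    show "AE s in lebesgue_on {0..t}. (\<lambda>i. S (round_up t i (t - s)) (g i s)) \<longlonglongrightarrow> S (t - s) (f s)"
      using g(2) AE_space
    proof eventually_elim
      case (elim s)
      then have "0 \<le> t - s" "t - s \<le> t" by auto
      then have "round_up t i (t - s) \<in> {0..t}" for i using round_up_bounds[of "t - s" t i] by auto
      then show ?case
        by (rule C0_jointly_continuous) (use elim \<open>t - s \<le> t\<close> in \<open>auto intro: round_up_tendsto\<close>)
    qed
  qed
qed

text \<open>The forced part of Duhamel's formula. The second conjunct determines the value by its scalar
products, which is the form used in all computations; \<open>strong_integral_exists\<close>
shows that a vector with both properties exists.\<close>

definition convolution :: "(real \<Rightarrow> 'h) \<Rightarrow> real \<Rightarrow> 'h" where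
  "convolution f t = (SOME v. has_strong_integral (lebesgue_on {0..t}) (\<lambda>s. S (t - s) (f s)) v \<and>
     (\<forall>x. v \<bullet> x = (\<integral>s. S (t - s) (f s) \<bullet> x \<partial>lebesgue_on {0..t})))"

context
  fixes f :: "real \<Rightarrow> 'h" and T :: real
  assumes f: "strongly_measurable (lebesgue_on {0..T}) f" and f_int: "integrable (lebesgue_on {0..T}) (\<lambda>s. norm (f s))"
begin

lemma integrable_transported:
  assumes t: "t \<in> {0..T}"
  shows "integrable (lebesgue_on {0..t}) (\<lambda>s. norm (S (t - s) (f s)))"
proof -
  have ft: "strongly_measurable (lebesgue_on {0..t}) f"
    using t by (intro strongly_measurable_subinterval[OF f]) auto
  have ft_int: "integrable (lebesgue_on {0..t}) (\<lambda>s. norm (f s))"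
    using t by (intro Equivalence_Lebesgue_Henstock_Integration.integrable_subinterval[OF f_int]) auto
  obtain M where M: "M \<ge> 1" "\<And>t x. t \<in> {0..T} \<Longrightarrow> norm (S t x) \<le> M * norm x" using S.bound by metis
  show ?thesis
  proof (rule Bochner_Integration.integrable_bound)
    show "integrable (lebesgue_on {0..t}) (\<lambda>s. M * norm (f s))" using ft_int by simp
    show "(\<lambda>s. norm (S (t - s) (f s))) \<in> borel_measurable (lebesgue_on {0..t})"
      by (rule time.borel_measurable_norm_strong[OF strongly_measurable_transported[OF ft]])
    show "AE s in lebesgue_on {0..t}. norm (norm (S (t - s) (f s))) \<le> norm (M * norm (f s))"
      using M t by (intro AE_I2) auto
  qed
qed

lemma convolution_characterization:
  assumes t: "t \<in> {0..T}"
  shows "has_strong_integral (lebesgue_on {0..t}) (\<lambda>s. S (t - s) (f s)) (convolution f t)"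
    and "convolution f t \<bullet> x = (\<integral>s. S (t - s) (f s) \<bullet> x \<partial>lebesgue_on {0..t})"
proof -
  have ft: "strongly_measurable (lebesgue_on {0..t}) f"
    using t by (intro strongly_measurable_subinterval[OF f]) auto
  from someI_ex[OF time.strong_integral_exists[OF strongly_measurable_transported[OF ft] integrable_transported[OF t]]]
  show "has_strong_integral (lebesgue_on {0..t}) (\<lambda>s. S (t - s) (f s)) (convolution f t)"
    "convolution f t \<bullet> x = (\<integral>s. S (t - s) (f s) \<bullet> x \<partial>lebesgue_on {0..t})"
    unfolding convolution_def by blast+
qed

lemma integrable_transported_inner:
  assumes t: "t \<in> {0..T}"
  shows "integrable (lebesgue_on {0..t}) (\<lambda>s. S (t - s) (f s) \<bullet> x)"
proof (rule Bochner_Integration.integrable_bound)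
  have ft: "strongly_measurable (lebesgue_on {0..t}) f"
    using t by (intro strongly_measurable_subinterval[OF f]) auto
  show "integrable (lebesgue_on {0..t}) (\<lambda>s. norm (S (t - s) (f s)) * norm x)"
    using integrable_transported[OF t] by simp
  show "(\<lambda>s. S (t - s) (f s) \<bullet> x) \<in> borel_measurable (lebesgue_on {0..t})"
    by (rule time.borel_measurable_inner_strong[OF strongly_measurable_transported[OF ft] time.strongly_measurable_simple]) simp
qed (simp add: Cauchy_Schwarz_ineq2)

text \<open>By the semigroup law, transporting the trajectory from time \<open>a\<close> to \<open>b\<close> accounts for the integral over
\<open>[0,a]\<close>; what remains is the contribution of \<open>[a,b]\<close>.\<close>

lemma convolution_bound:
  assumes M: "\<And>t x. t \<in> {0..T} \<Longrightarrow> norm (S t x) \<le> M * norm x" "M \<ge> 0"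
    and ab: "0 \<le> a" "a \<le> b" "b \<le> T"
  shows "norm (convolution f b - S (b - a) (convolution f a)) \<le> M * (\<integral>s. norm (f s) \<partial>lebesgue_on {a..b})"
proof (rule norm_le_if_inner_le)
  have fab: "integrable (lebesgue_on {a..b}) (\<lambda>s. norm (f s))"
    using ab by (intro Equivalence_Lebesgue_Henstock_Integration.integrable_subinterval[OF f_int]) auto
  show "0 \<le> M * (\<integral>s. norm (f s) \<partial>lebesgue_on {a..b})" using M by simp
  fix x
  have int: "integrable (lebesgue_on {0..b}) (\<lambda>s. S (b - s) (f s) \<bullet> x)"
    using ab by (intro integrable_transported_inner) auto
  have "S (b - a) (convolution f a) \<bullet> x = convolution f a \<bullet> adjoint (S (b - a)) x"
    using ab by (intro inner_adjoint S.lin) auto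
  also have "\<dots> = (\<integral>s. S (a - s) (f s) \<bullet> adjoint (S (b - a)) x \<partial>lebesgue_on {0..a})"
    using ab by (intro convolution_characterization) auto
  also have "\<dots> = (\<integral>s. S (b - s) (f s) \<bullet> x \<partial>lebesgue_on {0..a})"
  proof (rule Bochner_Integration.integral_cong)
    fix s assume "s \<in> space (lebesgue_on {0..a})"
    then have "S (b - s) (f s) = S (b - a) (S (a - s) (f s))"
      using S.R_add[of "b - a" "a - s" "f s"] ab by simp
    then show "S (a - s) (f s) \<bullet> adjoint (S (b - a)) x = S (b - s) (f s) \<bullet> x"
      using ab by (simp add: inner_adjoint[OF S.lin])
  qed simp
  finally have "(convolution f b - S (b - a) (convolution f a)) \<bullet> x
      = (\<integral>s. S (b - s) (f s) \<bullet> x \<partial>lebesgue_on {a..b})"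
    using convolution_characterization(2)[of b x] ab int Equivalence_Measurable_On_Borel.integral_combine[OF int ab(1,2)]
    by (simp add: inner_diff_left)
  also have "\<dots> \<le> (\<integral>s. M * norm (f s) * norm x \<partial>lebesgue_on {a..b})"
  proof (rule integral_mono)
    show "integrable (lebesgue_on {a..b}) (\<lambda>s. S (b - s) (f s) \<bullet> x)"
      using ab by (intro Equivalence_Lebesgue_Henstock_Integration.integrable_subinterval[OF int]) auto
    show "integrable (lebesgue_on {a..b}) (\<lambda>s. M * norm (f s) * norm x)" using fab by simp
    fix s assume "s \<in> space (lebesgue_on {a..b})"
    then have "norm (S (b - s) (f s)) * norm x \<le> (M * norm (f s)) * norm x"
      using ab by (intro mult_right_mono M) auto
    then show "S (b - s) (f s) \<bullet> x \<le> M * norm (f s) * norm x"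
      using norm_cauchy_schwarz[of "S (b - s) (f s)" x] by linarith
  qed
  finally show "(convolution f b - S (b - a) (convolution f a)) \<bullet> x
    \<le> M * (\<integral>s. norm (f s) \<partial>lebesgue_on {a..b}) * norm x" by simp
qed

lemma convolution_0: "0 \<le> T \<Longrightarrow> convolution f 0 = 0"
proof -
  assume "0 \<le> T"
  have "convolution f 0 \<bullet> x = 0" for x
  proof -
    (* The interval of integration is the null set {0}. *)
    have "integral\<^sup>L (lebesgue_on {0::real}) (\<lambda>s. S (0 - s) (f s) \<bullet> x) = 0"
      by (rule integral_eq_zero_null_sets) (simp add: null_sets_completionI)
    then show ?thesis using convolution_characterization(2)[of 0 x] \<open>0 \<le> T\<close> by simp
  qed
  then show ?thesis using inner_eq_zero_iff by blast
qed

text \<open>The trajectory differs from a continuous orbit by the integral of \<open>f\<close> over the intermediate interval.\<close>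

lemma convolution_right_continuous:
  assumes t: "t \<in> {0..T}" and X: "\<And>n. X n \<in> {t..T}" "X \<longlonglongrightarrow> t"
  shows "(\<lambda>n. convolution f (X n)) \<longlonglongrightarrow> convolution f t"
proof -
  obtain M where M: "M \<ge> 1" "\<And>t x. t \<in> {0..T} \<Longrightarrow> norm (S t x) \<le> M * norm x" using S.bound by metis
  have fI: "integrable (lebesgue_on {t..T}) (\<lambda>s. norm (f s))"
    using t by (intro Equivalence_Lebesgue_Henstock_Integration.integrable_subinterval[OF f_int]) auto
  define F where "F b = integral {t..b} (\<lambda>s. norm (f s))" for b
  have F: "F b = (\<integral>s. norm (f s) \<partial>lebesgue_on {t..b})" if "b \<in> {t..T}" for b
    unfolding F_def using that
    by (intro lebesgue_integral_eq_integral[symmetric]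
        Equivalence_Lebesgue_Henstock_Integration.integrable_subinterval[OF fI]) auto
  have "(\<lambda>s. norm (f s)) integrable_on {t..T}"
    using integrable_on_lebesgue_on[OF fI] by simp
  then have "continuous_on {t..T} F" unfolding F_def by (rule indefinite_integral_continuous_1)
  then have "(\<lambda>n. F (X n)) \<longlonglongrightarrow> F t"
    by (rule continuous_on_tendsto_compose[OF _ X(2)]) (use t X(1) in auto)
  then have F0: "(\<lambda>n. M * F (X n)) \<longlonglongrightarrow> 0" by (intro tendsto_mult_right_zero) (simp add: F_def)
  have "(\<lambda>n. convolution f (X n) - S (X n - t) (convolution f t)) \<longlonglongrightarrow> 0"
  proof (rule Lim_null_comparison[OF _ F0], intro always_eventually allI)
    fix n
    show "norm (convolution f (X n) - S (X n - t) (convolution f t)) \<le> M * F (X n)"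
      using convolution_bound[of M t "X n"] M t X(1)[of n] F[of "X n"] by simp
  qed
  moreover have "(\<lambda>n. S (X n - t) (convolution f t)) \<longlonglongrightarrow> S (t - t) (convolution f t)"
  proof (rule C0_jointly_continuous[where T=T])
    show "X n - t \<in> {0..T}" for n using X(1)[of n] t by auto
  qed (intro tendsto_intros X)+
  ultimately have "(\<lambda>n. (convolution f (X n) - S (X n - t) (convolution f t)) + S (X n - t) (convolution f t))
      \<longlonglongrightarrow> 0 + S (t - t) (convolution f t)" by (rule tendsto_add)
  then show ?thesis by (simp add: S.R_0)
qed

lemma square_integrable_mild:
  assumes T: "0 \<le> T"
  shows "square_integrable (lebesgue_on {0..T}) (\<lambda>t. S t y0 + convolution f t)"
proof -
  obtain M where M: "M \<ge> 1" "\<And>t x. t \<in> {0..T} \<Longrightarrow> norm (S t x) \<le> M * norm x" using S.bound by metis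
  show ?thesis
  proof (rule time.square_integrable_bounded)
    show "strongly_measurable (lebesgue_on {0..T}) (\<lambda>t. S t y0 + convolution f t)"
    proof (rule strongly_measurable_right_continuous)
      fix t X assume *: "t \<in> {0..T}" "\<And>n. X n \<in> {t..T}" "X \<longlonglongrightarrow> t"
      have "X n \<in> {0..T}" for n using *(1) *(2)[of n] by auto
      then show "(\<lambda>n. S (X n) y0 + convolution f (X n)) \<longlonglongrightarrow> S t y0 + convolution f t"
        by (intro tendsto_add convolution_right_continuous * C0_jointly_continuous[where T=T] tendsto_const)
    qed
    show "norm (S t y0 + convolution f t) \<le> M * norm y0 + M * (\<integral>s. norm (f s) \<partial>lebesgue_on {0..T})"
      if "t \<in> space (lebesgue_on {0..T})" for t
    proof -
      have t: "t \<in> {0..T}" using that by simp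
      have "norm (convolution f t) \<le> M * (\<integral>s. norm (f s) \<partial>lebesgue_on {0..t})"
        using convolution_bound[of M 0 t] M t T by (simp add: convolution_0 linear_simps(3)[OF S.lin])
      also have "\<dots> \<le> M * (\<integral>s. norm (f s) \<partial>lebesgue_on {0..T})"
      proof (rule mult_left_mono)
        have "(\<integral>s. norm (f s) \<partial>lebesgue_on {0..T})
            = (\<integral>s. norm (f s) \<partial>lebesgue_on {0..t}) + (\<integral>s. norm (f s) \<partial>lebesgue_on {t..T})"
          using t by (intro Equivalence_Measurable_On_Borel.integral_combine f_int) auto
        moreover have "0 \<le> (\<integral>s. norm (f s) \<partial>lebesgue_on {t..T})" by simp
        ultimately show "(\<integral>s. norm (f s) \<partial>lebesgue_on {0..t}) \<le> (\<integral>s. norm (f s) \<partial>lebesgue_on {0..T})"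
          by linarith
      qed (use M in simp)
      finally have "norm (convolution f t) \<le> M * (\<integral>s. norm (f s) \<partial>lebesgue_on {0..T})" .
      moreover have "norm (S t y0) \<le> M * norm y0" using M t by blast
      ultimately show ?thesis using norm_triangle_ineq[of "S t y0" "convolution f t"] by linarith
    qed
  qed
qed

end

end

lemma convolution_axpy:
  fixes S :: "real \<Rightarrow> 'h::{real_inner, complete_space} \<Rightarrow> 'h"
  assumes C0: "C0_semigroup S" and t: "t \<in> {0..T}"
    and f: "square_integrable (lebesgue_on {0..T}) f" and g: "square_integrable (lebesgue_on {0..T}) g"
  shows "convolution S (\<lambda>t. f t + c *\<^sub>R g t) t = convolution S f t + c *\<^sub>R convolution S g t"
proof -
  interpret S: weak_semigroup S by (rule weak_semigroup_C0[OF C0])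
  have fg: "square_integrable (lebesgue_on {0..T}) (\<lambda>t. f t + c *\<^sub>R g t)"
    by (rule time.square_integrable_axpy[OF f g])
  have sm: "strongly_measurable (lebesgue_on {0..T}) h" and int: "integrable (lebesgue_on {0..T}) (\<lambda>s. norm (h s))"
    if "square_integrable (lebesgue_on {0..T}) h" for h :: "real \<Rightarrow> 'h"
    using that time.square_integrable_norm[OF that] by (auto simp: square_integrable_def)
  note conv = convolution_characterization(2)[OF C0 sm int t] and cint = integrable_transported_inner[OF C0 sm int t]
  have "convolution S (\<lambda>t. f t + c *\<^sub>R g t) t \<bullet> x = (convolution S f t + c *\<^sub>R convolution S g t) \<bullet> x" for x
  proof -
    have "convolution S (\<lambda>t. f t + c *\<^sub>R g t) t \<bullet> x
        = (\<integral>s. S (t - s) (f s) \<bullet> x + c * (S (t - s) (g s) \<bullet> x) \<partial>lebesgue_on {0..t})"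
      unfolding conv[OF fg fg] using t
      by (intro Bochner_Integration.integral_cong)
        (auto simp: linear_simps(1,5)[OF S.lin] inner_simps)
    also have "\<dots> = (convolution S f t + c *\<^sub>R convolution S g t) \<bullet> x"
      using cint[OF f f] cint[OF g g] by (simp add: inner_simps conv[OF f f] conv[OF g g])
    finally show ?thesis .
  qed
  then have "(convolution S (\<lambda>t. f t + c *\<^sub>R g t) t - (convolution S f t + c *\<^sub>R convolution S g t)) \<bullet> x = 0" for x
    by (simp add: inner_diff_left)
  then show ?thesis by (metis inner_eq_zero_iff right_minus_eq)
qed

lemma L2_convolution:
  assumes C0: "C0_semigroup S" and T: "0 \<le> T" and f: "f \<in> L2 T"
  shows "(\<lambda>t. S t y0 + convolution S f t) \<in> L2 T" and "convolution S f \<in> L2 T"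
proof -
  interpret S: weak_semigroup S by (rule weak_semigroup_C0[OF C0])
  have sm: "strongly_measurable (time_measure T) f" and int: "integrable (time_measure T) (\<lambda>s. norm (f s))"
    using L2_D[OF f] time.square_integrable_norm[OF L2_D[OF f]] by (auto simp: square_integrable_def)
  show *: "(\<lambda>t. S t y0 + convolution S f t) \<in> L2 T" for y0
    using square_integrable_mild[OF C0 sm int T] by (simp add: L2_eq)
  have "square_integrable (time_measure T) (\<lambda>t. convolution S f t)"
  proof (rule time.square_integrable_cong_AE[OF L2_D[OF *[of 0]]], rule AE_I2)
    fix t assume "t \<in> space (time_measure T)"
    then show "S t 0 + convolution S f t = convolution S f t" by (simp add: linear_simps(3)[OF S.lin])
  qed
  then show "convolution S f \<in> L2 T" by (simp add: L2_eq)
qed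

section \<open>Duality between control and adjoint state\<close>

lemma simple_function_measurable_range:
  assumes "simple_function M f"
  shows "f \<in> measurable M (count_space (f ` space M))"
proof (rule measurableI)
  fix A assume "A \<in> sets (count_space (f ` space M))"
  have "f \<in> measurable M (count_space UNIV)" using assms by (rule measurable_simple_function)
  then show "f -` A \<inter> space M \<in> sets M" by (rule measurable_sets) simp
qed simp

text \<open>For simple functions the integrand takes, on each of finitely many rectangles, the form of a
continuous function of the elapsed time \<open>t - s\<close>; the general case follows by passing to the limit
everywhere. The indicator of \<open>{0..}\<close> discards negative times, at which the semigroup is arbitrary.\<close>

lemma convolution_kernel_measurable:
  fixes S :: "real \<Rightarrow> 'h::{real_inner, complete_space} \<Rightarrow> 'h"
  assumes C0: "C0_semigroup S"
    and f: "\<And>n. simple_function (lebesgue_on {0..T}) (f n)" "\<And>s. (\<lambda>n. f n s) \<longlonglongrightarrow> f' s"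
    and w: "\<And>n. simple_function (lebesgue_on {0..T}) (w n)" "\<And>s. (\<lambda>n. w n s) \<longlonglongrightarrow> w' s"
  shows "(\<lambda>(s, t). if s \<le> t then S (t - s) (f' s) \<bullet> w' t else 0)
    \<in> borel_measurable (lebesgue_on {0..T} \<Otimes>\<^sub>M lebesgue_on {0..T})"
proof -
  interpret S: weak_semigroup S by (rule weak_semigroup_C0[OF C0])
  let ?M = "lebesgue_on {0..T}"
  have kernel: "(\<lambda>x. indicator {0..} x *\<^sub>R (S x a \<bullet> b)) \<in> borel_measurable borel" for a b
    by (intro borel_measurable_continuous_on_indicator S.weak_cont) simp
  have elapsed: "(\<lambda>x. snd x - fst x) \<in> borel_measurable (?M \<Otimes>\<^sub>M ?M)"
  proof -
    have "(\<lambda>t. t) \<in> borel_measurable ?M" by (rule borel_measurable_lebesgue_on) simp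
    from measurable_compose[OF measurable_fst this] measurable_compose[OF measurable_snd this]
    show ?thesis by (intro borel_measurable_diff) auto
  qed
  have "(\<lambda>x. indicator {0..} (snd x - fst x) *\<^sub>R (S (snd x - fst x) (f n (fst x)) \<bullet> w n (snd x)))
      \<in> borel_measurable (?M \<Otimes>\<^sub>M ?M)" for n
  proof (rule measurable_compose_countable'[where I="f n ` space ?M" and g="\<lambda>x. f n (fst x)"])
    fix a
    show "(\<lambda>x. indicator {0..} (snd x - fst x) *\<^sub>R (S (snd x - fst x) a \<bullet> w n (snd x)))
      \<in> borel_measurable (?M \<Otimes>\<^sub>M ?M)"
    proof (rule measurable_compose_countable'[where I="w n ` space ?M" and g="\<lambda>x. w n (snd x)"])
      fix b
      show "(\<lambda>x. indicator {0..} (snd x - fst x) *\<^sub>R (S (snd x - fst x) a \<bullet> b))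
        \<in> borel_measurable (?M \<Otimes>\<^sub>M ?M)"
        by (rule measurable_compose[OF elapsed kernel])
      show "(\<lambda>x. w n (snd x)) \<in> ?M \<Otimes>\<^sub>M ?M \<rightarrow>\<^sub>M count_space (w n ` space ?M)"
        by (rule measurable_compose[OF measurable_snd simple_function_measurable_range[OF w(1)]])
    qed (use simple_functionD(1)[OF w(1)] in \<open>auto intro: countable_finite\<close>)
    show "(\<lambda>x. f n (fst x)) \<in> ?M \<Otimes>\<^sub>M ?M \<rightarrow>\<^sub>M count_space (f n ` space ?M)"
      by (rule measurable_compose[OF measurable_fst simple_function_measurable_range[OF f(1)]])
  qed (use simple_functionD(1)[OF f(1)] in \<open>auto intro: countable_finite\<close>)
  then show ?thesis
  proof (rule borel_measurable_LIMSEQ_real[rotated])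
    fix x :: "real \<times> real"
    obtain s t where x: "x = (s, t)" by (cases x)
    show "(\<lambda>n. indicator {0..} (snd x - fst x) *\<^sub>R (S (snd x - fst x) (f n (fst x)) \<bullet> w n (snd x)))
      \<longlonglongrightarrow> (case x of (s, t) \<Rightarrow> if s \<le> t then S (t - s) (f' s) \<bullet> w' t else 0)"
    proof (cases "s \<le> t")
      case True
      then have "(\<lambda>n. S (t - s) (f n s)) \<longlonglongrightarrow> S (t - s) (f' s)"
        by (intro bounded_linear.tendsto[OF S.lin] f) simp
      from tendsto_inner[OF this w(2)[of t]] show ?thesis using True x by simp
    qed (use x in simp)
  qed
qed

text \<open>Both sides are iterated integrals of \<open>S (t - s) (f s) \<bullet> w t\<close> over the triangle \<open>s \<le> t\<close>. To apply Fubini's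
theorem on the product of Lebesgue measures, \<open>f\<close> and \<open>w\<close> are replaced by equivalent functions that
are limits of simple functions everywhere.\<close>

theorem convolution_Fubini:
  fixes S :: "real \<Rightarrow> 'h::{real_inner, complete_space} \<Rightarrow> 'h"
  assumes C0: "C0_semigroup S" and T: "0 \<le> T"
    and f: "square_integrable (lebesgue_on {0..T}) f" and w: "square_integrable (lebesgue_on {0..T}) w"
    and p: "\<And>s x. s \<in> {0..T} \<Longrightarrow> p s \<bullet> x = (\<integral>t. (if s \<le> t then S (t - s) x \<bullet> w t else 0) \<partial>lebesgue_on {0..T})"
  shows "(\<integral>t. convolution S f t \<bullet> w t \<partial>lebesgue_on {0..T}) = (\<integral>s. f s \<bullet> p s \<partial>lebesgue_on {0..T})"
proof -
  interpret S: weak_semigroup S by (rule weak_semigroup_C0[OF C0])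
  let ?M = "lebesgue_on {0..T}"
  interpret P: pair_sigma_finite ?M ?M ..
  obtain M where M: "M \<ge> 1" "\<And>t x. t \<in> {0..T} \<Longrightarrow> norm (S t x) \<le> M * norm x" using S.bound by metis
  have f_sm: "strongly_measurable ?M f" and f_int: "integrable ?M (\<lambda>s. norm (f s))"
    using f time.square_integrable_norm[OF f] by (auto simp: square_integrable_def)
  have w_sm: "strongly_measurable ?M w" using w by (simp add: square_integrable_def)
  obtain f' fi where fi: "\<And>n. simple_function ?M (fi n)" "\<And>s. (\<lambda>n. fi n s) \<longlonglongrightarrow> f' s"
    and f': "AE s in ?M. f' s = f s"
    using strongly_measurable_everywhere_limit[OF f_sm] by blast
  obtain w' wi where wi: "\<And>n. simple_function ?M (wi n)" "\<And>s. (\<lambda>n. wi n s) \<longlonglongrightarrow> w' s"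
    and w': "AE s in ?M. w' s = w s"
    using strongly_measurable_everywhere_limit[OF w_sm] by blast
  have "AE s in ?M. f s = f' s" using f' by eventually_elim simp
  from time.square_integrable_norm[OF time.square_integrable_cong_AE[OF f this]]
  have f'_int: "integrable ?M (\<lambda>s. norm (f' s))" .
  have "AE s in ?M. w s = w' s" using w' by eventually_elim simp
  from time.square_integrable_norm[OF time.square_integrable_cong_AE[OF w this]]
  have w'_int: "integrable ?M (\<lambda>s. norm (w' s))" .
  define k where "k s t = (if s \<le> t then S (t - s) (f' s) \<bullet> w' t else 0)" for s t
  have k_meas: "case_prod k \<in> borel_measurable (?M \<Otimes>\<^sub>M ?M)"
    using convolution_kernel_measurable[OF C0 fi wi] by (simp add: k_def[abs_def])
  have k_int: "integrable (?M \<Otimes>\<^sub>M ?M) (case_prod k)"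
  proof (rule Bochner_Integration.integrable_bound[OF _ k_meas])
    show "integrable (?M \<Otimes>\<^sub>M ?M) (\<lambda>x. M * (norm (f' (fst x)) * norm (w' (snd x))))"
    proof (rule P.Fubini_integrable)
      have "(\<lambda>x. norm (f' (fst x))) \<in> borel_measurable (?M \<Otimes>\<^sub>M ?M)"
        using measurable_compose[OF measurable_fst borel_measurable_integrable[OF f'_int]] .
      moreover have "(\<lambda>x. norm (w' (snd x))) \<in> borel_measurable (?M \<Otimes>\<^sub>M ?M)"
        using measurable_compose[OF measurable_snd borel_measurable_integrable[OF w'_int]] .
      ultimately show "(\<lambda>x. M * (norm (f' (fst x)) * norm (w' (snd x)))) \<in> borel_measurable (?M \<Otimes>\<^sub>M ?M)"
        by measurable
    qed (use f'_int w'_int M in \<open>auto simp: abs_mult\<close>)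
    show "AE x in ?M \<Otimes>\<^sub>M ?M. norm (case_prod k x) \<le> norm (M * (norm (f' (fst x)) * norm (w' (snd x))))"
    proof (rule AE_I2)
      fix x assume "x \<in> space (?M \<Otimes>\<^sub>M ?M)"
      then obtain s t where x: "x = (s, t)" "s \<in> {0..T}" "t \<in> {0..T}" by (auto simp: space_pair_measure)
      have "\<bar>k s t\<bar> \<le> M * norm (f' s) * norm (w' t)"
      proof (cases "s \<le> t")
        case True
        then have "norm (S (t - s) (f' s)) * norm (w' t) \<le> M * norm (f' s) * norm (w' t)"
          using x by (intro mult_right_mono M) auto
        then show ?thesis
          using Cauchy_Schwarz_ineq2[of "S (t - s) (f' s)" "w' t"] True by (simp add: k_def)
      qed (use M in \<open>simp add: k_def\<close>)
      then show "norm (case_prod k x) \<le> norm (M * (norm (f' (fst x)) * norm (w' (snd x))))"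
        using x M by (simp add: mult_ac abs_mult)
    qed
  qed
  have "(\<integral>t. convolution S f t \<bullet> w t \<partial>?M) = (\<integral>t. (\<integral>s. k s t \<partial>?M) \<partial>?M)"
  proof (rule time.integral_cong_AE_complete)
    show "(\<lambda>t. \<integral>s. k s t \<partial>?M) \<in> borel_measurable ?M"
      using P.integrable_snd[OF k_int] by (rule borel_measurable_integrable)
    show "AE t in ?M. (\<integral>s. k s t \<partial>?M) = convolution S f t \<bullet> w t"
      using w' AE_space
    proof eventually_elim
      case (elim t)
      then have t: "t \<in> {0..T}" by simp
      have "convolution S f t \<bullet> w t = (\<integral>s. S (t - s) (f s) \<bullet> w t \<partial>lebesgue_on {0..t})"
        using convolution_characterization(2)[OF C0 f_sm f_int t] .
      also have "\<dots> = (\<integral>s. (if s \<in> {0..t} then S (t - s) (f s) \<bullet> w t else 0) \<partial>?M)"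
        using t by (intro integral_restrict[symmetric]) auto
      also have "\<dots> = (\<integral>s. k s t \<partial>?M)"
      proof (rule time.integral_cong_AE_complete)
        show "(\<lambda>s. k s t) \<in> borel_measurable ?M"
          using measurable_compose[OF measurable_Pair2'[of t ?M ?M] k_meas] t by simp
        show "AE s in ?M. k s t = (if s \<in> {0..t} then S (t - s) (f s) \<bullet> w t else 0)"
          using f' AE_space by eventually_elim (use elim in \<open>auto simp: k_def\<close>)
      qed
      finally show ?case by simp
    qed
  qed
  also have "\<dots> = (\<integral>s. (\<integral>t. k s t \<partial>?M) \<partial>?M)" by (rule P.Fubini_integral[OF k_int])
  also have "\<dots> = (\<integral>s. f s \<bullet> p s \<partial>?M)"
  proof (rule time.integral_cong_AE_complete[symmetric])
    show "(\<lambda>s. \<integral>t. k s t \<partial>?M) \<in> borel_measurable ?M"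
      using P.integrable_fst[OF k_int] by (rule borel_measurable_integrable)
    show "AE s in ?M. (\<integral>t. k s t \<partial>?M) = f s \<bullet> p s"
      using f' AE_space
    proof eventually_elim
      case (elim s)
      then have s: "s \<in> {0..T}" by simp
      have "f s \<bullet> p s = (\<integral>t. (if s \<le> t then S (t - s) (f s) \<bullet> w t else 0) \<partial>?M)"
        using p[OF s, of "f s"] by (simp add: inner_commute[of _ "p s"])
      also have "\<dots> = (\<integral>t. k s t \<partial>?M)"
      proof (rule time.integral_cong_AE_complete)
        show "(\<lambda>t. k s t) \<in> borel_measurable ?M"
          using measurable_compose[OF measurable_Pair1'[of s ?M ?M] k_meas] s by simp
        show "AE t in ?M. k s t = (if s \<le> t then S (t - s) (f s) \<bullet> w t else 0)"
          using w' by eventually_elim (use elim in \<open>auto simp: k_def\<close>)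
      qed
      finally show ?case by simp
    qed
  qed
  finally show ?thesis .
qed

text \<open>Reflecting time turns Duhamel's formula for the adjoint semigroup, run backward from \<open>T\<close>, into an
integral over the future \<open>[s,T]\<close> of the original time variable.\<close>

lemma adjoint_convolution:
  fixes S :: "real \<Rightarrow> 'h::{real_inner, complete_space} \<Rightarrow> 'h"
  assumes C0: "C0_semigroup S" and w: "square_integrable (lebesgue_on {0..T}) w" and s: "s \<in> {0..T}"
  shows "convolution (\<lambda>t. adjoint (S t)) (\<lambda>t. w (T - t)) (T - s) \<bullet> x
    = (\<integral>t. (if s \<le> t then S (t - s) x \<bullet> w t else 0) \<partial>lebesgue_on {0..T})"
proof -
  interpret S: weak_semigroup S by (rule weak_semigroup_C0[OF C0])
  interpret Sa: weak_semigroup "\<lambda>t. adjoint (S t)" by (rule adjoint_weak_semigroup[OF C0])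
  have wr: "square_integrable (lebesgue_on {0..T}) (\<lambda>t. w (T - t))" by (rule square_integrable_reflect[OF w])
  then have wr_sm: "strongly_measurable (lebesgue_on {0..T}) (\<lambda>t. w (T - t))"
    and wr_int: "integrable (lebesgue_on {0..T}) (\<lambda>t. norm (w (T - t)))"
    using time.square_integrable_norm[OF wr] by (auto simp: square_integrable_def)
  define g where "g t = (if s \<le> t then S (t - s) x else 0)" for t
  have g: "strongly_measurable (lebesgue_on {0..T}) g"
  proof (rule strongly_measurable_right_continuous)
    fix t X assume t: "t \<in> {0..T}" and X: "\<And>n. X n \<in> {t..T}" "X \<longlonglongrightarrow> t"
    show "(\<lambda>n. g (X n)) \<longlonglongrightarrow> g t"
    proof (cases "s \<le> t")
      case True
      have "s \<le> X n" for n using X(1)[of n] True by simp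
      moreover have "(\<lambda>n. S (X n - s) x) \<longlonglongrightarrow> S (t - s) x"
      proof (rule C0_jointly_continuous[OF C0, where T=T])
        show "X n - s \<in> {0..T}" for n using X(1)[of n] True s by auto
      qed (intro tendsto_intros X)+
      ultimately show ?thesis using True by (simp add: g_def)
    next
      case False
      then have "\<forall>\<^sub>F n in sequentially. X n < s" using order_tendstoD(2)[OF X(2)] by simp
      then have "\<forall>\<^sub>F n in sequentially. g (X n) = g t"
        by eventually_elim (use False in \<open>simp add: g_def\<close>)
      then show ?thesis by (rule tendsto_eventually)
    qed
  qed
  have Ts: "T - s \<in> {0..T}" using s by auto
  have "convolution (\<lambda>t. adjoint (S t)) (\<lambda>t. w (T - t)) (T - s) \<bullet> x
      = (\<integral>r. adjoint (S (T - s - r)) (w (T - r)) \<bullet> x \<partial>lebesgue_on {0..T - s})"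
    by (rule convolution_characterization(2)[OF Sa.C0 wr_sm wr_int Ts])
  also have "\<dots> = (\<integral>r. (if r \<in> {0..T - s} then adjoint (S (T - s - r)) (w (T - r)) \<bullet> x else 0) \<partial>lebesgue_on {0..T})"
    using s by (intro integral_restrict[symmetric]) auto
  also have "\<dots> = (\<integral>r. g (T - r) \<bullet> w (T - r) \<partial>lebesgue_on {0..T})"
  proof (rule Bochner_Integration.integral_cong)
    fix r assume r: "r \<in> space (lebesgue_on {0..T})"
    show "(if r \<in> {0..T - s} then adjoint (S (T - s - r)) (w (T - r)) \<bullet> x else 0) = g (T - r) \<bullet> w (T - r)"
    proof (cases "r \<le> T - s")
      case True
      then have "S (T - r - s) x \<bullet> w (T - r) = x \<bullet> adjoint (S (T - r - s)) (w (T - r))"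
        by (intro inner_adjoint S.lin) simp
      then show ?thesis using True r by (simp add: g_def inner_commute[of x] algebra_simps)
    qed (simp add: g_def)
  qed simp
  also have "\<dots> = (\<integral>t. g t \<bullet> w t \<partial>lebesgue_on {0..T})"
    using w g by (intro integral_reflect_time time.borel_measurable_inner_strong) (auto simp: square_integrable_def)
  also have "\<dots> = (\<integral>t. (if s \<le> t then S (t - s) x \<bullet> w t else 0) \<partial>lebesgue_on {0..T})"
    by (intro Bochner_Integration.integral_cong) (auto simp: g_def)
  finally show ?thesis .
qed

text \<open>Duhamel's formula for the solution of \<open>z' + A\<^sup>* z = - w\<close>, \<open>z(T) = \<zeta>\<close>; with this sign of \<open>w\<close> the two terms
of the duality identity are added.\<close>

definition adjoint_state :: "(real \<Rightarrow> 'h::{real_inner, complete_space} \<Rightarrow> 'h) \<Rightarrow> real \<Rightarrow> (real \<Rightarrow> 'h) \<Rightarrow> 'h \<Rightarrow> real \<Rightarrow> 'h"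
  where "adjoint_state S T w \<zeta> s =
    adjoint (S (T - s)) \<zeta> + convolution (\<lambda>t. adjoint (S t)) (\<lambda>t. w (T - t)) (T - s)"

lemma L2_reflect: "f \<in> L2 T \<Longrightarrow> (\<lambda>t. f (T - t)) \<in> L2 T"
  by (simp add: L2_eq square_integrable_reflect)

lemma L2_adjoint_state:
  assumes C0: "C0_semigroup S" and T: "0 \<le> T" and w: "w \<in> L2 T"
  shows "adjoint_state S T w \<zeta> \<in> L2 T"
  using L2_reflect[OF L2_convolution(1)[OF weak_semigroup.C0[OF adjoint_weak_semigroup[OF C0]] T L2_reflect[OF w]]]
  by (simp add: adjoint_state_def[abs_def])

lemma backward_mild_solution_adjoint_state:
  assumes gen: "generates A S" and w: "w \<in> L2 T"
  shows "backward_mild_solution T (adjoint_op A) (\<lambda>t. - w t) \<zeta> (adjoint_state S T w \<zeta>)"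
  unfolding backward_mild_solution_def mild_solution_def
proof (intro exI conjI ballI)
  show gen': "generates (adjoint_op A) (\<lambda>t. adjoint (S t))" by (rule generates_adjoint[OF gen])
  fix t assume t: "t \<in> {0..T}"
  have "(\<lambda>t. w (T - t)) \<in> L2 T" by (rule L2_reflect[OF w])
  then have "strongly_measurable (time_measure T) (\<lambda>t. w (T - t))"
    "integrable (time_measure T) (\<lambda>t. norm (w (T - t)))"
    using time.square_integrable_norm L2_D by (auto simp: square_integrable_def L2_eq)
  from convolution_characterization(1)[OF _ this t, of "\<lambda>t. adjoint (S t)"] gen'
  show "has_strong_integral (lebesgue_on {0..t}) (\<lambda>s. adjoint (S (t - s)) (- (- w (T - s))))
      (adjoint_state S T w \<zeta> (T - t) - adjoint (S t) \<zeta>)"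
    by (simp add: adjoint_state_def generates_def)
qed

text \<open>The final value contributes through the adjoint of \<open>S (T - s)\<close>, the distributed term through
\<open>convolution_Fubini\<close>.\<close>

theorem state_adjoint_duality:
  assumes C0: "C0_semigroup S" and T: "0 \<le> T" and f: "f \<in> L2 T" and w: "w \<in> L2 T"
  shows "convolution S f T \<bullet> \<zeta> + L2_inner T (convolution S f) w = L2_inner T f (adjoint_state S T w \<zeta>)"
proof -
  interpret S: weak_semigroup S by (rule weak_semigroup_C0[OF C0])
  have sm: "strongly_measurable (time_measure T) f" and int: "integrable (time_measure T) (\<lambda>s. norm (f s))"
    using L2_D[OF f] time.square_integrable_norm[OF L2_D[OF f]] by (auto simp: square_integrable_def)
  define p where "p = (\<lambda>s. convolution (\<lambda>t. adjoint (S t)) (\<lambda>t. w (T - t)) (T - s))"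
  have p: "p \<in> L2 T"
    unfolding p_def
    by (rule L2_reflect[OF L2_convolution(2)[OF weak_semigroup.C0[OF adjoint_weak_semigroup[OF C0]] T L2_reflect[OF w]]])
  have "convolution S f T \<bullet> \<zeta> = (\<integral>s. S (T - s) (f s) \<bullet> \<zeta> \<partial>time_measure T)"
    using T by (intro convolution_characterization(2)[OF C0 sm int]) simp
  also have "\<dots> = L2_inner T f (\<lambda>s. adjoint_state S T w \<zeta> s - p s)"
    unfolding L2_inner_def
    by (intro Bochner_Integration.integral_cong)
      (auto simp: adjoint_state_def p_def intro!: inner_adjoint S.lin)
  also have "\<dots> = L2_inner T f (adjoint_state S T w \<zeta>) - L2_inner T f p"
    using L2_inner_diff[OF L2_adjoint_state[OF C0 T w] p f] by (simp add: L2_inner_commute[of T f])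
  finally have "convolution S f T \<bullet> \<zeta> = L2_inner T f (adjoint_state S T w \<zeta>) - L2_inner T f p" .
  moreover have "L2_inner T (convolution S f) w = L2_inner T f p"
    unfolding L2_inner_def
  proof (rule convolution_Fubini[OF C0 T L2_D[OF f] L2_D[OF w]])
    show "p s \<bullet> x = (\<integral>t. (if s \<le> t then S (t - s) x \<bullet> w t else 0) \<partial>time_measure T)"
      if "s \<in> {0..T}" for s x
      unfolding p_def by (rule adjoint_convolution[OF C0 L2_D[OF w] that])
  qed
  ultimately show ?thesis by simp
qed

text \<open>By duality \<open>B\<^sup>* z\<close> is orthogonal to every control \<open>v\<close> orthogonal to \<open>G\<close>. The difference \<open>v\<close> of \<open>B\<^sup>* z\<close> and its
projection \<open>p\<close> onto \<open>G\<close> is such a control, hence orthogonal to itself, so that \<open>B\<^sup>* z = p\<close> belongs to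
\<open>G\<close> and the unique continuation property applies.\<close>

lemma adjoint_data_zero_if_orthogonal:
  fixes A :: "('h::{real_inner, complete_space} \<times> 'h) set"
    and B :: "'u::{real_inner, complete_space} \<Rightarrow> 'h"
  assumes gen: "generates A S" and B: "bounded_linear B" and T: "0 \<le> T"
    and G: "L2_closed_subspace T G" and W: "L2_closed_subspace T W"
    and unique_continuation:
      "\<And>zT g w z. \<lbrakk>g \<in> G; w \<in> W; backward_mild_solution T (adjoint_op A) w zT z;
          AE t in time_measure T. adjoint B (z t) = g t\<rbrakk>
        \<Longrightarrow> zT = 0 \<and> (AE t in time_measure T. g t = 0) \<and> (AE t in time_measure T. w t = 0)"
    and w: "w \<in> W"
    and orth: "\<And>v. v \<in> L2 T \<Longrightarrow> (\<And>g. g \<in> G \<Longrightarrow> L2_inner T v g = 0) \<Longrightarrow>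
      convolution S (\<lambda>t. B (v t)) T \<bullet> \<zeta> + L2_inner T (convolution S (\<lambda>t. B (v t))) w = 0"
  shows "\<zeta> = 0 \<and> (AE t in time_measure T. w t = 0)"
proof -
  have C0: "C0_semigroup S" using gen by (simp add: generates_def)
  have wL: "w \<in> L2 T" and GL: "G \<subseteq> L2 T" using W G w by (auto simp: L2_closed_subspace_def)
  define z where "z = adjoint_state S T w \<zeta>"
  have z: "z \<in> L2 T" unfolding z_def by (rule L2_adjoint_state[OF C0 T wL])
  have Ba: "bounded_linear (adjoint B)"
    using B by (rule bounded_linear_adjoint(1)[where M="onorm B"]) (use onorm[OF B] onorm_pos_le[OF B] in auto)
  define q where "q = (\<lambda>t. adjoint B (z t))"
  have q: "q \<in> L2 T"
    using time.square_integrable_compose_bounded[OF L2_D[OF z] Ba] by (simp add: L2_eq q_def)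
  obtain p where p: "p \<in> G" and proj: "\<And>g. g \<in> G \<Longrightarrow> L2_inner T q g = L2_inner T p g"
    using L2_projection_exists[OF G q] by blast
  have pL: "p \<in> L2 T" using p GL by blast
  define v where "v = (\<lambda>t. q t - p t)"
  have v: "v \<in> L2 T" using L2_axpy[OF q pL, of "-1"] by (simp add: v_def)
  have vG: "L2_inner T v g = 0" if "g \<in> G" for g
    using that GL unfolding v_def by (subst L2_inner_diff[OF q pL]) (auto simp: proj)
  have Bv: "(\<lambda>t. B (v t)) \<in> L2 T"
    using time.square_integrable_compose_bounded[OF L2_D[OF v] B] by (simp add: L2_eq)
  have "L2_inner T v q = L2_inner T (\<lambda>t. B (v t)) z"
    unfolding L2_inner_def q_def by (simp add: inner_adjoint[OF B])
  also have "\<dots> = 0" using state_adjoint_duality[OF C0 T Bv wL, of \<zeta>] orth[OF v vG] by (simp add: z_def)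
  finally have "L2_inner T v q = 0" .
  then have "L2_inner T v v = 0"
    using L2_inner_diff[OF q pL v, folded v_def] vG[OF p]
    by (simp add: L2_inner_commute[of T q v] L2_inner_commute[of T p v])
  then have "AE t in time_measure T. v t = 0" by (rule AE_zero_if_L2_inner_zero[OF v])
  then have observation: "AE t in time_measure T. adjoint B (z t) = p t" by eventually_elim (simp add: v_def q_def)
  have minus_w: "(\<lambda>t. - w t) \<in> W"
    using L2_closed_subspace_sum[OF W, of "{w}" "\<lambda>_. -1"] w by simp
  have "backward_mild_solution T (adjoint_op A) (\<lambda>t. - w t) \<zeta> z"
    unfolding z_def by (rule backward_mild_solution_adjoint_state[OF gen wL])
  from unique_continuation[OF p minus_w this observation] show ?thesis by simp
qed

section \<open>Controllability\<close>

theorem theorem1p1: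
  fixes A :: "('h::{real_inner, complete_space} \<times> 'h) set"
    and B :: "'u::{real_inner, complete_space} \<Rightarrow> 'h"
    and T :: real
    and G :: "(real \<Rightarrow> 'u) set"
    and W :: "(real \<Rightarrow> 'h) set"
    and E :: "'h set"
  assumes A: "\<exists>S. generates A S"
    and B: "bounded_linear B"
    and T: "T > 0"
    and G: "L2_closed_subspace T G"
    and W: "L2_closed_subspace T W"
    and E: "finite_dim_subspace E"
    and unique_continuation:
      "\<And>zT g w z. \<lbrakk>g \<in> G; w \<in> W; backward_mild_solution T (adjoint_op A) w zT z;
          AE t in time_measure T. adjoint B (z t) = g t\<rbrakk>
        \<Longrightarrow> zT = 0 \<and> (AE t in time_measure T. g t = 0) \<and> (AE t in time_measure T. w t = 0)"
    and W_fin: "L2_finite_dim T W"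
  shows "\<forall>y0 y1. \<forall>\<epsilon>>0. \<forall>g\<^sub>0\<in>G. \<forall>w\<^sub>0\<in>W.
    \<exists>u\<in>L2 T. L2_proj T G u g\<^sub>0 \<and>
      (\<exists>y. mild_solution T A (\<lambda>t. B (u t)) y0 y \<and>
           norm (y T - y1) \<le> \<epsilon> \<and> L2_proj T W y w\<^sub>0 \<and> orth_proj E (y T) = orth_proj E y1)"
proof (intro allI impI ballI)
  fix y0 y1 :: 'h and \<epsilon> :: real and g\<^sub>0 w\<^sub>0
  assume \<epsilon>: "\<epsilon> > 0" and g0: "g\<^sub>0 \<in> G" and w0: "w\<^sub>0 \<in> W"
  obtain S where gen: "generates A S" using A by blast
  have C0: "C0_semigroup S" using gen by (simp add: generates_def)
  have T0: "0 \<le> T" using T by simp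
  obtain Bs where Bs: "finite Bs" "Bs \<subseteq> W"
    and span_W: "\<And>f. f \<in> W \<Longrightarrow> \<exists>c. AE t in time_measure T. f t = (\<Sum>b\<in>Bs. c b *\<^sub>R b t)"
    using W_fin unfolding L2_finite_dim_def by blast
  obtain b where b: "finite b" "E = span b" using E unfolding finite_dim_subspace_def by blast
  have GL: "G \<subseteq> L2 T" and WL: "W \<subseteq> L2 T" using G W by (auto simp: L2_closed_subspace_def)
  have BsL: "Bs \<subseteq> L2 T" using Bs WL by blast
  have B_L2: "(\<lambda>t. B (v t)) \<in> L2 T" if "v \<in> L2 T" for v
    using time.square_integrable_compose_bounded[OF L2_D[OF that] B] by (simp add: L2_eq)
  define y where "y u t = S t y0 + convolution S (\<lambda>t. B (u t)) t" for u t
  have y_L2: "y u \<in> L2 T" if "u \<in> L2 T" for u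
    unfolding y_def[abs_def] by (rule L2_convolution(1)[OF C0 T0 B_L2[OF that]])
  have conv_axpy: "convolution S (\<lambda>t. B (u t + c *\<^sub>R v t)) t
      = convolution S (\<lambda>t. B (u t)) t + c *\<^sub>R convolution S (\<lambda>t. B (v t)) t"
    if "u \<in> L2 T" "v \<in> L2 T" "t \<in> {0..T}" for u v c t
    using convolution_axpy[OF C0 that(3) L2_D[OF B_L2[OF that(1)]] L2_D[OF B_L2[OF that(2)]]]
    by (simp add: linear_simps(1,5)[OF B])
  have y_add: "y (\<lambda>t. u t + v t) t = y u t + convolution S (\<lambda>t. B (v t)) t"
    if "u \<in> L2 T" "v \<in> L2 T" "t \<in> {0..T}" for u v t
    using conv_axpy[OF that, of 1] by (simp add: y_def)
  have inner_conv_axpy: "L2_inner T (convolution S (\<lambda>t. B (u t + c *\<^sub>R v t))) w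
      = L2_inner T (convolution S (\<lambda>t. B (u t))) w + c * L2_inner T (convolution S (\<lambda>t. B (v t))) w"
    if "u \<in> L2 T" "v \<in> L2 T" "w \<in> L2 T" for u v w c
  proof -
    have "L2_inner T (convolution S (\<lambda>t. B (u t + c *\<^sub>R v t))) w
        = L2_inner T (\<lambda>t. convolution S (\<lambda>t. B (u t)) t + c *\<^sub>R convolution S (\<lambda>t. B (v t)) t) w"
      unfolding L2_inner_def using that
      by (intro Bochner_Integration.integral_cong) (auto simp: conv_axpy)
    also have "\<dots> = L2_inner T (convolution S (\<lambda>t. B (u t))) w + c * L2_inner T (convolution S (\<lambda>t. B (v t))) w"
      by (intro L2_inner_axpy L2_convolution(2)[OF C0 T0] B_L2 that)
    finally show ?thesis .
  qed
  have g0L: "g\<^sub>0 \<in> L2 T" and w0L: "w\<^sub>0 \<in> L2 T" using g0 GL w0 WL by auto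
  (* With the control g0 the projection onto G is the prescribed one, whereas y misses its prescribed
     projection onto W by the projection of r, and the final state misses y1 by y1 - y g0 T. The
     correction v, orthogonal to G, has to make up for these two defects. *)
  define r where "r = (\<lambda>t. w\<^sub>0 t - y g\<^sub>0 t)"
  have r: "r \<in> L2 T" unfolding r_def using L2_axpy[OF w0L y_L2[OF g0L], of "-1"] by simp
  define V where "V = {v \<in> L2 T. \<forall>g\<in>G. L2_inner T v g = 0}"
  have V0: "(\<lambda>t. 0) \<in> V" using G GL by (auto simp: V_def L2_inner_def L2_closed_subspace_def L2_eq
      square_integrable_def intro!: time.strongly_measurable_simple)
  have V_axpy: "(\<lambda>t. u t + c *\<^sub>R v t) \<in> V" if "u \<in> V" "v \<in> V" for u v c
    using that GL by (auto simp: V_def L2_axpy L2_inner_axpy subset_iff)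
  have "\<exists>v\<in>V. (\<forall>\<beta>\<in>Bs. L2_inner T (convolution S (\<lambda>t. B (v t))) \<beta> = L2_inner T r \<beta>) \<and>
      (\<forall>x\<in>span b. (convolution S (\<lambda>t. B (v t)) T - (y1 - y g\<^sub>0 T)) \<bullet> x = 0) \<and>
      norm (convolution S (\<lambda>t. B (v t)) T - (y1 - y g\<^sub>0 T)) \<le> \<epsilon>"
  proof (rule approximate_range_with_constraints[where axpy="\<lambda>x c y t. x t + c *\<^sub>R y t"])
    fix \<zeta> :: 'h and c :: "(real \<Rightarrow> 'h) \<Rightarrow> real"
    assume orth: "\<And>v. v \<in> V \<Longrightarrow> convolution S (\<lambda>t. B (v t)) T \<bullet> \<zeta>
      + (\<Sum>\<beta>\<in>Bs. c \<beta> * L2_inner T (convolution S (\<lambda>t. B (v t))) \<beta>) = 0"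
    define w where "w = (\<lambda>t. \<Sum>\<beta>\<in>Bs. c \<beta> *\<^sub>R \<beta> t)"
    have w: "w \<in> W" unfolding w_def by (rule L2_closed_subspace_sum[OF W Bs])
    have *: "\<zeta> = 0 \<and> (AE t in time_measure T. w t = 0)"
    proof (rule adjoint_data_zero_if_orthogonal[OF gen B T0 G W unique_continuation w])
      fix v assume "v \<in> L2 T" "\<And>g. g \<in> G \<Longrightarrow> L2_inner T v g = 0"
      then show "convolution S (\<lambda>t. B (v t)) T \<bullet> \<zeta> + L2_inner T (convolution S (\<lambda>t. B (v t))) w = 0"
        using orth[of v] unfolding w_def
        by (simp add: V_def L2_inner_sum_right[OF L2_convolution(2)[OF C0 T0 B_L2] BsL])
    qed
    then have "AE t in time_measure T. w t = (\<lambda>_. 0) t" by simp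
    from L2_inner_cong_AE_right[OF r _ this] have "L2_inner T r w = 0"
      using w WL by (auto simp: L2_inner_def)
    then show "\<zeta> = 0 \<and> (\<Sum>\<beta>\<in>Bs. c \<beta> * L2_inner T r \<beta>) = 0"
      using * by (simp add: w_def L2_inner_sum_right[OF r BsL])
  qed (use V0 V_axpy \<epsilon> Bs b BsL T0 in \<open>auto simp: V_def intro!: conv_axpy inner_conv_axpy\<close>)
  then obtain v where v: "v \<in> V"
    and vW: "\<And>\<beta>. \<beta> \<in> Bs \<Longrightarrow> L2_inner T (convolution S (\<lambda>t. B (v t))) \<beta> = L2_inner T r \<beta>"
    and vE: "\<And>x. x \<in> E \<Longrightarrow> (convolution S (\<lambda>t. B (v t)) T - (y1 - y g\<^sub>0 T)) \<bullet> x = 0"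
    and v\<epsilon>: "norm (convolution S (\<lambda>t. B (v t)) T - (y1 - y g\<^sub>0 T)) \<le> \<epsilon>"
    using b by blast
  have vL: "v \<in> L2 T" using v by (simp add: V_def)
  define u where "u = (\<lambda>t. g\<^sub>0 t + v t)"
  have u: "u \<in> L2 T" using L2_axpy[OF g0L vL, of 1] by (simp add: u_def)
  have yu: "y u t = y g\<^sub>0 t + convolution S (\<lambda>t. B (v t)) t" if "t \<in> {0..T}" for t
    unfolding u_def by (rule y_add[OF g0L vL that])
  have yuT: "y u T - y1 = convolution S (\<lambda>t. B (v t)) T - (y1 - y g\<^sub>0 T)"
    using yu[of T] T0 by simp
  show "\<exists>u\<in>L2 T. L2_proj T G u g\<^sub>0 \<and>
      (\<exists>y. mild_solution T A (\<lambda>t. B (u t)) y0 y \<and>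
           norm (y T - y1) \<le> \<epsilon> \<and> L2_proj T W y w\<^sub>0 \<and> orth_proj E (y T) = orth_proj E y1)"
  proof (intro bexI[OF _ u] exI conjI)
    show "L2_proj T G u g\<^sub>0"
      using u g0 v by (simp add: L2_proj_def u_def V_def)
    show "mild_solution T A (\<lambda>t. B (u t)) y0 (y u)"
      unfolding mild_solution_def
    proof (intro exI conjI ballI)
      fix t assume t: "t \<in> {0..T}"
      note Bu = L2_D[OF B_L2[OF u]]
      show "has_strong_integral (lebesgue_on {0..t}) (\<lambda>s. S (t - s) (B (u s))) (y u t - S t y0)"
        using convolution_characterization(1)[OF C0 _ time.square_integrable_norm[OF Bu] t] Bu
        by (simp add: y_def square_integrable_def)
    qed (rule gen)
    show "norm (y u T - y1) \<le> \<epsilon>" using v\<epsilon> by (simp add: yuT)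
    show "L2_proj T W (y u) w\<^sub>0"
      unfolding L2_proj_def
    proof (intro conjI ballI y_L2 u w0)
      fix f assume f: "f \<in> W"
      then obtain c where c: "AE t in time_measure T. f t = (\<Sum>\<beta>\<in>Bs. c \<beta> *\<^sub>R \<beta> t)" using span_W by blast
      have d: "(\<lambda>t. y u t - w\<^sub>0 t) \<in> L2 T" using L2_axpy[OF y_L2[OF u] w0L, of "-1"] by simp
      have "L2_inner T (\<lambda>t. y u t - w\<^sub>0 t) \<beta> = 0" if "\<beta> \<in> Bs" for \<beta>
      proof -
        have "L2_inner T (\<lambda>t. y u t - w\<^sub>0 t) \<beta> = L2_inner T (\<lambda>t. convolution S (\<lambda>t. B (v t)) t - r t) \<beta>"
          unfolding L2_inner_def
          by (intro Bochner_Integration.integral_cong) (auto simp: yu r_def algebra_simps)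
        also have "\<dots> = L2_inner T (convolution S (\<lambda>t. B (v t))) \<beta> - L2_inner T r \<beta>"
          using that BsL by (intro L2_inner_diff L2_convolution(2)[OF C0 T0] B_L2 vL r) auto
        finally show ?thesis using vW[OF that] by simp
      qed
      then have "L2_inner T (\<lambda>t. y u t - w\<^sub>0 t) (\<lambda>t. \<Sum>\<beta>\<in>Bs. c \<beta> *\<^sub>R \<beta> t) = 0"
        by (simp add: L2_inner_sum_right[OF d BsL])
      then show "L2_inner T (\<lambda>t. y u t - w\<^sub>0 t) f = 0"
        using L2_inner_cong_AE_right[OF d _ c] f WL by auto
    qed
    have "orthogonal (y u T - p) x \<longleftrightarrow> orthogonal (y1 - p) x" if "x \<in> E" for p x
      using vE[OF that] unfolding yuT[symmetric] by (auto simp: orthogonal_def inner_diff_left)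
    then show "orth_proj E (y u T) = orth_proj E y1" unfolding orth_proj_def by simp
  qed
qed

end
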